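(* Let $d\ge1$, $s\in(0,1)$, $\lambda,\Lambda>0$, $\rho\ge0$, $A\ge0$, $R_0>0$, $R\in(\rho,R_0]$ with $R>2\rho$, and $u\in L^\infty(\mathbb R^d\times I_R)$. Suppose that either (a) $s\ge1/2$ and $u$ satisfies, in the viscosity sense, $$\partial_tu-\Lambda|\nabla u|-\mathcal M_\rho^+u\le A\quad\text{and}\quad\partial_tu+\Lambda|\nabla u|-\mathcal M_\rho^-u\ge-A\quad\text{in }Q_R,$$ or (b) $u$ satisfies, in the viscosity sense, $$\partial_tu-\mathcal M_\rho^+u\le A\quad\text{and}\quad\partial_tu-\mathcal M_\rho^-u\ge-A\quad\text{in }Q_R.$$ Then there exist $\alpha\in(0,2s)$ and $C>0$ depending only on $d,s,\lambda,\Lambda$ and $R_0$ such that $$\sup_{\substack{(x,t),(y,\tau)\in Q_{R/4}\\ d((x,t),(y,\tau))>\rho}}\frac{|u(x,t)-u(y,\tau)|}{d((x,t),(y,\tau))^\alpha}\le\frac{C}{R^\alpha}\left(\|u\|_{L^\infty(\mathbb R^d\times I_R)}+R^{2s}A\right).$$ In case (b), $\alpha$ and $C$ do not depend on $R_0$.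
   Context: Notation: $B_R(x)=\{y\in\mathbb R^d:|x-y|<R\}$, $B_R=B_R(0)$, $I_R=(-R^{2s},0]$, $Q_R=B_R\times I_R$, $d((x,t),(y,\tau))=\max\{|x-y|,|t-\tau|^{1/(2s)}\}$. Kernels: with the convention that $\rho^{-d-2s}=\infty$ if $\rho=0$ (so $\min\{|y|^{-d-2s},\rho^{-d-2s}\}=|y|^{-d-2s}$), $\mathcal K_\rho$ is the set of all measurable $K:\mathbb R^d\to[0,\infty)$ such that (1) $K(y)\ge\lambda\min\{|y|^{-d-2s},\rho^{-d-2s}\}$ for all $y\ne0$; (2) $\int_{B_{2r}\setminus B_r}K(y)\,dy\le\Lambda r^{-2s}$ for all $r>0$; (3) if $s=1/2$, additionally $\int_{B_{2r}\setminus B_r}yK(y)\,dy=0$ for all $r>0$. Operators (acting in space): $\delta_yu(x)=u(x+y)-u(x)$ if $s<1/2$; $\delta_yu(x)=u(x+y)-u(x)-y\cdot\nabla u(x)\mathbf 1_{B_1}(y)$ if $s=1/2$; $\delta_yu(x)=u(x+y)-u(x)-y\cdot\nabla u(x)$ if $s>1/2$. $L_Ku(x)=\int_{\mathbb R^d}\delta_yu(x)K(y)\,dy$, $\mathcal M_\rho^-u(x)=\inf_{K\in\mathcal K_\rho}L_Ku(x)$, $\mathcal M_\rho^+u(x)=\sup_{K\in\mathcal K_\rho}L_Ku(x)$. It is tacitly assumed that $\mathcal K_\rho\neq\emptyset$. Since functions are evaluated pointwise, $L^\infty(\mathbb R^d\times I)$ means bounded Borel measurable functions defined everywhere, with the supremum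 norm. Viscosity sense: let $\Omega\subseteq\mathbb R^d$ be a domain, $I\subseteq(-\infty,0]$ a left-open interval, $f:\Omega\times I\to\mathbb R$, and let $F(v)$ be one of $\mathcal M_\rho^{+}v+\Lambda|\nabla v|$, $\mathcal M_\rho^{-}v-\Lambda|\nabla v|$, $\mathcal M_\rho^\pm v$; $\partial_t$ is the left derivative in time. A function $u\in L^\infty(\mathbb R^d\times I)$ that is upper semicontinuous in $\Omega\times I$ satisfies $\partial_tu-F(u)\le f$ in $\Omega\times I$ in the viscosity sense if for every $(x_0,t_0)\in\Omega\times I$, every $\varepsilon>0$ with $B_\varepsilon(x_0)\times(t_0-\varepsilon,t_0]\subseteq\Omega\times I$ and every $\varphi:B_\varepsilon(x_0)\times(t_0-\varepsilon,t_0]\to\mathbb R$ that is left-differentiable in time and $C^{1,1}$ in space with $u(x_0,t_0)=\varphi(x_0,t_0)$ and $u\le\varphi$ in $B_\varepsilon(x_0)\times(t_0-\varepsilon,t_0]$, the function $v$ equal to $\varphi$ in $B_\varepsilon(x_0)\times(t_0-\varepsilon,t_0]$ and to $u$ elsewhere in $\mathbb R^d\times I$ satisfies $\partial_tv(x_0,t_0)-F(v)(x_0,t_0)\le f(x_0,t_0)$. A function $u\in L^\infty(\mathbb R^d\times I)$ that is lower semicontinuous in $\Omega\times I$ satisfies $\partial_tu-F(u)\ge f$ in the viscosity sense if the same holds with $u\ge\varphi$ in place of $u\le\varphi$ and $\partial_tv(x_0,t_0)-F(v)(x_0,t_0)\ge f(x_0,t_0)$ as conclusion. *)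

theory Defs
  imports "HOL-Analysis.Analysis"
begin

text \<open>Points of space-time are pairs \<open>(x, t)\<close>; the space dimension is \<open>CARD('n)\<close>.
  The parameters \<open>lam\<close> and \<open>Lam\<close> are the ellipticity constants.\<close>

subsection \<open>Parabolic geometry\<close>

definition time_interval :: "real \<Rightarrow> real \<Rightarrow> real set" where
  "time_interval s R = {- (R powr (2 * s)) <.. 0}"

definition par_cyl :: "real \<Rightarrow> real \<Rightarrow> ((real^'n) \<times> real) set" where
  "par_cyl s R = ball 0 R \<times> time_interval s R"

definition par_dist :: "real \<Rightarrow> (real^'n) \<times> real \<Rightarrow> (real^'n) \<times> real \<Rightarrow> real" where
  "par_dist s p q = max (norm (fst p - fst q)) (\<bar>snd p - snd q\<bar> powr (1 / (2 * s)))"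

text \<open>The supremum is taken in \<open>ereal\<close>, since it need not be finite a priori if \<open>\<rho> = 0\<close>.\<close>

definition holder_above ::
  "real \<Rightarrow> real \<Rightarrow> real \<Rightarrow> ((real^'n) \<times> real) set \<Rightarrow> ((real^'n) \<times> real \<Rightarrow> real) \<Rightarrow> ereal" where
  "holder_above s \<alpha> \<rho> S u =
     (SUP (p, q) \<in> {(p, q). p \<in> S \<and> q \<in> S \<and> \<rho> < par_dist s p q}.
        ereal (\<bar>u p - u q\<bar> / par_dist s p q powr \<alpha>))"

subsection \<open>Bounded Borel functions and semicontinuity\<close>

text \<open>Only the values on the given set matter; \<open>sup_norm\<close> is meaningful for members of
  \<open>bounded_borel\<close> on a nonempty set.\<close>

definition bounded_borel :: "'a::topological_space set \<Rightarrow> ('a \<Rightarrow> real) set" where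
  "bounded_borel S = {u. u \<in> borel_measurable (restrict_space borel S) \<and> bounded (u ` S)}"

definition sup_norm :: "'a set \<Rightarrow> ('a \<Rightarrow> real) \<Rightarrow> real" where
  "sup_norm S u = (SUP p\<in>S. \<bar>u p\<bar>)"

definition usc_on :: "'a::topological_space set \<Rightarrow> ('a \<Rightarrow> real) \<Rightarrow> bool" where
  "usc_on S u \<longleftrightarrow> (\<forall>p\<in>S. \<forall>a > u p. \<forall>\<^sub>F q in at p within S. u q < a)"

definition lsc_on :: "'a::topological_space set \<Rightarrow> ('a \<Rightarrow> real) \<Rightarrow> bool" where
  "lsc_on S u \<longleftrightarrow> (\<forall>p\<in>S. \<forall>a < u p. \<forall>\<^sub>F q in at p within S. a < u q)"

subsection \<open>Kernels\<close>

text \<open>\<open>min {|y|^(-d-2s), \<rho>^(-d-2s)}\<close> with the convention \<open>0^(-d-2s) = \<infinity>\<close>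
  (whereas \<open>0 powr a = 0\<close> in HOL).\<close>

definition trunc_kernel :: "real \<Rightarrow> real \<Rightarrow> real^'n \<Rightarrow> real" where
  "trunc_kernel s \<rho> y =
     (let e = - real CARD('n) - 2 * s
      in if \<rho> = 0 then norm y powr e else min (norm y powr e) (\<rho> powr e))"

definition kernels :: "real \<Rightarrow> real \<Rightarrow> real \<Rightarrow> real \<Rightarrow> (real^'n \<Rightarrow> real) set" where
  "kernels s lam Lam \<rho> = {K.
     K \<in> borel_measurable lebesgue \<and> (\<forall>y. 0 \<le> K y) \<and>
     (\<forall>y. y \<noteq> 0 \<longrightarrow> lam * trunc_kernel s \<rho> y \<le> K y) \<and>
     (\<forall>r>0. (\<integral>\<^sup>+y \<in> ball 0 (2 * r) - ball 0 r. ennreal (K y) \<partial>lebesgue)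
               \<le> ennreal (Lam * r powr (- 2 * s))) \<and>
     (s = 1 / 2 \<longrightarrow>
        (\<forall>r>0. set_lebesgue_integral lebesgue (ball 0 (2 * r) - ball 0 r) (\<lambda>y. K y *\<^sub>R y) = 0))}"

subsection \<open>Nonlocal operators\<close>

definition grad :: "('a::real_inner \<Rightarrow> real) \<Rightarrow> 'a \<Rightarrow> 'a" where
  "grad w x = (THE D. GDERIV w x :> D)"

definition delta :: "real \<Rightarrow> (real^'n \<Rightarrow> real) \<Rightarrow> real^'n \<Rightarrow> real^'n \<Rightarrow> real" where
  "delta s w x y =
     (if s < 1 / 2 then w (x + y) - w x
      else if s = 1 / 2 then w (x + y) - w x - (y \<bullet> grad w x) * indicator (ball 0 1) y
      else w (x + y) - w x - y \<bullet> grad w x)"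

definition nonlocal_op :: "real \<Rightarrow> (real^'n \<Rightarrow> real) \<Rightarrow> (real^'n \<Rightarrow> real) \<Rightarrow> real^'n \<Rightarrow> real" where
  "nonlocal_op s K w x = (\<integral>y. delta s w x y * K y \<partial>lebesgue)"

text \<open>The operators below are only evaluated at bounded Borel functions that are \<open>C\<^sup>1\<^sup>,\<^sup>1\<close> near
  \<open>x\<close>. For these, the integrals converge absolutely, and they are bounded uniformly over the
  kernels; hence \<open>Inf\<close> and \<open>Sup\<close> in \<open>real\<close> are the true ones if \<open>kernels s lam Lam \<rho>\<close> is
  nonempty.\<close>

definition M_minus ::
  "real \<Rightarrow> real \<Rightarrow> real \<Rightarrow> real \<Rightarrow> (real^'n \<Rightarrow> real) \<Rightarrow> real^'n \<Rightarrow> real" where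
  "M_minus s lam Lam \<rho> w x = (INF K\<in>kernels s lam Lam \<rho>. nonlocal_op s K w x)"

definition M_plus ::
  "real \<Rightarrow> real \<Rightarrow> real \<Rightarrow> real \<Rightarrow> (real^'n \<Rightarrow> real) \<Rightarrow> real^'n \<Rightarrow> real" where
  "M_plus s lam Lam \<rho> w x = (SUP K\<in>kernels s lam Lam \<rho>. nonlocal_op s K w x)"

subsection \<open>Viscosity sub- and supersolutions\<close>

definition C11_on :: "'a::real_inner set \<Rightarrow> ('a \<Rightarrow> real) \<Rightarrow> bool" where
  "C11_on S w \<longleftrightarrow> (\<exists>g L. (\<forall>x\<in>S. GDERIV w x :> g x) \<and> L-lipschitz_on S g)"

definition back_cyl :: "real \<Rightarrow> (real^'n) \<times> real \<Rightarrow> ((real^'n) \<times> real) set" where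
  "back_cyl \<epsilon> p = ball (fst p) \<epsilon> \<times> {snd p - \<epsilon> <.. snd p}"

definition test_fun :: "real \<Rightarrow> (real^'n) \<times> real \<Rightarrow> ((real^'n) \<times> real \<Rightarrow> real) \<Rightarrow> bool" where
  "test_fun \<epsilon> p \<phi> \<longleftrightarrow>
     (\<forall>(x, t) \<in> back_cyl \<epsilon> p. (\<lambda>\<tau>. \<phi> (x, \<tau>)) differentiable (at_left t)) \<and>
     (\<forall>t \<in> {snd p - \<epsilon> <.. snd p}. C11_on (ball (fst p) \<epsilon>) (\<lambda>x. \<phi> (x, t)))"

definition left_dt :: "((real^'n) \<times> real \<Rightarrow> real) \<Rightarrow> (real^'n) \<times> real \<Rightarrow> real" where
  "left_dt v p = vector_derivative (\<lambda>\<tau>. v (fst p, \<tau>)) (at_left (snd p))"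

text \<open>\<open>F\<close> maps a function on space and a point to a real; it acts on the time slices.\<close>

definition visc_sub ::
  "(real^'n) set \<Rightarrow> real set \<Rightarrow> ((real^'n \<Rightarrow> real) \<Rightarrow> real^'n \<Rightarrow> real) \<Rightarrow>
     ((real^'n) \<times> real \<Rightarrow> real) \<Rightarrow> ((real^'n) \<times> real \<Rightarrow> real) \<Rightarrow> bool" where
  "visc_sub \<Omega> I F f u \<longleftrightarrow>
     u \<in> bounded_borel (UNIV \<times> I) \<and> usc_on (\<Omega> \<times> I) u \<and>
     (\<forall>p \<in> \<Omega> \<times> I. \<forall>\<epsilon>>0. \<forall>\<phi>.
        back_cyl \<epsilon> p \<subseteq> \<Omega> \<times> I \<and> test_fun \<epsilon> p \<phi> \<and> u p = \<phi> p \<and> (\<forall>q \<in> back_cyl \<epsilon> p. u q \<le> \<phi> q) \<longrightarrow>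
        (let v = (\<lambda>q. if q \<in> back_cyl \<epsilon> p then \<phi> q else u q)
         in left_dt v p - F (\<lambda>x. v (x, snd p)) (fst p) \<le> f p))"

definition visc_super ::
  "(real^'n) set \<Rightarrow> real set \<Rightarrow> ((real^'n \<Rightarrow> real) \<Rightarrow> real^'n \<Rightarrow> real) \<Rightarrow>
     ((real^'n) \<times> real \<Rightarrow> real) \<Rightarrow> ((real^'n) \<times> real \<Rightarrow> real) \<Rightarrow> bool" where
  "visc_super \<Omega> I F f u \<longleftrightarrow>
     u \<in> bounded_borel (UNIV \<times> I) \<and> lsc_on (\<Omega> \<times> I) u \<and>
     (\<forall>p \<in> \<Omega> \<times> I. \<forall>\<epsilon>>0. \<forall>\<phi>.
        back_cyl \<epsilon> p \<subseteq> \<Omega> \<times> I \<and> test_fun \<epsilon> p \<phi> \<and> u p = \<phi> p \<and> (\<forall>q \<in> back_cyl \<epsilon> p. u q \<ge> \<phi> q) \<longrightarrow>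
        (let v = (\<lambda>q. if q \<in> back_cyl \<epsilon> p then \<phi> q else u q)
         in left_dt v p - F (\<lambda>x. v (x, snd p)) (fst p) \<ge> f p))"

definition solves_with_drift ::
  "real \<Rightarrow> real \<Rightarrow> real \<Rightarrow> real \<Rightarrow> real \<Rightarrow> real \<Rightarrow> ((real^'n) \<times> real \<Rightarrow> real) \<Rightarrow> bool" where
  "solves_with_drift s lam Lam \<rho> A R u \<longleftrightarrow>
     visc_sub (ball 0 R) (time_interval s R)
       (\<lambda>w x. M_plus s lam Lam \<rho> w x + Lam * norm (grad w x)) (\<lambda>_. A) u \<and>
     visc_super (ball 0 R) (time_interval s R)
       (\<lambda>w x. M_minus s lam Lam \<rho> w x - Lam * norm (grad w x)) (\<lambda>_. - A) u"

definition solves_without_drift ::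
  "real \<Rightarrow> real \<Rightarrow> real \<Rightarrow> real \<Rightarrow> real \<Rightarrow> real \<Rightarrow> ((real^'n) \<times> real \<Rightarrow> real) \<Rightarrow> bool" where
  "solves_without_drift s lam Lam \<rho> A R u \<longleftrightarrow>
     visc_sub (ball 0 R) (time_interval s R) (M_plus s lam Lam \<rho>) (\<lambda>_. A) u \<and>
     visc_super (ball 0 R) (time_interval s R) (M_minus s lam Lam \<rho>) (\<lambda>_. - A) u"

end

theory Submission
  imports Defs
begin

text \<open>The estimate is an improvement of oscillation, iterated over the radii \<open>\<sigma>^j * r0\<close>. Assume that
\<open>u \<le> M\<close> on a cylinder of radius \<open>r \<ge> \<rho>\<close> around \<open>(x0, t0)\<close> and that \<open>u < M - h / 2\<close> on at least half of a
smaller, earlier cylinder. Then \<open>u \<le> M - \<theta> * h\<close> on a smaller, later one, with \<open>\<theta>\<close> independent of \<open>\<rho>\<close> and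
\<open>r\<close> (\<open>diminish_of_oscillation\<close>). Either \<open>u\<close> or \<open>- u\<close> satisfies the measure condition, so the oscillation
drops by a fixed factor.

Kernels in the class are bounded above only on average, but on \<open>ball 0 r\<close> they are bounded below by
\<open>lam * r powr (- d - 2 * s)\<close> as soon as \<open>r \<ge> \<rho>\<close>. Hence the operator feels the low set from every point of
the cylinder, with a strength proportional to its measure, and no ABP estimate is needed. The
comparison function is \<open>M - h * m t * b x\<close> with a fixed bump \<open>b\<close> and with the solution \<open>m\<close> of
\<open>m' = \<kappa> * S t - C * r powr (- 2 * s) * m\<close>, where \<open>S t\<close> is, up to a continuous approximation, the measure
of the low set at time \<open>t\<close>. At a first contact point the low set contributes at least \<open>h * \<kappa> * S t\<close>
(\<open>touching_bound\<close>), which pays for \<open>m'\<close>; the rest is the barrier inequality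
\<open>L b - B * norm (grad b) \<ge> - C * r powr (- 2 * s) * b\<close> (\<open>bump_barrier\<close>). The latter holds up to the
boundary of the support, because \<open>grad b\<close> is of order \<open>sqrt b\<close> there, while \<open>L b\<close> stays positive where
\<open>b\<close> is small. This is also what absorbs the drift, even in the critical case \<open>s = 1 / 2\<close>.

All estimates are made directly at scale \<open>r\<close>. Scaling the equation would not be exact for \<open>s = 1 / 2\<close>,
where the gradient correction is cut off at the fixed radius \<open>1\<close>; moving that radius to \<open>r\<close> costs a
drift of size \<open>r powr (1 - 2 * s)\<close>, by the cancellation condition (\<open>cutoff_drift\<close>). The size of the drift
enters only through a bound \<open>B1\<close> for \<open>B * r powr (2 * s - 1)\<close>: with \<open>B = Lam\<close> and \<open>s \<ge> 1 / 2\<close> this bound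
depends on \<open>R0\<close>, without drift it is \<open>0\<close>. In the iteration the bounds from the larger scales
make \<open>u\<close> grow at most like \<open>|x - x0|^\<alpha>\<close> outside the current cylinder (\<open>osc_inv\<close>), which is negligible if \<open>\<alpha>\<close>
is small (\<open>powr_minus_one_le\<close>). The iteration stops at the scale \<open>\<rho>\<close>, which is why only pairs of points at
a distance above \<open>\<rho>\<close> are compared.\<close>

section \<open>Dyadic moments of the kernels\<close>

definition annulus :: "real \<Rightarrow> (real^'n) set" where
  "annulus a = ball 0 (2 * a) - ball 0 a"

lemma annulus_iff: "y \<in> annulus a \<longleftrightarrow> a \<le> norm y \<and> norm y < 2 * a"
  by (auto simp: annulus_def dist_norm)

lemma annulus_sets [measurable]: "annulus a \<in> sets lebesgue"
  unfolding annulus_def by auto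

lemma kernelsD:
  assumes "K \<in> kernels s lam Lam \<rho>"
  shows "K \<in> borel_measurable lebesgue" "0 \<le> K y"
    "y \<noteq> 0 \<Longrightarrow> lam * trunc_kernel s \<rho> y \<le> K y"
    "0 < r \<Longrightarrow> (\<integral>\<^sup>+y \<in> annulus r. ennreal (K y) \<partial>lebesgue) \<le> ennreal (Lam * r powr (- 2 * s))"
    "s = 1/2 \<Longrightarrow> 0 < r \<Longrightarrow> set_lebesgue_integral lebesgue (annulus r) (\<lambda>y. K y *\<^sub>R y) = 0"
  using assms unfolding kernels_def annulus_def by auto

lemma norm_powr_measurable [measurable]:
  "(\<lambda>x::real^'n. norm x powr p) \<in> borel_measurable lebesgue"
  by (rule measurable_completion) measurable

lemma annulus_moment:
  fixes K :: "real^'n \<Rightarrow> real"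
  assumes K: "K \<in> kernels s lam Lam \<rho>" and a: "0 < a" and p: "0 \<le> p"
  shows "(\<integral>\<^sup>+y \<in> annulus a. ennreal (norm y powr p * K y) \<partial>lebesgue)
           \<le> ennreal ((2 * a) powr p * (Lam * a powr (- 2 * s)))"
proof -
  note [measurable] = kernelsD(1)[OF K]
  have "(\<integral>\<^sup>+y \<in> annulus a. ennreal (norm y powr p * K y) \<partial>lebesgue)
      \<le> (\<integral>\<^sup>+y. ennreal ((2 * a) powr p) * (ennreal (K y) * indicator (annulus a) y) \<partial>lebesgue)"
  proof (rule nn_integral_mono)
    fix y :: "real^'n"
    show "ennreal (norm y powr p * K y) * indicator (annulus a) y
        \<le> ennreal ((2 * a) powr p) * (ennreal (K y) * indicator (annulus a) y)"
    proof (cases "y \<in> annulus a")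
      case True
      then have "norm y powr p \<le> (2 * a) powr p"
        using a p by (intro powr_mono2) (auto simp: annulus_iff)
      then have "norm y powr p * K y \<le> (2 * a) powr p * K y"
        using kernelsD(2)[OF K] by (intro mult_right_mono) auto
      then show ?thesis using True kernelsD(2)[OF K, of y]
        by (auto simp: ennreal_mult[symmetric])
    qed auto
  qed
  also have "\<dots> = ennreal ((2 * a) powr p) * (\<integral>\<^sup>+y \<in> annulus a. ennreal (K y) \<partial>lebesgue)"
    by (rule nn_integral_cmult) simp
  also have "\<dots> \<le> ennreal ((2 * a) powr p) * ennreal (Lam * a powr (- 2 * s))"
    by (intro mult_left_mono kernelsD(4)[OF K a]) auto
  also have "\<dots> = ennreal ((2 * a) powr p * (Lam * a powr (- 2 * s)))"
    by (simp add: ennreal_mult')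
  finally show ?thesis .
qed

text \<open>The kernel condition controls each annulus, so every moment is a geometric series over dyadic annuli,
taken outwards (\<open>outer_moment\<close>) or inwards (\<open>inner_moment\<close>).\<close>

lemma dyadic_moment:
  fixes K :: "real^'n \<Rightarrow> real"
  assumes K: "K \<in> kernels s lam Lam \<rho>" and Lam: "0 \<le> Lam" and p: "0 \<le> p"
    and S: "S \<subseteq> (\<Union>k. annulus (a k))" and a: "\<And>k. 0 < a k"
    and sums: "(\<lambda>k. (2 * a k) powr p * (Lam * a k powr (- 2 * s))) sums c"
  shows "(\<integral>\<^sup>+y \<in> S. ennreal (norm y powr p * K y) \<partial>lebesgue) \<le> ennreal c"
proof -
  note [measurable] = kernelsD(1)[OF K]
  let ?f = "\<lambda>k y. ennreal (norm y powr p * K y) * indicator (annulus (a k)) y"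
  have "(\<integral>\<^sup>+y \<in> S. ennreal (norm y powr p * K y) \<partial>lebesgue) \<le> (\<integral>\<^sup>+y. (\<Sum>k. ?f k y) \<partial>lebesgue)"
  proof (rule nn_integral_mono)
    fix y
    show "ennreal (norm y powr p * K y) * indicator S y \<le> (\<Sum>k. ?f k y)"
    proof (cases "y \<in> S")
      case True
      then obtain k where k: "y \<in> annulus (a k)" using S by auto
      have "(\<Sum>i\<in>{k}. ?f i y) \<le> (\<Sum>i. ?f i y)"
        by (intro sum_le_suminf summableI) auto
      then show ?thesis using k True
        by (simp only: sum.insert_if sum.empty finite.emptyI empty_iff if_False add_0_right indicator_simps)
    qed auto
  qed
  also have "\<dots> = (\<Sum>k. \<integral>\<^sup>+y. ?f k y \<partial>lebesgue)"
    by (rule nn_integral_suminf) simp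
  also have "\<dots> \<le> (\<Sum>k. ennreal ((2 * a k) powr p * (Lam * a k powr (- 2 * s))))"
    by (intro suminf_le summableI annulus_moment[OF K a p])
  also have "\<dots> = ennreal c"
    using sums Lam by (intro suminf_ennreal_eq) auto
  finally show ?thesis .
qed

definition outer_const :: "real \<Rightarrow> real \<Rightarrow> real \<Rightarrow> real" where
  "outer_const Lam s p = Lam * 2 powr p / (1 - 2 powr (p - 2 * s))"

definition inner_const :: "real \<Rightarrow> real \<Rightarrow> real \<Rightarrow> real" where
  "inner_const Lam s p = Lam * 2 powr (2 * s) / (1 - 2 powr (2 * s - p))"

lemma outer_const_nonneg: "0 \<le> Lam \<Longrightarrow> p < 2 * s \<Longrightarrow> 0 \<le> outer_const Lam s p"
  unfolding outer_const_def using powr_mono[of "p - 2 * s" 0 2] by (intro divide_nonneg_nonneg) auto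

lemma inner_const_nonneg: "0 \<le> Lam \<Longrightarrow> 2 * s < p \<Longrightarrow> 0 \<le> inner_const Lam s p"
  unfolding inner_const_def using powr_mono[of "2 * s - p" 0 2] by (intro divide_nonneg_nonneg) auto

lemma dyadic_bracket:
  assumes "0 < r" "r \<le> (x::real)"
  obtains k where "r * 2 ^ k \<le> x" "x < r * 2 ^ Suc k"
proof -
  obtain n where n: "x / r < 2 ^ n"
    using real_arch_pow[of 2 "x / r"] by auto
  define m where "m = (LEAST n. x < r * 2 ^ n)"
  have ex: "x < r * 2 ^ n" using n assms by (simp add: field_simps)
  then have m: "x < r * 2 ^ m" unfolding m_def by (rule LeastI)
  have "m \<noteq> 0" using m assms by (cases m) auto
  then obtain k where k: "m = Suc k" by (cases m) auto
  have "\<not> x < r * 2 ^ k" using not_less_Least[of k "\<lambda>n. x < r * 2 ^ n"] k m_def by auto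
  then show ?thesis using that[of k] m k by simp
qed

lemma outer_moment:
  fixes K :: "real^'n \<Rightarrow> real"
  assumes K: "K \<in> kernels s lam Lam \<rho>" and Lam: "0 \<le> Lam" and p: "0 \<le> p" "p < 2 * s"
    and r: "0 < r"
  shows "(\<integral>\<^sup>+y \<in> - ball 0 r. ennreal (norm y powr p * K y) \<partial>lebesgue)
           \<le> ennreal (outer_const Lam s p * r powr (p - 2 * s))"
proof (rule dyadic_moment[OF K Lam p(1), where a = "\<lambda>k. r * 2 ^ k"])
  show "- ball (0::real^'n) r \<subseteq> (\<Union>k. annulus (r * 2 ^ k))"
  proof
    fix y :: "real^'n" assume "y \<in> - ball 0 r"
    then have "r \<le> norm y" by auto
    from dyadic_bracket[OF r this] obtain k where "r * 2 ^ k \<le> norm y" "norm y < r * 2 ^ Suc k" .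
    then show "y \<in> (\<Union>k. annulus (r * 2 ^ k))" by (auto simp: annulus_iff)
  qed
  have "(2 * (r * 2 ^ k)) powr p * (Lam * (r * 2 ^ k) powr (- 2 * s))
      = Lam * 2 powr p * r powr (p - 2 * s) * (2 powr (p - 2 * s)) ^ k" for k
  proof -
    have "(r * 2 ^ k) powr p * (r * 2 ^ k) powr (- 2 * s) = (r * 2 ^ k) powr (p - 2 * s)"
      using r by (simp add: powr_add[symmetric])
    also have "\<dots> = r powr (p - 2 * s) * (2 powr (p - 2 * s)) ^ k"
      using r by (simp add: powr_mult powr_powr powr_realpow[symmetric] mult.commute)
    finally show ?thesis using r by (simp add: powr_mult mult_ac)
  qed
  moreover have "(\<lambda>k. Lam * 2 powr p * r powr (p - 2 * s) * (2 powr (p - 2 * s)) ^ k) sums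
      (Lam * 2 powr p * r powr (p - 2 * s) * (1 / (1 - 2 powr (p - 2 * s))))"
    using p by (intro sums_mult geometric_sums) (auto simp: powr_less_one)
  ultimately show "(\<lambda>k. (2 * (r * 2 ^ k)) powr p * (Lam * (r * 2 ^ k) powr (- 2 * s))) sums
      (outer_const Lam s p * r powr (p - 2 * s))"
    by (simp only: outer_const_def mult_ac times_divide_eq_left times_divide_eq_right mult_1_left)
qed (use r in auto)

lemma inner_moment:
  fixes K :: "real^'n \<Rightarrow> real"
  assumes K: "K \<in> kernels s lam Lam \<rho>" and Lam: "0 \<le> Lam" and p: "0 \<le> p" "2 * s < p"
    and r: "0 < r"
  shows "(\<integral>\<^sup>+y \<in> ball 0 r - {0}. ennreal (norm y powr p * K y) \<partial>lebesgue)
           \<le> ennreal (inner_const Lam s p * r powr (p - 2 * s))"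
proof (rule dyadic_moment[OF K Lam p(1), where a = "\<lambda>k. r / 2 ^ Suc k"])
  show "ball (0::real^'n) r - {0} \<subseteq> (\<Union>k. annulus (r / 2 ^ Suc k))"
  proof
    fix y :: "real^'n" assume y: "y \<in> ball 0 r - {0}"
    then have n: "0 < norm y" "norm y < r" by auto
    then obtain k where "norm y * 2 ^ k \<le> r" "r < norm y * 2 ^ Suc k"
      using dyadic_bracket[of "norm y" r] by force
    show "y \<in> (\<Union>k. annulus (r / 2 ^ Suc k))"
    proof (cases "norm y * 2 ^ k = r")
      case True
      then have "k \<noteq> 0" using n by (cases k) auto
      then obtain j where "k = Suc j" by (cases k) auto
      then show ?thesis using True n by (auto simp: annulus_iff field_simps intro!: exI[of _ j])
    next
      case False
      then show ?thesis using \<open>norm y * 2 ^ k \<le> r\<close> \<open>r < norm y * 2 ^ Suc k\<close> 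
        by (auto simp: annulus_iff field_simps intro!: exI[of _ k])
    qed
  qed
  have "(2 * (r / 2 ^ Suc k)) powr p * (Lam * (r / 2 ^ Suc k) powr (- 2 * s))
      = Lam * 2 powr (2 * s) * r powr (p - 2 * s) * (2 powr (2 * s - p)) ^ k" for k
  proof -
    have "(r / 2 ^ k) powr p * (r / 2 ^ k) powr (- 2 * s) = (r / 2 ^ k) powr (p - 2 * s)"
      using r by (simp add: powr_add[symmetric])
    also have "\<dots> = r powr (p - 2 * s) * (2 powr (2 * s - p)) ^ k"
      using r by (simp add: powr_divide powr_powr powr_realpow[symmetric] mult.commute powr_diff field_simps powr_minus)
    finally have 1: "(r / 2 ^ k) powr p * (r / 2 ^ k) powr (- 2 * s) = r powr (p - 2 * s) * (2 powr (2 * s - p)) ^ k" .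
    have 2: "(r / 2 ^ Suc k) powr (- 2 * s) = 2 powr (2 * s) * (r / 2 ^ k) powr (- 2 * s)"
      using r by (simp add: powr_divide powr_minus powr_mult field_simps)
    have 3: "2 * (r / 2 ^ Suc k) = r / 2 ^ k" by simp
    show ?thesis unfolding 2 3 using 1 by (simp add: mult_ac)
  qed
  moreover have "(\<lambda>k. Lam * 2 powr (2 * s) * r powr (p - 2 * s) * (2 powr (2 * s - p)) ^ k) sums
      (Lam * 2 powr (2 * s) * r powr (p - 2 * s) * (1 / (1 - 2 powr (2 * s - p))))"
    using p by (intro sums_mult geometric_sums) (auto simp: powr_less_one)
  ultimately show "(\<lambda>k. (2 * (r / 2 ^ Suc k)) powr p * (Lam * (r / 2 ^ Suc k) powr (- 2 * s))) sums
      (inner_const Lam s p * r powr (p - 2 * s))"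
    by (simp only: inner_const_def mult_ac times_divide_eq_left times_divide_eq_right mult_1_left)
qed (use r in auto)

text \<open>The bridge from moments to Bochner integrals: domination by a power of \<open>norm y\<close> gives both
integrability against the kernel and a bound that is uniform over the class.\<close>

lemma integral_le_moment:
  fixes K :: "real^'n \<Rightarrow> real"
  assumes K: "K \<in> kernels s lam Lam \<rho>" and S: "S \<in> sets lebesgue"
    and mom: "(\<integral>\<^sup>+y \<in> S. ennreal (norm y powr p * K y) \<partial>lebesgue) \<le> ennreal c"
    and c: "0 \<le> c" and a: "0 \<le> a"
    and f: "f \<in> borel_measurable lebesgue"
    and f0: "\<And>y. y \<notin> S \<Longrightarrow> f y = 0" and fb: "\<And>y. y \<in> S \<Longrightarrow> \<bar>f y\<bar> \<le> a * norm y powr p"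
  shows "integrable lebesgue (\<lambda>y. f y * K y)" "\<bar>\<integral>y. f y * K y \<partial>lebesgue\<bar> \<le> a * c"
proof -
  note [measurable] = kernelsD(1)[OF K] f S
  have "(\<integral>\<^sup>+y. ennreal (norm (f y * K y)) \<partial>lebesgue)
      \<le> (\<integral>\<^sup>+y. ennreal a * (ennreal (norm y powr p * K y) * indicator S y) \<partial>lebesgue)"
  proof (rule nn_integral_mono)
    fix y
    show "ennreal (norm (f y * K y)) \<le> ennreal a * (ennreal (norm y powr p * K y) * indicator S y)"
    proof (cases "y \<in> S")
      case True
      have "\<bar>f y\<bar> * K y \<le> a * norm y powr p * K y"
        using fb[OF True] kernelsD(2)[OF K] by (intro mult_right_mono) auto
      then show ?thesis using True a kernelsD(2)[OF K, of y]
        by (simp add: abs_mult ennreal_mult[symmetric] mult_ac)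
    qed (simp add: f0)
  qed
  also have "\<dots> = ennreal a * (\<integral>\<^sup>+y \<in> S. ennreal (norm y powr p * K y) \<partial>lebesgue)"
    by (rule nn_integral_cmult) measurable
  also have "\<dots> \<le> ennreal a * ennreal c"
    by (intro mult_left_mono mom) auto
  also have "\<dots> = ennreal (a * c)"
    using a c by (simp add: ennreal_mult)
  finally have *: "(\<integral>\<^sup>+y. ennreal (norm (f y * K y)) \<partial>lebesgue) \<le> ennreal (a * c)" .
  show int: "integrable lebesgue (\<lambda>y. f y * K y)"
    using * by (intro integrableI_bounded) (auto intro: le_less_trans)
  have "ennreal (norm (\<integral>y. f y * K y \<partial>lebesgue)) \<le> ennreal (a * c)"
    using integral_norm_bound_ennreal[OF int] * by (rule order_trans)
  then show "\<bar>\<integral>y. f y * K y \<partial>lebesgue\<bar> \<le> a * c" using a c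
    by (simp add: ennreal_le_iff)
qed

lemma outer_integral:
  fixes K :: "real^'n \<Rightarrow> real"
  assumes K: "K \<in> kernels s lam Lam \<rho>" and Lam: "0 \<le> Lam" and p: "0 \<le> p" "p < 2 * s"
    and r: "0 < r" and a: "0 \<le> a" and f: "f \<in> borel_measurable lebesgue"
    and f0: "\<And>y. norm y < r \<Longrightarrow> f y = 0" and fb: "\<And>y. r \<le> norm y \<Longrightarrow> \<bar>f y\<bar> \<le> a * norm y powr p"
  shows "integrable lebesgue (\<lambda>y. f y * K y)"
    "\<bar>\<integral>y. f y * K y \<partial>lebesgue\<bar> \<le> a * (outer_const Lam s p * r powr (p - 2 * s))"
  by (rule integral_le_moment[OF K _ outer_moment[OF K Lam p r] _ a f];
      use outer_const_nonneg[OF Lam p(2)] f0 fb in force)+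

lemma inner_integral:
  fixes K :: "real^'n \<Rightarrow> real"
  assumes K: "K \<in> kernels s lam Lam \<rho>" and Lam: "0 \<le> Lam" and p: "0 < p" "2 * s < p"
    and r: "0 < r" and a: "0 \<le> a" and f: "f \<in> borel_measurable lebesgue"
    and f0: "\<And>y. r \<le> norm y \<Longrightarrow> f y = 0" and fb: "\<And>y. norm y < r \<Longrightarrow> \<bar>f y\<bar> \<le> a * norm y powr p"
  shows "integrable lebesgue (\<lambda>y. f y * K y)"
    "\<bar>\<integral>y. f y * K y \<partial>lebesgue\<bar> \<le> a * (inner_const Lam s p * r powr (p - 2 * s))"
proof -
  have f00: "f y = 0" if "y \<notin> ball 0 r - {0}" for y
    using that f0[of y] fb[of 0] r p by (cases "y = 0") (auto simp: not_less)
  show "integrable lebesgue (\<lambda>y. f y * K y)"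
    "\<bar>\<integral>y. f y * K y \<partial>lebesgue\<bar> \<le> a * (inner_const Lam s p * r powr (p - 2 * s))"
    by (rule integral_le_moment[OF K _ inner_moment[OF K Lam less_imp_le[OF p(1)] p(2) r] _ a f];
      use inner_const_nonneg[OF Lam p(2)] f00 fb in force)+
qed

section \<open>Cancellation and the effective drift\<close>

text \<open>The factor that multiplies the gradient term of \<open>delta\<close>, so that the three ranges of \<open>s\<close> can be treated
together.\<close>

definition cutoff :: "real \<Rightarrow> real^'n \<Rightarrow> real" where
  "cutoff s y = (if s < 1 / 2 then 0 else if s = 1 / 2 then indicator (ball 0 1) y else 1)"

lemma delta_cutoff: "delta s w x y = w (x + y) - w x - (y \<bullet> grad w x) * cutoff s y"
  by (simp add: delta_def cutoff_def)

lemma borel_imp_lebesgue: "f \<in> borel_measurable borel \<Longrightarrow> f \<in> borel_measurable lebesgue"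
  by (rule measurable_completion) simp

lemma inner_measurable [measurable]: "(\<lambda>y::real^'n. y \<bullet> e) \<in> borel_measurable lebesgue"
  by (rule borel_imp_lebesgue) measurable

lemma ball_sets_lebesgue [measurable]: "ball (c::real^'n) r \<in> sets lebesgue"
  by simp

lemma cutoff_measurable [measurable]: "cutoff s \<in> borel_measurable lebesgue"
  unfolding cutoff_def by simp

text \<open>Peeling off annuli of ratio two, whose first moments vanish, leaves an annulus of ratio at most two.
Its contribution need not vanish, since the cancellation condition says nothing about smaller ratios,
but it is bounded by a first moment that is scale invariant for \<open>s = 1 / 2\<close>.\<close>

lemma annulus_drift:
  fixes K :: "real^'n \<Rightarrow> real"
  assumes K: "K \<in> kernels (1/2) lam Lam \<rho>" and Lam: "0 \<le> Lam"
  shows "0 < a \<Longrightarrow> a \<le> b \<Longrightarrow>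
    integrable lebesgue (\<lambda>y. ((y \<bullet> e) * indicator (ball 0 b - ball 0 a) y) * K y) \<and>
    \<bar>\<integral>y. ((y \<bullet> e) * indicator (ball 0 b - ball 0 a) y) * K y \<partial>lebesgue\<bar> \<le> norm e * (2 * Lam)"
proof -
  have annulus_bound: "integrable lebesgue (\<lambda>y. ((y \<bullet> e) * indicator (ball 0 b - ball 0 a) y) * K y) \<and>
    \<bar>\<integral>y. ((y \<bullet> e) * indicator (ball 0 b - ball 0 a) y) * K y \<partial>lebesgue\<bar> \<le> norm e * (2 * Lam)"
    if a: "0 < a" and b: "b \<le> 2 * a" for a b
  proof -
    have mom: "(\<integral>\<^sup>+y \<in> annulus a. ennreal (norm y powr 1 * K y) \<partial>lebesgue) \<le> ennreal (2 * Lam)"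
      using annulus_moment[OF K a, of 1] a by (simp add: powr_minus field_simps)
    have *: "\<bar>(y \<bullet> e) * indicator (ball 0 b - ball 0 a) y\<bar> \<le> norm e * norm y powr 1" for y
      using Cauchy_Schwarz_ineq2[of y e] by (auto simp: indicator_def mult.commute)
    have 0: "(y \<bullet> e) * indicator (ball 0 b - ball 0 a) y = 0" if "y \<notin> annulus a" for y
      using that b by (auto simp: annulus_iff indicator_def)
    note I = integral_le_moment[OF K annulus_sets mom _ _ _ 0 *]
    show ?thesis using I Lam by (auto intro!: conjI)
  qed
  have annulus_zero: "(\<integral>y. ((y \<bullet> e) * indicator (annulus a) y) * K y \<partial>lebesgue) = 0" if a: "0 < a" for a
  proof -
    note [measurable] = kernelsD(1)[OF K]
    have int: "integrable lebesgue (\<lambda>y. indicator (annulus a) y *\<^sub>R K y *\<^sub>R y)"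
    proof (rule Bochner_Integration.integrable_bound)
      have "integrable lebesgue (\<lambda>y::real^'n. (norm y * indicator (annulus a) y) * K y)"
      proof (rule integral_le_moment(1)[OF K annulus_sets annulus_moment[OF K a, of 1], where a = 1])
        show "(\<lambda>y::real^'n. norm y * indicator (annulus a) y) \<in> borel_measurable lebesgue"
          by (intro borel_measurable_times[OF borel_imp_lebesgue borel_measurable_indicator[OF annulus_sets]]) simp
      qed (use Lam a in auto)
      then show "integrable lebesgue (\<lambda>y. norm y * indicator (annulus a) y * K y)" .
      have "(\<lambda>y. y :: real^'n) \<in> borel_measurable lebesgue"
        by (rule measurable_completion) simp
      then show "(\<lambda>y. indicator (annulus a) y *\<^sub>R K y *\<^sub>R y) \<in> borel_measurable lebesgue"
        by (intro borel_measurable_scaleR) auto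
    qed (auto simp: indicator_def mult.commute abs_mult)
    have "(\<integral>y. indicator (annulus a) y *\<^sub>R K y *\<^sub>R y \<partial>lebesgue) = 0"
      using kernelsD(5)[OF K _ a] by (simp add: set_lebesgue_integral_def)
    then have "(\<integral>y. (indicator (annulus a) y *\<^sub>R K y *\<^sub>R y) \<bullet> e \<partial>lebesgue) = 0"
      using integral_inner_left[of e, OF int] by simp
    then show ?thesis by (simp add: mult_ac)
  qed
  have *: "0 < a \<Longrightarrow> b \<le> 2 ^ k * a \<Longrightarrow>
    integrable lebesgue (\<lambda>y. ((y \<bullet> e) * indicator (ball 0 b - ball 0 a) y) * K y) \<and>
    \<bar>\<integral>y. ((y \<bullet> e) * indicator (ball 0 b - ball 0 a) y) * K y \<partial>lebesgue\<bar> \<le> norm e * (2 * Lam)" for k a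
  proof (induction k arbitrary: a)
    case 0
    then show ?case by (intro annulus_bound) auto
  next
    case (Suc k)
    show ?case
    proof (cases "b \<le> 2 * a")
      case True
      then show ?thesis using Suc.prems by (intro annulus_bound) auto
    next
      case False
      have IH: "integrable lebesgue (\<lambda>y. ((y \<bullet> e) * indicator (ball 0 b - ball 0 (2*a)) y) * K y)"
        "\<bar>\<integral>y. ((y \<bullet> e) * indicator (ball 0 b - ball 0 (2*a)) y) * K y \<partial>lebesgue\<bar> \<le> norm e * (2 * Lam)"
        using Suc.IH[of "2 * a"] Suc.prems by (auto simp: mult_ac)
      have R: "integrable lebesgue (\<lambda>y. ((y \<bullet> e) * indicator (annulus a) y) * K y)"
        using annulus_bound[of a "2 * a"] Suc.prems by (auto simp: annulus_def)
      have eq: "((y \<bullet> e) * indicator (ball 0 b - ball 0 a) y) * K y =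
         ((y \<bullet> e) * indicator (annulus a) y) * K y + ((y \<bullet> e) * indicator (ball 0 b - ball 0 (2*a)) y) * K y" for y
        using False Suc.prems by (auto simp: annulus_iff indicator_def)
      show ?thesis unfolding eq using IH R annulus_zero[OF Suc.prems(1)]
        by (auto simp: Bochner_Integration.integral_add)
    qed
  qed
  show "0 < a \<Longrightarrow> a \<le> b \<Longrightarrow> ?thesis"
  proof -
    assume a: "0 < a" "a \<le> b"
    obtain k where "b / a < 2 ^ k" using real_arch_pow[of 2 "b / a"] by auto
    then show ?thesis using *[of a k] a by (auto simp: field_simps)
  qed
qed

definition drift_const :: "real \<Rightarrow> real \<Rightarrow> real" where
  "drift_const Lam s = (if s < 1/2 then inner_const Lam s 1
     else if s = 1/2 then 2 * Lam else outer_const Lam s 1)"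

lemma drift_const_nonneg: "0 \<le> Lam \<Longrightarrow> 0 \<le> drift_const Lam s"
  using inner_const_nonneg[of Lam s 1] outer_const_nonneg[of Lam 1 s]
  by (auto simp: drift_const_def)

text \<open>Replacing the cutoff of the gradient term by the indicator of \<open>ball 0 r\<close> changes the operator by a drift
of the natural size: for \<open>s < 1 / 2\<close> first moments converge at the origin, for \<open>s > 1 / 2\<close> they converge
at infinity, and for \<open>s = 1 / 2\<close> the cancellation condition takes over.\<close>

lemma cutoff_drift:
  fixes K :: "real^'n \<Rightarrow> real"
  assumes K: "K \<in> kernels s lam Lam \<rho>" and Lam: "0 \<le> Lam" and s: "0 < s" and r: "0 < r"
  shows "integrable lebesgue (\<lambda>y. ((y \<bullet> e) * (cutoff s y - indicator (ball 0 r) y)) * K y)"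
    and "\<bar>\<integral>y. ((y \<bullet> e) * (cutoff s y - indicator (ball 0 r) y)) * K y \<partial>lebesgue\<bar>
           \<le> norm e * (drift_const Lam s * r powr (1 - 2 * s))"
proof -
  let ?f = "\<lambda>y. (y \<bullet> e) * (cutoff s y - indicator (ball 0 r) y)"
  have meas: "?f \<in> borel_measurable lebesgue" by simp
  consider "s < 1/2" | "s = 1/2" | "1/2 < s" by linarith
  then have "integrable lebesgue (\<lambda>y. ?f y * K y) \<and>
    \<bar>\<integral>y. ?f y * K y \<partial>lebesgue\<bar> \<le> norm e * (drift_const Lam s * r powr (1 - 2 * s))"
  proof cases
    case 1
    have b: "norm y < r \<Longrightarrow> \<bar>?f y\<bar> \<le> norm e * norm y powr 1" for y
      using Cauchy_Schwarz_ineq2[of y e] 1 by (auto simp: cutoff_def mult.commute abs_mult)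
    have 0: "r \<le> norm y \<Longrightarrow> ?f y = 0" for y
      using 1 by (auto simp: cutoff_def)
    show ?thesis using inner_integral[OF K Lam _ _ r _ meas 0 b] 1
      by (auto simp: drift_const_def)
  next
    case 3
    have b: "r \<le> norm y \<Longrightarrow> \<bar>?f y\<bar> \<le> norm e * norm y powr 1" for y
      using Cauchy_Schwarz_ineq2[of y e] 3 by (auto simp: cutoff_def mult.commute abs_mult)
    have 0: "norm y < r \<Longrightarrow> ?f y = 0" for y
      using 3 by (auto simp: cutoff_def)
    show ?thesis using outer_integral[OF K Lam _ _ r _ meas 0 b] 3
      by (auto simp: drift_const_def)
  next
    case 2
    have K': "K \<in> kernels (1/2) lam Lam \<rho>" using K 2 by simp
    have const: "drift_const Lam s * r powr (1 - 2 * s) = 2 * Lam"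
    proof -
      have "1 - 2 * s = 0" using 2 by simp
      then show ?thesis using 2 r by (simp only: drift_const_def) simp
    qed
    show ?thesis
    proof (cases "r \<le> 1")
      case True
      have eq: "?f y = (y \<bullet> e) * indicator (ball 0 1 - ball 0 r) y" for y
        using 2 True by (auto simp: cutoff_def indicator_def)
      show ?thesis unfolding eq const by (rule annulus_drift[OF K' Lam r True])
    next
      case False
      have eq: "?f y * K y = - ((y \<bullet> e) * indicator (ball 0 r - ball 0 1) y * K y)" for y
        using 2 False by (auto simp: cutoff_def indicator_def)
      show ?thesis unfolding eq const using annulus_drift[OF K' Lam, of 1 r e] False by simp
    qed
  qed
  then show "integrable lebesgue (\<lambda>y. ?f y * K y)"
    and "\<bar>\<integral>y. ?f y * K y \<partial>lebesgue\<bar> \<le> norm e * (drift_const Lam s * r powr (1 - 2 * s))"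
    by auto
qed

section \<open>The bump function\<close>

text \<open>Convexity and a bound for the second derivative of \<open>q \<mapsto> (max 0 q)\<^sup>2\<close>, in integrated form. The square is what
makes the bump below \<open>C\<^sup>1\<^sup>,\<^sup>1\<close> across the boundary of its support.\<close>

lemma pos_part_square_expansion:
  fixes p q :: real
  shows "(max 0 p)\<^sup>2 + 2 * max 0 p * (q - p) \<le> (max 0 q)\<^sup>2"
    and "(max 0 q)\<^sup>2 \<le> (max 0 p)\<^sup>2 + 2 * max 0 p * (q - p) + (q - p)\<^sup>2"
proof -
  have "(max 0 q)\<^sup>2 - (max 0 p)\<^sup>2 - 2 * max 0 p * (q - p)
      = (max 0 q - max 0 p)\<^sup>2 + 2 * max 0 p * (max 0 q - q)"
    by (simp add: power2_eq_square algebra_simps max_def)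
  moreover have "0 \<le> 2 * max 0 p * (max 0 q - q)"
    by (intro mult_nonneg_nonneg) auto
  ultimately show "(max 0 p)\<^sup>2 + 2 * max 0 p * (q - p) \<le> (max 0 q)\<^sup>2"
    by (smt (verit) zero_le_power2)
  show "(max 0 q)\<^sup>2 \<le> (max 0 p)\<^sup>2 + 2 * max 0 p * (q - p) + (q - p)\<^sup>2"
  proof (cases "0 < q"; cases "0 < p")
    assume "\<not> 0 < q" "0 < p"
    then show ?thesis by (simp add: power2_eq_square algebra_simps)
  next
    assume "0 < q" "\<not> 0 < p"
    then have "q\<^sup>2 \<le> (q - p)\<^sup>2" by (intro power_mono) auto
    then show ?thesis using \<open>0 < q\<close> \<open>\<not> 0 < p\<close> by simp
  next
    assume "\<not> 0 < q" "\<not> 0 < p"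
    then show ?thesis by simp
  qed (simp_all add: power2_eq_square algebra_simps)
qed

lemma pos_part_square_deriv: "((\<lambda>q. (max 0 q)\<^sup>2) has_real_derivative 2 * max 0 p) (at p)"
  unfolding DERIV_def
proof (rule LIM_zero_cancel, rule Lim_null_comparison)
  show "((\<lambda>h. \<bar>h\<bar>) \<longlongrightarrow> 0) (at (0::real))"
    using tendsto_rabs[OF tendsto_ident_at, of 0] by simp
  show "\<forall>\<^sub>F h in at 0. norm (((max 0 (p + h))\<^sup>2 - (max 0 p)\<^sup>2) / h - 2 * max 0 p) \<le> \<bar>h\<bar>"
  proof (rule eventually_at_filter[THEN iffD2], rule always_eventually, intro allI impI)
    fix h :: real assume "h \<noteq> 0"
    have "\<bar>(max 0 (p + h))\<^sup>2 - (max 0 p)\<^sup>2 - 2 * max 0 p * h\<bar> \<le> h\<^sup>2"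
      using pos_part_square_expansion(1)[of p "p + h"] pos_part_square_expansion(2)[of "p + h" p]
      unfolding abs_le_iff by simp
    then have "\<bar>(max 0 (p + h))\<^sup>2 - (max 0 p)\<^sup>2 - 2 * max 0 p * h\<bar> / \<bar>h\<bar> \<le> \<bar>h\<bar>"
      using \<open>h \<noteq> 0\<close> by (simp add: field_simps power2_eq_square)
    moreover have "((max 0 (p + h))\<^sup>2 - (max 0 p)\<^sup>2) / h - 2 * max 0 p =
        ((max 0 (p + h))\<^sup>2 - (max 0 p)\<^sup>2 - 2 * max 0 p * h) / h"
      using \<open>h \<noteq> 0\<close> by (simp add: field_simps)
    ultimately show "norm (((max 0 (p + h))\<^sup>2 - (max 0 p)\<^sup>2) / h - 2 * max 0 p) \<le> \<bar>h\<bar>"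
      by (simp add: abs_divide)
  qed
qed

definition bump :: "real^'n \<Rightarrow> real \<Rightarrow> real^'n \<Rightarrow> real" where
  "bump c R x = (max 0 (1 - (norm (x - c) / R)\<^sup>2))\<^sup>2"

definition bump_grad :: "real^'n \<Rightarrow> real \<Rightarrow> real^'n \<Rightarrow> real^'n" where
  "bump_grad c R x = (- 4 / R\<^sup>2 * max 0 (1 - (norm (x - c) / R)\<^sup>2)) *\<^sub>R (x - c)"

lemma bump_nonneg: "0 \<le> bump c R x"
  by (simp add: bump_def)

lemma bump_le_1: "bump c R x \<le> 1"
  unfolding bump_def by (rule power_le_one) auto

lemma sqrt_bump: "sqrt (bump c R x) = max 0 (1 - (norm (x - c) / R)\<^sup>2)"
  unfolding bump_def by (simp add: real_sqrt_abs)

lemma bump_le_sqrt_bump: "bump c R x \<le> sqrt (bump c R x)"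
proof -
  have "sqrt (bump c R x) * sqrt (bump c R x) \<le> sqrt (bump c R x) * 1"
    using bump_le_1[of c R x] bump_nonneg[of c R x] by (intro mult_left_mono) auto
  then show ?thesis using bump_nonneg[of c R x] by simp
qed

lemma bump_eq_0: "0 < R \<Longrightarrow> R \<le> norm (x - c) \<Longrightarrow> bump c R x = 0"
  by (simp add: bump_def)

lemma bump_ge_half: "0 < R \<Longrightarrow> norm (x - c) \<le> R / 2 \<Longrightarrow> 1 / 2 \<le> bump c R x"
proof -
  assume R: "0 < R" "norm (x - c) \<le> R / 2"
  then have "(norm (x - c) / R)\<^sup>2 \<le> (1/2)\<^sup>2"
    by (intro power_mono) (auto simp: field_simps)
  then have q: "(norm (x - c) / R)\<^sup>2 \<le> 1/4"
    by (simp add: power2_eq_square)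
  have "3/4 \<le> max 0 (1 - q)" if "q \<le> 1/4" for q :: real
    using that by simp
  from this[OF q] have "3/4 \<le> max 0 (1 - (norm (x - c) / R)\<^sup>2)" .
  then have "(3/4)\<^sup>2 \<le> bump c R x" unfolding bump_def
    by (rule power_mono) simp
  then show ?thesis by (simp add: power2_eq_square)
qed

lemma bump_continuous: "continuous_on UNIV (bump c R)"
  unfolding bump_def divide_inverse by (intro continuous_intros)

lemma bump_borel [measurable]: "bump c R \<in> borel_measurable borel"
  by (rule borel_measurable_continuous_onI[OF bump_continuous])

lemma GDERIV_bump: "GDERIV (bump c R) x :> bump_grad c R x"
proof -
  have "((\<lambda>x. (x - c) \<bullet> (x - c)) has_derivative (\<lambda>h. (x - c) \<bullet> h + h \<bullet> (x - c))) (at x)"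
    by (auto intro!: derivative_eq_intros)
  then have n: "GDERIV (\<lambda>x. (norm (x - c))\<^sup>2) x :> 2 *\<^sub>R (x - c)"
    unfolding gderiv_def power2_norm_eq_inner by (simp add: inner_commute)
  have "((\<lambda>q. 1 - q * k) has_real_derivative (- k)) (at q)" for k q :: real
    by (auto intro!: derivative_eq_intros)
  from DERIV_chain2[OF pos_part_square_deriv this]
  have "((\<lambda>q. (max 0 (1 - q * inverse (R\<^sup>2)))\<^sup>2) has_real_derivative
      2 * max 0 (1 - q * inverse (R\<^sup>2)) * (- inverse (R\<^sup>2))) (at q)" for q .
  note D = GDERIV_DERIV_compose[OF n this]
  have eq: "bump_grad c R x = (2 * max 0 (1 - (norm (x - c))\<^sup>2 * inverse (R\<^sup>2)) * (- inverse (R\<^sup>2))) *\<^sub>R (2 *\<^sub>R (x - c))"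
    unfolding bump_grad_def power_divide divide_inverse by (simp add: power_mult_distrib power_inverse)
  show ?thesis unfolding eq bump_def[abs_def] divide_inverse power_mult_distrib power_inverse by (rule D)
qed

text \<open>The gradient vanishes like the square root of the bump at the boundary of the support; a nonnegative
\<open>C\<^sup>1\<^sup>,\<^sup>1\<close> function cannot behave worse.\<close>

lemma bump_grad_bound: assumes "0 < R" "norm (x - c) \<le> R"
  shows "norm (bump_grad c R x) \<le> 4 / R * sqrt (bump c R x)"
proof -
  have "norm (bump_grad c R x) = 4 / R\<^sup>2 * sqrt (bump c R x) * norm (x - c)"
    unfolding sqrt_bump bump_grad_def using assms(1) by (simp add: abs_mult)
  also have "\<dots> \<le> 4 / R\<^sup>2 * sqrt (bump c R x) * R"
    using assms bump_nonneg[of c R x] by (intro mult_left_mono) auto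
  also have "\<dots> = 4 / R * sqrt (bump c R x)"
    using assms by (simp add: power2_eq_square)
  finally show ?thesis .
qed

lemma bump_taylor: assumes R: "0 < R" and x: "norm (x - c) \<le> R" and y: "norm y \<le> 2 * R"
  shows "\<bar>bump c R (x + y) - bump c R x - y \<bullet> bump_grad c R x\<bar> \<le> 16 / R\<^sup>2 * (norm y)\<^sup>2"
proof -
  define p where "p = 1 - (norm (x - c) / R)\<^sup>2"
  define q where "q = 1 - (norm (x + y - c) / R)\<^sup>2"
  have sq: "(norm (x + y - c))\<^sup>2 = (norm (x - c))\<^sup>2 + 2 * ((x - c) \<bullet> y) + (norm y)\<^sup>2"
    unfolding power2_norm_eq_inner by (simp add: inner_add inner_diff inner_commute algebra_simps)
  have qp: "q - p = - (2 * ((x - c) \<bullet> y) + (norm y)\<^sup>2) / R\<^sup>2"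
    unfolding p_def q_def power_divide sq using R by (simp add: field_simps)
  have cs: "\<bar>(x - c) \<bullet> y\<bar> \<le> R * norm y"
    using Cauchy_Schwarz_ineq2[of "x - c" y] mult_right_mono[OF x, of "norm y"] by simp
  have ny: "(norm y)\<^sup>2 \<le> 2 * R * norm y"
    using mult_right_mono[OF y, of "norm y"] by (simp add: power2_eq_square)
  have "\<bar>q - p\<bar> \<le> (4 * R * norm y) / R\<^sup>2"
  proof -
    have "0 \<le> (norm y)\<^sup>2" by simp
    then have "\<bar>- (2 * ((x - c) \<bullet> y) + (norm y)\<^sup>2)\<bar> \<le> 4 * R * norm y"
      using cs ny unfolding abs_le_iff by linarith
    then show ?thesis unfolding qp abs_divide by (simp add: divide_right_mono)
  qed
  then have "(q - p)\<^sup>2 \<le> ((4 * R * norm y) / R\<^sup>2)\<^sup>2"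
    by (metis abs_ge_zero power2_abs power_mono)
  also have "\<dots> = 16 / R\<^sup>2 * (norm y)\<^sup>2"
    using R by (simp add: power2_eq_square field_simps)
  finally have sqb: "(q - p)\<^sup>2 \<le> 16 / R\<^sup>2 * (norm y)\<^sup>2" .
  have lin: "2 * max 0 p * (q - p) = y \<bullet> bump_grad c R x - 2 * max 0 p * ((norm y)\<^sup>2 / R\<^sup>2)"
  proof -
    have "y \<bullet> bump_grad c R x = - 4 / R\<^sup>2 * max 0 p * ((x - c) \<bullet> y)"
      unfolding bump_grad_def p_def by (simp only: inner_scaleR_right inner_commute)
    then show ?thesis unfolding qp by (simp add: add_divide_distrib diff_divide_distrib algebra_simps)
  qed
  have m: "0 \<le> max 0 p" "max 0 p \<le> 1" by (auto simp: p_def)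
  have e0: "0 \<le> (norm y)\<^sup>2 / R\<^sup>2" by simp
  have e1: "2 * max 0 p * ((norm y)\<^sup>2 / R\<^sup>2) \<le> 2 * ((norm y)\<^sup>2 / R\<^sup>2)"
    using mult_right_mono[OF m(2) e0] by (simp only: mult_ac)
  have e2: "0 \<le> 2 * max 0 p * ((norm y)\<^sup>2 / R\<^sup>2)" using m by simp
  have b: "bump c R x = (max 0 p)\<^sup>2" "bump c R (x + y) = (max 0 q)\<^sup>2"
    by (simp_all add: bump_def p_def q_def)
  have e3: "16 / R\<^sup>2 * (norm y)\<^sup>2 = 16 * ((norm y)\<^sup>2 / R\<^sup>2)" by simp
  show ?thesis
    using pos_part_square_expansion(1)[of p q] pos_part_square_expansion(2)[of q p] lin e0 e1 e2 sqb unfolding b e3 abs_le_iff by linarith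
qed

lemma bump_C11: assumes R: "0 < R" shows "C11_on (ball x \<epsilon>) (bump c R)"
  unfolding C11_on_def
proof (intro exI conjI ballI)
  define N where "N = norm (x - c) + \<bar>\<epsilon>\<bar>"
  have N: "0 \<le> N" by (simp add: N_def)
  show "(4 / R\<^sup>2 * (1 + 2 * N\<^sup>2 / R\<^sup>2))-lipschitz_on (ball x \<epsilon>) (bump_grad c R)"
  proof (rule lipschitz_onI)
    fix y z assume "y \<in> ball x \<epsilon>" "z \<in> ball x \<epsilon>"
    then have yz: "norm (y - c) \<le> N" "norm (z - c) \<le> N"
      unfolding N_def using norm_triangle_ineq[of "y - x" "x - c"] norm_triangle_ineq[of "z - x" "x - c"]
      by (auto simp: dist_norm norm_minus_commute)
    define p where "p = max 0 (1 - (norm (y - c) / R)\<^sup>2)"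
    define q where "q = max 0 (1 - (norm (z - c) / R)\<^sup>2)"
    have p1: "0 \<le> p" "p \<le> 1" by (auto simp: p_def)
    have "\<bar>p - q\<bar> \<le> \<bar>(norm (y - c) / R)\<^sup>2 - (norm (z - c) / R)\<^sup>2\<bar>"
      unfolding p_def q_def by (auto simp: max_def)
    also have "\<dots> = \<bar>norm (y - c) - norm (z - c)\<bar> * (norm (y - c) + norm (z - c)) / R\<^sup>2"
    proof -
      have "(norm (y - c) / R)\<^sup>2 - (norm (z - c) / R)\<^sup>2
          = (norm (y - c) - norm (z - c)) * (norm (y - c) + norm (z - c)) / R\<^sup>2"
        by (simp add: power2_eq_square diff_divide_distrib algebra_simps)
      then show ?thesis by (simp add: abs_mult)
    qed
    also have "\<dots> \<le> norm (y - z) * (2 * N) / R\<^sup>2"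
      using yz norm_triangle_ineq3[of "y - c" "z - c"]
      by (intro divide_right_mono mult_mono) auto
    finally have pq: "\<bar>p - q\<bar> \<le> norm (y - z) * (2 * N) / R\<^sup>2" .
    have "p *\<^sub>R (y - c) - q *\<^sub>R (z - c) = p *\<^sub>R (y - z) + (p - q) *\<^sub>R (z - c)"
      by (simp add: algebra_simps)
    then have "norm (p *\<^sub>R (y - c) - q *\<^sub>R (z - c)) \<le> p * norm (y - z) + \<bar>p - q\<bar> * norm (z - c)"
      using norm_triangle_ineq[of "p *\<^sub>R (y - z)" "(p - q) *\<^sub>R (z - c)"] p1 by simp
    also have "\<dots> \<le> 1 * norm (y - z) + norm (y - z) * (2 * N) / R\<^sup>2 * N"
      using p1 pq yz N by (intro add_mono mult_mono) auto
    also have "\<dots> = (1 + 2 * N\<^sup>2 / R\<^sup>2) * norm (y - z)"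
      by (simp add: power2_eq_square algebra_simps)
    finally have main: "norm (p *\<^sub>R (y - c) - q *\<^sub>R (z - c)) \<le> (1 + 2 * N\<^sup>2 / R\<^sup>2) * norm (y - z)" .
    have "bump_grad c R y - bump_grad c R z = (- 4 / R\<^sup>2) *\<^sub>R (p *\<^sub>R (y - c) - q *\<^sub>R (z - c))"
      unfolding bump_grad_def p_def q_def by (simp add: scaleR_diff_right)
    then have "norm (bump_grad c R y - bump_grad c R z) = 4 / R\<^sup>2 * norm (p *\<^sub>R (y - c) - q *\<^sub>R (z - c))"
      by simp
    also have "\<dots> \<le> 4 / R\<^sup>2 * ((1 + 2 * N\<^sup>2 / R\<^sup>2) * norm (y - z))"
      by (intro mult_left_mono main) auto
    finally show "dist (bump_grad c R y) (bump_grad c R z) \<le> 4 / R\<^sup>2 * (1 + 2 * N\<^sup>2 / R\<^sup>2) * dist y z"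
      by (simp only: dist_norm mult.assoc)
  qed (use N in auto)
qed (rule GDERIV_bump)

lemma grad_eqI: assumes "GDERIV w x :> D" shows "grad w x = D"
  unfolding grad_def
proof (rule the_equality, rule assms)
  fix D' assume "GDERIV w x :> D'"
  then have "(\<lambda>h. h \<bullet> D') = (\<lambda>h. h \<bullet> D)"
    using assms has_derivative_unique unfolding gderiv_def by blast
  then have "(D' - D) \<bullet> D' = (D' - D) \<bullet> D" by metis
  then have "(D' - D) \<bullet> (D' - D) = 0" by (simp add: inner_diff_right)
  then show "D' = D" by simp
qed

section \<open>The barrier inequality\<close>

text \<open>This is the only place where \<open>\<rho> \<le> r\<close> matters: at scales above \<open>\<rho>\<close> the truncated kernel is as large as
the untruncated one, so that no later constant depends on \<open>\<rho>\<close>.\<close>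

lemma kernel_lower_bound:
  fixes K :: "real^'n \<Rightarrow> real"
  assumes K: "K \<in> kernels s lam Lam \<rho>" and "0 < s" "0 < lam" "0 \<le> \<rho>" "\<rho> \<le> r" "0 < r" and y: "y \<noteq> 0" "norm y \<le> r"
  shows "lam * r powr (- real CARD('n) - 2 * s) \<le> K y"
proof -
  let ?e = "- real CARD('n) - 2 * s"
  have "r powr ?e \<le> norm y powr ?e" using assms by (intro powr_mono2') auto
  moreover have "r powr ?e \<le> \<rho> powr ?e" if "\<rho> \<noteq> 0" using assms that by (intro powr_mono2') auto
  ultimately have "r powr ?e \<le> trunc_kernel s \<rho> y" by (auto simp: trunc_kernel_def Let_def)
  then have "lam * r powr ?e \<le> lam * trunc_kernel s \<rho> y" using assms by (intro mult_left_mono) auto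
  then show ?thesis using kernelsD(3)[OF K y(1)] by simp
qed

lemma kernel_mass_lower_bound:
  fixes K :: "real^'n \<Rightarrow> real"
  assumes K: "K \<in> kernels s lam Lam \<rho>" and s: "0 < s" "0 < lam" "0 \<le> Lam" and r: "0 \<le> \<rho>" "\<rho> \<le> r" "0 < r"
    and e: "0 < \<epsilon>" and f: "f \<in> borel_measurable lebesgue" "\<And>y. 0 \<le> f y" "\<And>y. f y \<le> 1"
    and f0: "\<And>y. norm y < \<epsilon> \<Longrightarrow> f y = 0" "\<And>y. r < norm y \<Longrightarrow> f y = 0"
  shows "integrable lebesgue (\<lambda>y. f y * K y)"
    and "lam * r powr (- real CARD('n) - 2 * s) * (\<integral>y. f y \<partial>lebesgue) \<le> (\<integral>y. f y * K y \<partial>lebesgue)"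
proof -
  show int: "integrable lebesgue (\<lambda>y. f y * K y)"
    by (rule outer_integral(1)[OF K s(3) _ _ e, where p = 0 and a = 1]) (use s f f0 e in auto)
  have intf: "integrable lebesgue f"
  proof (rule Bochner_Integration.integrable_bound[of _ "indicator (cball (0::real^'n) r) :: _ \<Rightarrow> real"])
    show "AE x in lebesgue. norm (f x) \<le> norm (indicator (cball (0::real^'n) r) x :: real)"
      using f f0(2) by (auto simp: indicator_def not_le)
  qed (use f emeasure_bounded_finite[OF bounded_cball, of "0::real^'n" r] in \<open>auto simp: integrable_indicator_iff\<close>)
  have "(\<integral>y. lam * r powr (- real CARD('n) - 2 * s) * f y \<partial>lebesgue) \<le> (\<integral>y. f y * K y \<partial>lebesgue)"
  proof (rule integral_mono)
    fix y
    show "lam * r powr (- real CARD('n) - 2 * s) * f y \<le> f y * K y"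
    proof (cases "norm y < \<epsilon> \<or> r < norm y")
      case True
      then show ?thesis using f0 by auto
    next
      case False
      then have "lam * r powr (- real CARD('n) - 2 * s) \<le> K y"
        using e by (intro kernel_lower_bound[OF K s(1,2) r]) auto
      from mult_right_mono[OF this f(2)[of y]] show ?thesis by (simp add: mult_ac)
    qed
  qed (use int intf in auto)
  then show "lam * r powr (- real CARD('n) - 2 * s) * (\<integral>y. f y \<partial>lebesgue) \<le> (\<integral>y. f y * K y \<partial>lebesgue)"
    by simp
qed

lemma bump_shift_measurable [measurable]: "(\<lambda>y. bump c R (x + y)) \<in> borel_measurable lebesgue"
  by (rule borel_imp_lebesgue) measurable

lemma measure_lebesgue_ball:
  assumes "0 \<le> r"
  shows "measure lebesgue (ball (c::real^'n) r) = unit_ball_vol (real CARD('n)) * r ^ CARD('n)"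
  using content_ball[OF assms, of c] by simp

text \<open>Removing a small ball around the origin, where kernels may be singular, costs at most a fixed
fraction of the volume of \<open>ball z (r / 4)\<close>.\<close>

lemma measure_shell_lower_bound:
  fixes z :: "real^'n"
  assumes r: "0 < r" and k: "0 < k" "k \<le> 1/8"
  shows "r ^ CARD('n) * (unit_ball_vol (real CARD('n)) * ((1/4) ^ CARD('n) - (1/8) ^ CARD('n)))
     \<le> measure lebesgue (ball z (r/4) - ball 0 (k * r))"
proof -
  let ?d = "CARD('n)" and ?V = "unit_ball_vol (real CARD('n))"
  have V: "0 \<le> ?V" by simp
  have "measure lebesgue (ball z (r/4)) - measure lebesgue (ball (0::real^'n) (k * r))
      \<le> measure lebesgue (ball z (r/4) - ball 0 (k * r))"
  proof -
    have "measure lebesgue (ball z (r/4)) \<le> measure lebesgue ((ball z (r/4) - ball 0 (k * r)) \<union> ball 0 (k * r))"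
      by (rule measure_mono_fmeasurable) auto
    also have "\<dots> \<le> measure lebesgue (ball z (r/4) - ball 0 (k * r)) + measure lebesgue (ball (0::real^'n) (k * r))"
      by (rule measure_Un_le) auto
    finally show ?thesis by simp
  qed
  moreover have "measure lebesgue (ball z (r/4)) = ?V * (r / 4) ^ ?d"
    using r by (intro measure_lebesgue_ball) auto
  moreover have "measure lebesgue (ball (0::real^'n) (k * r)) \<le> ?V * (r / 8) ^ ?d"
  proof -
    have "measure lebesgue (ball (0::real^'n) (k * r)) = ?V * (k * r) ^ ?d"
      using r k by (intro measure_lebesgue_ball) auto
    moreover have "(k * r) ^ ?d \<le> (r / 8) ^ ?d"
      using r k by (intro power_mono) auto
    ultimately show ?thesis using V by (simp add: mult_left_mono)
  qed
  moreover have "r ^ ?d * (?V * ((1/4) ^ ?d - (1/8) ^ ?d)) = ?V * (r / 4) ^ ?d - ?V * (r / 8) ^ ?d"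
    by (simp add: power_divide algebra_simps)
  ultimately show ?thesis by linarith
qed

lemma shell_const_pos: "0 < unit_ball_vol (real CARD('n)) * ((1/4) ^ CARD('n::finite) - (1/8) ^ CARD('n))"
proof -
  have "(1/8 :: real) ^ CARD('n) < (1/4) ^ CARD('n)"
    by (rule power_strict_mono) auto
  then show ?thesis by simp
qed

text \<open>The increment of the bump is split at radius \<open>k * r\<close>. Close to the origin the Taylor bound gives an error
that is small with \<open>k\<close>. Further out, the part of the bump above \<open>1 / 2\<close> gives a positive
contribution by the kernel lower bound, and the remaining terms are of order \<open>sqrt (bump c (r/2) x)\<close>, as is the drift that
comes from the cutoff.\<close>

lemma bump_operator_lower_bound:
  fixes K :: "real^'n \<Rightarrow> real"
  assumes K: "K \<in> kernels s lam Lam \<rho>" and s: "0 < s" "s < 1" and lam: "0 < lam" and Lam: "0 \<le> Lam"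
    and r: "0 \<le> \<rho>" "\<rho> \<le> r" "0 < r" and x: "norm (x - c) \<le> r / 2" and k: "0 < k" "k \<le> 1/8"
  defines "V \<equiv> unit_ball_vol (real CARD('n)) * ((1/4) ^ CARD('n) - (1/8) ^ CARD('n))"
  shows "integrable lebesgue (\<lambda>y. delta s (bump c (r/2)) x y * K y)"
    and "r powr (- 2 * s) * (lam * V / 2 - 64 * inner_const Lam s 2 * k powr (2 - 2 * s)
        - (9 * outer_const Lam s 0 * k powr (- 2 * s) + 8 * drift_const Lam s) * sqrt (bump c (r/2) x))
      \<le> nonlocal_op s K (bump c (r/2)) x"
proof -
  let ?d = "real CARD('n)"
  define b where "b = bump c (r/2)"
  define g where "g = bump_grad c (r/2) x"
  define q where "q = sqrt (b x)"
  have q: "0 \<le> q" "b x \<le> q" "q \<le> 1"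
    using bump_nonneg[of c "r/2" x] bump_le_sqrt_bump[of c "r/2" x] bump_le_1[of c "r/2" x]
    by (auto simp: q_def b_def real_sqrt_le_1_iff)
  have b01: "0 \<le> b z" "b z \<le> 1" for z by (auto simp: b_def bump_nonneg bump_le_1)
  have g: "norm g \<le> 8 / r * q"
    using bump_grad_bound[of "r/2" x c] x r by (simp add: g_def q_def b_def)
  have grad: "grad b x = g" unfolding b_def g_def by (rule grad_eqI[OF GDERIV_bump])
  have bm: "(\<lambda>y. b (x + y)) \<in> borel_measurable lebesgue" unfolding b_def by measurable
  note [measurable] = bm
  define E1 where "E1 y = (b (x + y) - b x - y \<bullet> g) * indicator (ball 0 (k * r)) y" for y
  define E2 where "E2 y = (b (x + y) - b x - (y \<bullet> g) * indicator (ball 0 r) y) * indicator (- ball 0 (k * r)) y" for y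
  define E3 where "E3 y = (y \<bullet> g) * (cutoff s y - indicator (ball 0 r) y)" for y
  define G where "G = ball (c - x) (r/4) - ball 0 (k * r)"
  have kr: "0 < k * r" "k * r \<le> r" using k r by auto
  have Gm: "G \<in> sets lebesgue" by (simp add: G_def)
  have E1m: "E1 \<in> borel_measurable lebesgue" unfolding E1_def by measurable
  have E2m: "E2 \<in> borel_measurable lebesgue" unfolding E2_def by measurable
  have split: "delta s b x y * K y = E1 y * K y + E2 y * K y - E3 y * K y" for y
  proof -
    have "delta s b x y = E1 y + E2 y - E3 y"
      using kr unfolding delta_cutoff grad E1_def E2_def E3_def
      by (auto simp: indicator_def algebra_simps)
    then show ?thesis by (simp only: distrib_right left_diff_distrib)
  qed
  have E1: "integrable lebesgue (\<lambda>y. E1 y * K y)"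
    "\<bar>\<integral>y. E1 y * K y \<partial>lebesgue\<bar> \<le> 64 / r\<^sup>2 * (inner_const Lam s 2 * (k * r) powr (2 - 2 * s))"
  proof -
    have e: "\<bar>E1 y\<bar> \<le> 64 / r\<^sup>2 * norm y powr 2" if "norm y < k * r" for y
      using bump_taylor[of "r/2" x c y] x r that kr
      by (auto simp: E1_def b_def g_def powr_numeral power2_eq_square)
    show "integrable lebesgue (\<lambda>y. E1 y * K y)"
      "\<bar>\<integral>y. E1 y * K y \<partial>lebesgue\<bar> \<le> 64 / r\<^sup>2 * (inner_const Lam s 2 * (k * r) powr (2 - 2 * s))"
      by (rule inner_integral[OF K Lam _ _ kr(1) _ E1m _ e]; use s in \<open>auto simp: E1_def\<close>)+
  qed
  have E3: "integrable lebesgue (\<lambda>y. E3 y * K y)"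
    "\<bar>\<integral>y. E3 y * K y \<partial>lebesgue\<bar> \<le> norm g * (drift_const Lam s * r powr (1 - 2 * s))"
    unfolding E3_def by (rule cutoff_drift[OF K Lam s(1) r(3)])+
  have yg: "\<bar>(y \<bullet> g) * indicator (ball 0 r) y\<bar> \<le> 8 * q" for y
  proof (cases "norm y < r")
    case True
    have "\<bar>y \<bullet> g\<bar> \<le> norm y * norm g" by (rule Cauchy_Schwarz_ineq2)
    also have "\<dots> \<le> r * (8 / r * q)" using True g r by (intro mult_mono) auto
    finally show ?thesis using r by (auto simp: indicator_def)
  qed (use q in auto)
  have E2b: "\<bar>E2 y\<bar> \<le> 10 * norm y powr 0" if "k * r \<le> norm y" for y
    using yg[of y] b01[of "x + y"] b01[of x] q that kr unfolding E2_def by auto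
  have E2: "integrable lebesgue (\<lambda>y. E2 y * K y)"
    by (rule outer_integral(1)[OF K Lam _ _ kr(1) _ E2m _ E2b]) (use s in \<open>auto simp: E2_def\<close>)
  show int: "integrable lebesgue (\<lambda>y. delta s (bump c (r/2)) x y * K y)"
    unfolding b_def[symmetric] split using E1(1) E2 E3(1) by auto
  let ?i = "indicator (- ball (0::real^'n) (k * r)) :: _ \<Rightarrow> real"
  have I: "integrable lebesgue (\<lambda>y. ?i y * K y)"
    "\<bar>\<integral>y. ?i y * K y \<partial>lebesgue\<bar> \<le> 1 * (outer_const Lam s 0 * (k * r) powr (0 - 2 * s))"
  proof -
    have i0: "?i y = 0" if "norm y < k * r" for y using that by simp
    have i1: "\<bar>?i y\<bar> \<le> 1 * norm y powr 0" if "k * r \<le> norm y" for y using that kr by auto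
    have im: "?i \<in> borel_measurable lebesgue" by simp
    have p: "(0::real) \<le> 0" "0 < 2 * s" "(0::real) \<le> 1" using s by auto
    show "integrable lebesgue (\<lambda>y. ?i y * K y)"
      "\<bar>\<integral>y. ?i y * K y \<partial>lebesgue\<bar> \<le> 1 * (outer_const Lam s 0 * (k * r) powr (0 - 2 * s))"
      by (rule outer_integral[OF K Lam p(1,2) kr(1) p(3) im i0 i1]; assumption)+
  qed
  have GK: "integrable lebesgue (\<lambda>y. indicator G y * K y)"
    "lam * r powr (- ?d - 2 * s) * (\<integral>y. indicator G y \<partial>lebesgue) \<le> (\<integral>y. indicator G y * K y \<partial>lebesgue)"
  proof -
    have far: "indicator G y = (0::real)" if "r < norm y" for y
    proof -
      have "norm y \<le> norm (c - x - y) + norm (c - x)"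
        using norm_triangle_ineq4[of "c - x" "c - x - y"] by simp
      then show ?thesis using that x r by (auto simp: G_def indicator_def dist_norm norm_minus_commute)
    qed
    have near: "indicator G y = (0::real)" if "norm y < k * r" for y
      using that by (simp add: G_def)
    show "integrable lebesgue (\<lambda>y. indicator G y * K y)"
      "lam * r powr (- ?d - 2 * s) * (\<integral>y. indicator G y \<partial>lebesgue) \<le> (\<integral>y. indicator G y * K y \<partial>lebesgue)"
      by (rule kernel_mass_lower_bound[OF K s(1) lam Lam r kr(1) borel_measurable_indicator[OF Gm] _ _ near far];
          simp add: indicator_def)+
  qed
  have E2low: "1/2 * (indicator G y * K y) - 9 * q * (?i y * K y) \<le> E2 y * K y" for y
  proof -
    have "1/2 * indicator G y - 9 * q * ?i y \<le> E2 y"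
    proof (cases "norm y < k * r")
      case True
      then show ?thesis by (auto simp: E2_def G_def)
    next
      case False
      have "1/2 * indicator G y \<le> b (x + y)"
      proof (cases "y \<in> G")
        case True
        then have "norm (x + y - c) \<le> r / 2 / 2"
          by (auto simp: G_def dist_norm norm_minus_commute algebra_simps)
        then show ?thesis using bump_ge_half[of "r/2" "x + y" c] r True by (auto simp: b_def)
      qed (use b01 in auto)
      then show ?thesis using yg[of y] q False unfolding E2_def by auto
    qed
    from mult_right_mono[OF this kernelsD(2)[OF K, of y]] show ?thesis
      by (simp add: algebra_simps)
  qed
  have E2int: "1/2 * (\<integral>y. indicator G y * K y \<partial>lebesgue) - 9 * q * (\<integral>y. ?i y * K y \<partial>lebesgue)
      \<le> (\<integral>y. E2 y * K y \<partial>lebesgue)"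
  proof -
    have "(\<integral>y. 1/2 * (indicator G y * K y) - 9 * q * (?i y * K y) \<partial>lebesgue) \<le> (\<integral>y. E2 y * K y \<partial>lebesgue)"
      by (intro integral_mono E2low E2) (use GK(1) I(1) in auto)
    then show ?thesis using GK(1) I(1) by (simp add: Bochner_Integration.integral_diff)
  qed
  let ?t = "r powr (- 2 * s)"
  have t1: "64 / r\<^sup>2 * (inner_const Lam s 2 * (k * r) powr (2 - 2 * s))
      = ?t * (64 * inner_const Lam s 2 * k powr (2 - 2 * s))"
  proof -
    have "r powr (2 - 2 * s) = r\<^sup>2 * ?t"
      using powr_add[of r 2 "- 2 * s"] r by (simp add: powr_numeral)
    then have "(k * r) powr (2 - 2 * s) = k powr (2 - 2 * s) * (r\<^sup>2 * ?t)"
      using k r by (simp add: powr_mult)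
    then show ?thesis using r by simp
  qed
  have t2: "norm g * (drift_const Lam s * r powr (1 - 2 * s)) \<le> ?t * (8 * drift_const Lam s * q)"
  proof -
    have "norm g * (drift_const Lam s * r powr (1 - 2 * s)) \<le> (8 / r * q) * (drift_const Lam s * r powr (1 - 2 * s))"
      using g drift_const_nonneg[OF Lam] by (intro mult_right_mono) auto
    also have "\<dots> = ?t * (8 * drift_const Lam s * q)"
    proof -
      have "r powr (1 - 2 * s) = r * ?t"
        using powr_add[of r 1 "- 2 * s"] r by simp
      then show ?thesis using r by simp
    qed
    finally show ?thesis .
  qed
  have t3: "9 * q * (\<integral>y. ?i y * K y \<partial>lebesgue) \<le> ?t * (9 * outer_const Lam s 0 * k powr (- 2 * s) * q)"
  proof -
    have "9 * q * (\<integral>y. ?i y * K y \<partial>lebesgue) \<le> 9 * q * (outer_const Lam s 0 * (k * r) powr (- 2 * s))"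
      using I(2) q by (intro mult_left_mono) auto
    also have "\<dots> = ?t * (9 * outer_const Lam s 0 * k powr (- 2 * s) * q)"
    proof -
      have "(k * r) powr (- 2 * s) = k powr (- 2 * s) * ?t"
        using k r by (intro powr_mult)
      then show ?thesis by (simp only: mult_ac)
    qed
    finally show ?thesis .
  qed
  have t4: "?t * (lam * V / 2) \<le> 1/2 * (\<integral>y. indicator G y * K y \<partial>lebesgue)"
  proof -
    have "r ^ CARD('n) * V \<le> (\<integral>y. indicator G y \<partial>lebesgue)"
      using measure_shell_lower_bound[OF r(3) k, of "c - x"] Gm by (simp add: G_def V_def)
    then have "lam * r powr (- ?d - 2 * s) * (r ^ CARD('n) * V) \<le> lam * r powr (- ?d - 2 * s) * (\<integral>y. indicator G y \<partial>lebesgue)"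
      using lam by (intro mult_left_mono) auto
    moreover have rt: "r powr (- ?d - 2 * s) * r ^ CARD('n) = ?t"
      using r by (simp add: powr_realpow[symmetric] powr_add[symmetric])
    have "lam * r powr (- ?d - 2 * s) * (r ^ CARD('n) * V) = ?t * (lam * V)"
      unfolding rt[symmetric] by (simp only: mult_ac)
    ultimately show ?thesis using GK(2) by simp
  qed
  have "nonlocal_op s K b x = (\<integral>y. E1 y * K y \<partial>lebesgue) + (\<integral>y. E2 y * K y \<partial>lebesgue) - (\<integral>y. E3 y * K y \<partial>lebesgue)"
    unfolding nonlocal_op_def split using E1(1) E2 E3(1) by simp
  moreover have "r powr (- 2 * s) * (lam * V / 2 - 64 * inner_const Lam s 2 * k powr (2 - 2 * s)
        - (9 * outer_const Lam s 0 * k powr (- 2 * s) + 8 * drift_const Lam s) * q)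
     = ?t * (lam * V / 2) - ?t * (64 * inner_const Lam s 2 * k powr (2 - 2 * s))
       - ?t * (9 * outer_const Lam s 0 * k powr (- 2 * s) * q) - ?t * (8 * drift_const Lam s * q)"
    by (simp add: algebra_simps)
  ultimately show "r powr (- 2 * s) * (lam * V / 2 - 64 * inner_const Lam s 2 * k powr (2 - 2 * s)
        - (9 * outer_const Lam s 0 * k powr (- 2 * s) + 8 * drift_const Lam s) * sqrt (bump c (r/2) x))
      \<le> nonlocal_op s K (bump c (r/2)) x"
    unfolding b_def[symmetric] q_def[symmetric]
    using E1(2) E2int E3(2) t1 t2 t3 t4 unfolding abs_le_iff by linarith
qed

text \<open>Fix \<open>k\<close> so small that the near part is dominated by the positive part \<open>2 * m\<close>. What remains is
\<open>m - C3 * q\<close> with \<open>q\<close> the square root of the bump, and by the inequality of arithmetic and geometric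
means it is at least \<open>- C * q\<^sup>2\<close>.\<close>

lemma bump_barrier:
  fixes s lam Lam B1 :: real
  assumes s: "0 < s" "s < 1" and lam: "0 < lam" and Lam: "0 < Lam" and B1: "0 \<le> B1"
  shows "\<exists>C>0. \<forall>\<rho> r (K :: real^'n \<Rightarrow> real) (c :: real^'n) x B.
    K \<in> kernels s lam Lam \<rho> \<and> 0 \<le> \<rho> \<and> \<rho> \<le> r \<and> 0 < r \<and> norm (x - c) \<le> r / 2 \<and>
    0 \<le> B \<and> B * r powr (2 * s - 1) \<le> B1 \<longrightarrow>
      B * norm (grad (bump c (r/2)) x) - nonlocal_op s K (bump c (r/2)) x
        \<le> C * r powr (- 2 * s) * bump c (r/2) x"
proof -
  define V where "V = unit_ball_vol (real CARD('n)) * ((1/4) ^ CARD('n) - (1/8) ^ CARD('n))"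
  define m where "m = lam * V / 4"
  have m: "0 < m" using shell_const_pos[where 'n='n] lam by (simp add: m_def V_def)
  define Ci where "Ci = 64 * inner_const Lam s 2"
  have Ci: "0 \<le> Ci" using inner_const_nonneg[of Lam s 2] s Lam by (simp add: Ci_def)
  define k where "k = min (1/8) ((m / (Ci + 1)) powr (1 / (2 - 2 * s)))"
  have k: "0 < k" "k \<le> 1/8" using m Ci by (auto simp: k_def)
  have "Ci * k powr (2 - 2 * s) \<le> m"
  proof -
    have "k powr (2 - 2 * s) \<le> ((m / (Ci + 1)) powr (1 / (2 - 2 * s))) powr (2 - 2 * s)"
      using s k by (intro powr_mono2) (auto simp: k_def)
    also have "\<dots> = m / (Ci + 1)" using s m Ci by (simp add: powr_powr)
    finally have "Ci * k powr (2 - 2 * s) \<le> Ci * (m / (Ci + 1))" using Ci by (rule mult_left_mono)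
    also have "\<dots> \<le> m" using Ci m by (simp add: field_simps)
    finally show ?thesis .
  qed
  note km = this
  define C3 where "C3 = 9 * outer_const Lam s 0 * k powr (- 2 * s) + 8 * drift_const Lam s + 8 * B1"
  define C where "C = C3\<^sup>2 / (4 * m) + 1"
  have C: "0 < C" using m by (simp add: C_def add_nonneg_pos)
  show ?thesis
  proof (intro exI[of _ C] conjI C allI impI)
    fix \<rho> r and K :: "real^'n \<Rightarrow> real" and c x :: "real^'n" and B
    assume *: "K \<in> kernels s lam Lam \<rho> \<and> 0 \<le> \<rho> \<and> \<rho> \<le> r \<and> 0 < r \<and> norm (x - c) \<le> r / 2 \<and>
      0 \<le> B \<and> B * r powr (2 * s - 1) \<le> B1"
    define q where "q = sqrt (bump c (r/2) x)"
    have q: "0 \<le> q" "q\<^sup>2 = bump c (r/2) x" by (auto simp: q_def bump_nonneg)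
    let ?t = "r powr (- 2 * s)"
    have t: "0 \<le> ?t" by simp
    have low: "?t * (2 * m - Ci * k powr (2 - 2 * s)
        - (9 * outer_const Lam s 0 * k powr (- 2 * s) + 8 * drift_const Lam s) * q) \<le> nonlocal_op s K (bump c (r/2)) x"
      using bump_operator_lower_bound(2)[of K s lam Lam \<rho> r x c k] * s lam Lam k
      by (simp add: m_def V_def Ci_def q_def)
    have gr: "B * norm (grad (bump c (r/2)) x) \<le> ?t * (8 * B1 * q)"
    proof -
      have "grad (bump c (r/2)) x = bump_grad c (r/2) x" by (rule grad_eqI[OF GDERIV_bump])
      then have "norm (grad (bump c (r/2)) x) \<le> 8 / r * q"
        using bump_grad_bound[of "r/2" x c] * by (simp add: q_def)
      then have "B * norm (grad (bump c (r/2)) x) \<le> B * (8 / r * q)" using * by (intro mult_left_mono) auto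
      also have "\<dots> = (B * r powr (2 * s - 1)) * (?t * 8 * q)"
        using * by (simp add: powr_diff powr_minus field_simps)
      also have "\<dots> \<le> B1 * (?t * 8 * q)" using * q by (intro mult_right_mono) auto
      finally show ?thesis by (simp add: mult_ac)
    qed
    have sq: "C3 * q \<le> m + C * q\<^sup>2"
    proof -
      have "0 \<le> (2 * m - C3 * q)\<^sup>2 / (4 * m)" using m by simp
      also have "\<dots> = m - C3 * q + C3\<^sup>2 / (4 * m) * q\<^sup>2"
        using m by (simp add: power2_eq_square field_simps)
      finally have "C3 * q \<le> m + C3\<^sup>2 / (4 * m) * q\<^sup>2" by simp
      also have "\<dots> \<le> m + C * q\<^sup>2" unfolding C_def by (simp add: distrib_right)
      finally show ?thesis .
    qed
    have "?t * (C3 * q - m) \<le> ?t * (C * q\<^sup>2)" using sq t by (intro mult_left_mono) auto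
    moreover have "?t * (8 * B1 * q) - ?t * (2 * m - Ci * k powr (2 - 2 * s)
        - (9 * outer_const Lam s 0 * k powr (- 2 * s) + 8 * drift_const Lam s) * q)
        = ?t * (C3 * q - 2 * m + Ci * k powr (2 - 2 * s))"
      by (simp add: C3_def algebra_simps)
    moreover have "?t * (C3 * q - 2 * m + Ci * k powr (2 - 2 * s)) \<le> ?t * (C3 * q - m)"
      using km t by (intro mult_left_mono) auto
    ultimately show "B * norm (grad (bump c (r/2)) x) - nonlocal_op s K (bump c (r/2)) x
        \<le> C * ?t * bump c (r/2) x"
      using low gr unfolding q(2)[symmetric] by (simp add: mult_ac)
  qed
qed

section \<open>The mass of the low set as an evolution\<close>

lemma usc_attains_max:
  fixes W :: "'a::metric_space \<Rightarrow> real"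
  assumes C: "compact C" "C \<noteq> {}" and usc: "usc_on C W"
  shows "\<exists>p\<in>C. \<forall>q\<in>C. W q \<le> W p"
proof (rule ccontr)
  assume "\<not> (\<exists>p\<in>C. \<forall>q\<in>C. W q \<le> W p)"
  then have "\<forall>p\<in>C. \<exists>q\<in>C. W p < W q" by (auto simp: not_le)
  then obtain f where f: "\<And>p. p \<in> C \<Longrightarrow> f p \<in> C \<and> W p < W (f p)" by metis
  have "\<exists>N. open N \<and> p \<in> N \<and> (\<forall>q\<in>N \<inter> C. W q < W (f p))" if p: "p \<in> C" for p
  proof -
    have "\<forall>\<^sub>F q in at p within C. W q < W (f p)"
      using usc p f[OF p] unfolding usc_on_def by blast
    then obtain N where "open N" "p \<in> N" "\<And>q. q \<in> N \<Longrightarrow> q \<noteq> p \<Longrightarrow> q \<in> C \<Longrightarrow> W q < W (f p)"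
      unfolding eventually_at_topological by auto
    then show ?thesis using f[OF p] by (intro exI[of _ N]) auto
  qed
  then obtain N where N: "\<And>p. p \<in> C \<Longrightarrow> open (N p) \<and> p \<in> N p \<and> (\<forall>q\<in>N p \<inter> C. W q < W (f p))"
    by metis
  have "\<exists>D\<subseteq>C. finite D \<and> C \<subseteq> (\<Union>p\<in>D. N p)"
    by (rule compactE_image[OF C(1), of C N]) (use N in auto)
  then obtain D where D: "D \<subseteq> C" "finite D" "C \<subseteq> (\<Union>p\<in>D. N p)" by auto
  then have "D \<noteq> {}" using C(2) by auto
  have "Max ((\<lambda>p. W (f p)) ` D) \<in> (\<lambda>p. W (f p)) ` D"
    using D(2) \<open>D \<noteq> {}\<close> by (intro Max_in) auto
  then obtain P where P': "P \<in> D" "Max ((\<lambda>p. W (f p)) ` D) = W (f P)" by auto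
  have P: "P \<in> D" "\<And>p. p \<in> D \<Longrightarrow> W (f p) \<le> W (f P)"
    using P'(1) D(2) unfolding P'(2)[symmetric] by auto
  have "f P \<in> C" using f P(1) D(1) by auto
  then obtain p where p: "p \<in> D" "f P \<in> N p" using D(3) by auto
  then have "W (f P) < W (f p)" using N[of p] D(1) \<open>f P \<in> C\<close> by auto
  then show False using P(2)[OF p(1)] by simp
qed

text \<open>The measure of the time slices of an open set is only lower semicontinuous in time. The cutoff
\<open>min 1 (k * infdist p (- U))\<close> replaces the indicator by a Lipschitz function with almost the same
integral, which makes the right-hand side of the differential equation below continuous.\<close>

lemma open_inner_lipschitz:
  fixes U :: "'a::euclidean_space set"
  assumes U: "open U" "bounded U" and \<mu>: "\<mu> < measure lborel U"
  shows "\<exists>g k. (\<forall>p q. \<bar>g p - g q\<bar> \<le> k * dist p q) \<and> 0 \<le> k \<and> (\<forall>p. 0 \<le> g p \<and> g p \<le> 1) \<and>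
    (\<forall>p. p \<notin> U \<longrightarrow> g p = 0) \<and> \<mu> < (\<integral>p. g p \<partial>lborel)"
proof -
  define g where "g k p = min 1 (real k * infdist p (- U))" for k p
  have ne: "- U \<noteq> {}"
    using U(2) not_bounded_UNIV by (metis Compl_empty_eq double_complement)
  have cl: "closed (- U)" using U(1) by auto
  have lip: "\<bar>g k p - g k q\<bar> \<le> real k * dist p q" for k p q
  proof -
    have "\<bar>g k p - g k q\<bar> \<le> \<bar>real k * infdist p (- U) - real k * infdist q (- U)\<bar>"
      by (auto simp: g_def min_def)
    also have "\<dots> = real k * \<bar>infdist p (- U) - infdist q (- U)\<bar>"
      by (simp add: right_diff_distrib[symmetric] abs_mult)
    also have "\<dots> \<le> real k * dist p q"
      by (intro mult_left_mono infdist_triangle_abs) auto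
    finally show ?thesis .
  qed
  have g01: "0 \<le> g k p" "g k p \<le> 1" for k p by (auto simp: g_def infdist_nonneg)
  have gU: "g k p = 0" if "p \<notin> U" for k p using that by (simp add: g_def)
  have [measurable]: "g k \<in> borel_measurable borel" for k
    unfolding g_def by (intro borel_measurable_continuous_onI continuous_intros)
  have [measurable]: "U \<in> sets borel" using U(1) by auto
  have fin: "emeasure lborel U < \<infinity>" by (rule emeasure_bounded_finite[OF U(2)])
  have "(\<lambda>k. \<integral>p. g k p \<partial>lborel) \<longlonglongrightarrow> (\<integral>p. indicator U p \<partial>lborel)"
  proof (rule integral_dominated_convergence[where w = "indicator U"])
    show "integrable lborel (indicator U :: _ \<Rightarrow> real)" using fin by (simp add: integrable_indicator_iff)
    show "AE p in lborel. (\<lambda>k. g k p) \<longlonglongrightarrow> indicator U p"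
    proof (rule AE_I2)
      fix p
      show "(\<lambda>k. g k p) \<longlonglongrightarrow> indicator U p"
      proof (cases "p \<in> U")
        case True
        then have pos: "0 < infdist p (- U)" using infdist_pos_not_in_closed[OF cl ne, of p] by auto
        obtain n where n: "1 < real n * infdist p (- U)" using reals_Archimedean3[OF pos, THEN spec, of 1] by auto
        have "g k p = 1" if "n \<le> k" for k
        proof -
          have "real n * infdist p (- U) \<le> real k * infdist p (- U)" using that pos by simp
          then show ?thesis using n by (simp add: g_def)
        qed
        then have "\<forall>\<^sub>F k in sequentially. g k p = 1" unfolding eventually_sequentially by auto
        then show ?thesis using True by (simp add: tendsto_eventually)
      qed (simp add: gU)
    qed
    show "AE p in lborel. norm (g k p) \<le> indicator U p" for k
      using g01 gU by (auto simp: indicator_def)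
  qed auto
  then have "(\<lambda>k. \<integral>p. g k p \<partial>lborel) \<longlonglongrightarrow> measure lborel U" by simp
  from order_tendstoD(1)[OF this \<mu>] obtain k where "\<mu> < (\<integral>p. g k p \<partial>lborel)"
    by (auto simp: eventually_sequentially)
  then show ?thesis using lip g01 gU by (intro exI[of _ "g k"] exI[of _ "real k"]) auto
qed

text \<open>Variation of constants for \<open>m' = \<kappa> * S - C * m\<close> with \<open>m a = 0\<close>.\<close>

lemma duhamel:
  fixes S :: "real \<Rightarrow> real"
  assumes S: "continuous_on UNIV S" "\<And>t. 0 \<le> S t" and \<kappa>: "0 \<le> \<kappa>" and C: "0 \<le> C"
  shows "\<exists>m. m a = 0 \<and> continuous_on {a..} m \<and>
    (\<forall>t>a. (m has_real_derivative \<kappa> * S t - C * m t) (at t)) \<and>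
    (\<forall>t\<ge>a. 0 \<le> m t \<and> m t \<le> \<kappa> * integral {a..t} S \<and> \<kappa> * exp (- C * (t - a)) * integral {a..t} S \<le> m t)"
proof -
  define F where "F \<tau> = exp (C * (\<tau> - a)) * (\<kappa> * S \<tau>)" for \<tau>
  define m where "m t = exp (- C * (t - a)) * integral {a..t} F" for t
  have Fc: "continuous_on X F" for X unfolding F_def
    by (intro continuous_intros continuous_on_subset[OF S(1)]) auto
  have Sc: "continuous_on X S" for X by (rule continuous_on_subset[OF S(1)]) auto
  have D: "((\<lambda>t. integral {a..t} F) has_real_derivative F t) (at t within {a..T})" if "a \<le> t" "t \<le> T" for t T
    using that by (intro integral_has_real_derivative Fc) auto
  have Dm: "(m has_real_derivative \<kappa> * S t - C * m t) (at t within {a..T})" if "a \<le> t" "t \<le> T" for t T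
    unfolding m_def
    by (rule derivative_eq_intros D[OF that] refl)+
      (auto simp: F_def field_simps exp_add[symmetric])
  have Dm': "(m has_real_derivative \<kappa> * S t - C * m t) (at t)" if "a < t" for t
  proof -
    have "at t within {a..t+1} = at t" using that by (intro at_within_interior) auto
    then show ?thesis using Dm[of t "t + 1"] that by simp
  qed
  have cont: "continuous_on {a..} m"
  proof -
    have "continuous (at t within {a..}) m" if "t \<in> {a..}" for t
    proof -
      have "continuous (at t within {a..t+1}) m"
        using Dm[of t "t + 1"] that DERIV_continuous by auto
      moreover have "at t within {a..t+1} = at t within {a..}"
        by (rule at_within_nhd[of _ "{..<t+1}"]) auto
      ultimately show ?thesis by simp
    qed
    then show ?thesis by (simp add: continuous_on_eq_continuous_within)
  qed
  have bounds: "0 \<le> m t \<and> m t \<le> \<kappa> * integral {a..t} S \<and> \<kappa> * exp (- C * (t - a)) * integral {a..t} S \<le> m t"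
    if t: "a \<le> t" for t
  proof -
    have int: "F integrable_on {a..t}" "S integrable_on {a..t}"
      by (auto intro!: integrable_continuous_interval Fc Sc)
    have up: "integral {a..t} F \<le> integral {a..t} (\<lambda>\<tau>. exp (C * (t - a)) * \<kappa> * S \<tau>)"
    proof (rule integral_le)
      fix \<tau> assume "\<tau> \<in> {a..t}"
      then have "exp (C * (\<tau> - a)) \<le> exp (C * (t - a))" using C by (auto intro!: mult_left_mono)
      then have "exp (C * (\<tau> - a)) * (\<kappa> * S \<tau>) \<le> exp (C * (t - a)) * (\<kappa> * S \<tau>)"
        using \<kappa> S(2) by (intro mult_right_mono) auto
      then show "F \<tau> \<le> exp (C * (t - a)) * \<kappa> * S \<tau>" by (simp add: F_def mult.assoc)
    qed (use int in \<open>auto intro!: integrable_on_mult_right\<close>)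
    have low: "integral {a..t} (\<lambda>\<tau>. \<kappa> * S \<tau>) \<le> integral {a..t} F"
    proof (rule integral_le)
      fix \<tau> assume "\<tau> \<in> {a..t}"
      then have "1 \<le> exp (C * (\<tau> - a))" using C by auto
      then have "1 * (\<kappa> * S \<tau>) \<le> exp (C * (\<tau> - a)) * (\<kappa> * S \<tau>)"
        using \<kappa> S(2) by (intro mult_right_mono) auto
      then show "\<kappa> * S \<tau> \<le> F \<tau>" by (simp add: F_def)
    qed (use int in \<open>auto intro!: integrable_on_mult_right\<close>)
    have up': "integral {a..t} F \<le> exp (C * (t - a)) * (\<kappa> * integral {a..t} S)"
      using up by (simp add: mult.assoc)
    have low': "\<kappa> * integral {a..t} S \<le> integral {a..t} F" using low by simp
    have I: "0 \<le> integral {a..t} S" using S(2) int by (intro integral_nonneg) auto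
    have e: "exp (- C * (t - a)) * exp (C * (t - a)) = 1" by (simp add: exp_add[symmetric])
    have "m t \<le> exp (- C * (t - a)) * (exp (C * (t - a)) * (\<kappa> * integral {a..t} S))"
      unfolding m_def using up' by (intro mult_left_mono) auto
    also have "\<dots> = \<kappa> * integral {a..t} S" using e by (simp add: mult.assoc[symmetric])
    finally have 1: "m t \<le> \<kappa> * integral {a..t} S" .
    have 2: "exp (- C * (t - a)) * (\<kappa> * integral {a..t} S) \<le> m t"
      unfolding m_def using low' by (intro mult_left_mono) auto
    have "0 \<le> exp (- C * (t - a)) * (\<kappa> * integral {a..t} S)" using \<kappa> I by simp
    then show ?thesis using 1 2 by (simp add: mult_ac)
  qed
  show ?thesis
    by (rule exI[of _ m]) (use cont Dm' bounds in \<open>auto simp: m_def\<close>)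
qed

text \<open>By Fubini's theorem the slice integrals of the Lipschitz cutoff are a continuous source for the
differential equation, and their total is above \<open>\<mu>\<close>. All of it has been collected at time \<open>b\<close>.\<close>

lemma mass_profile:
  fixes U :: "((real^'n) \<times> real) set"
  assumes ab: "a < b" and U: "open U" "U \<subseteq> ball c \<sigma> \<times> {a<..<b}" and \<mu>: "\<mu> < measure lborel U"
    and \<kappa>: "0 \<le> \<kappa>" and C: "0 \<le> C"
  shows "\<exists>g m. (\<forall>p. 0 \<le> g p \<and> g p \<le> 1) \<and> (\<forall>p. p \<notin> U \<longrightarrow> g p = 0) \<and> continuous_on UNIV g \<and>
    m a = 0 \<and> continuous_on {a..} m \<and>
    (\<forall>t>a. (m has_real_derivative \<kappa> * (\<integral>x. g (x, t) \<partial>lebesgue) - C * m t) (at t)) \<and>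
    (\<forall>t\<ge>a. 0 \<le> m t \<and> m t \<le> \<kappa> * measure lborel U) \<and>
    (\<forall>t\<ge>b. \<kappa> * exp (- C * (t - a)) * \<mu> \<le> m t)"
proof -
  have "bounded (ball c \<sigma> \<times> {a..b})"
    by (intro bounded_Times bounded_ball bounded_closed_interval)
  then have bU: "bounded U"
    by (rule bounded_subset) (use U(2) in auto)
  obtain g k where lip: "\<And>p q. \<bar>g p - g q\<bar> \<le> k * dist p q" and k: "0 \<le> k"
    and g01: "\<And>p. 0 \<le> g p" "\<And>p. g p \<le> 1" and gU: "\<And>p. p \<notin> U \<Longrightarrow> g p = 0"
    and g\<mu>: "\<mu> < (\<integral>p. g p \<partial>lborel)"
    using open_inner_lipschitz[OF U(1) bU \<mu>] by blast
  have gc: "continuous_on UNIV g"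
    by (rule lipschitz_on_continuous_on[of k]) (use lip k in \<open>auto intro!: lipschitz_onI simp: dist_real_def\<close>)
  have gm [measurable]: "g \<in> borel_measurable borel" by (rule borel_measurable_continuous_onI[OF gc])
  have gsm [measurable]: "(\<lambda>x. g (x, t)) \<in> borel_measurable borel" for t
    by (intro borel_measurable_continuous_onI continuous_on_compose2[OF gc] continuous_intros) auto
  define S where "S t = (\<integral>x. g (x, t) \<partial>lborel)" for t
  have Sleb: "(\<integral>x. g (x, t) \<partial>lebesgue) = S t" for t
    unfolding S_def by (rule integral_completion) simp
  have Uc: "g (x, t) = 0" if "x \<notin> ball c \<sigma>" for x t using that U(2) by (intro gU) auto
  have Ut: "g (x, t) = 0" if "t \<notin> {a<..<b}" for x t using that U(2) by (intro gU) auto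
  have bint: "integrable lborel (indicator (ball c \<sigma>) :: real^'n \<Rightarrow> real)"
    using emeasure_bounded_finite[OF bounded_ball, of c \<sigma>] by (simp add: integrable_indicator_iff)
  have sint: "integrable lborel (\<lambda>x. g (x, t))" for t
    by (rule Bochner_Integration.integrable_bound[OF bint]) (use g01 Uc in \<open>auto simp: indicator_def\<close>)
  have S0: "0 \<le> S t" for t unfolding S_def using g01 by simp
  have Slip: "\<bar>S t - S t'\<bar> \<le> k * measure lborel (ball c \<sigma>) * \<bar>t - t'\<bar>" for t t'
  proof -
    have "\<bar>S t - S t'\<bar> = \<bar>\<integral>x. g (x, t) - g (x, t') \<partial>lborel\<bar>"
      unfolding S_def using sint by simp
    also have "\<dots> \<le> (\<integral>x. \<bar>g (x, t) - g (x, t')\<bar> \<partial>lborel)" by simp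
    also have "\<dots> \<le> (\<integral>x. k * \<bar>t - t'\<bar> * indicator (ball c \<sigma>) x \<partial>lborel)"
    proof (rule integral_mono)
      fix x
      show "\<bar>g (x, t) - g (x, t')\<bar> \<le> k * \<bar>t - t'\<bar> * indicator (ball c \<sigma>) x"
        using lip[of "(x, t)" "(x, t')"] Uc by (auto simp: dist_Pair_Pair dist_real_def indicator_def)
    qed (use sint bint in auto)
    also have "\<dots> = k * measure lborel (ball c \<sigma>) * \<bar>t - t'\<bar>" by simp
    finally show ?thesis .
  qed
  have Sc: "continuous_on UNIV S"
    by (rule lipschitz_on_continuous_on[of "k * measure lborel (ball c \<sigma>)"])
      (use Slip k in \<open>auto intro!: lipschitz_onI simp: dist_real_def\<close>)
  have fin: "emeasure lborel U < \<infinity>" by (rule emeasure_bounded_finite[OF bU])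
  have Uint: "integrable lborel (indicator U :: _ \<Rightarrow> real)"
    using fin U(1) by (simp add: integrable_indicator_iff)
  have gint: "integrable lborel g"
    by (rule Bochner_Integration.integrable_bound[OF Uint]) (use g01 gU in \<open>auto simp: indicator_def\<close>)
  have gle: "(\<integral>p. g p \<partial>lborel) \<le> measure lborel U"
  proof -
    have "(\<integral>p. g p \<partial>lborel) \<le> (\<integral>p. indicator U p \<partial>lborel)"
      by (rule integral_mono[OF gint Uint]) (use g01 gU in \<open>auto simp: indicator_def\<close>)
    then show ?thesis using U(1) by simp
  qed
  have Sint: "integrable lborel S" "(\<integral>t. S t \<partial>lborel) = (\<integral>p. g p \<partial>lborel)"
  proof -
    have gp: "integrable (lborel \<Otimes>\<^sub>M lborel) (\<lambda>(x, t). g (x, t))"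
      using gint by (simp add: lborel_prod case_prod_unfold)
    show "integrable lborel S" unfolding S_def by (rule lborel_pair.integrable_snd[OF gp])
    show "(\<integral>t. S t \<partial>lborel) = (\<integral>p. g p \<partial>lborel)"
      unfolding S_def lborel_pair.integral_snd[OF gp] by (simp add: lborel_prod case_prod_unfold)
  qed
  have S_out: "S t = 0" if "t \<notin> {a<..<b}" for t unfolding S_def using Ut[OF that] by simp
  have SI: "integral {a..t} S = (\<integral>\<tau>. indicator {a..t} \<tau> * S \<tau> \<partial>lborel)" for t
  proof -
    have "set_integrable lborel {a..t} S"
      unfolding set_integrable_def using Sint(1) by (intro integrable_mult_indicator) auto
    from set_borel_integral_eq_integral(2)[OF this] show ?thesis
      by (simp add: set_lebesgue_integral_def)
  qed
  have SI_le: "integral {a..t} S \<le> measure lborel U" for t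
  proof -
    have "(\<integral>\<tau>. indicator {a..t} \<tau> * S \<tau> \<partial>lborel) \<le> (\<integral>\<tau>. S \<tau> \<partial>lborel)"
      using S0 Sint(1) integrable_mult_indicator[of "{a..t}" lborel S]
      by (intro integral_mono) (auto simp: indicator_def)
    then show ?thesis using SI Sint(2) gle by simp
  qed
  have SI_ge: "\<mu> \<le> integral {a..t} S" if "b \<le> t" for t
  proof -
    have eq: "indicator {a..t} \<tau> * S \<tau> = S \<tau>" for \<tau>
      using S_out[of \<tau>] that by (cases "\<tau> \<in> {a<..<b}") (auto simp: indicator_def)
    show ?thesis using Sint(2) g\<mu> unfolding SI eq by simp
  qed
  obtain m where m: "m a = 0" "continuous_on {a..} m"
    "\<And>t. a < t \<Longrightarrow> (m has_real_derivative \<kappa> * S t - C * m t) (at t)"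
    "\<And>t. a \<le> t \<Longrightarrow> 0 \<le> m t \<and> m t \<le> \<kappa> * integral {a..t} S \<and> \<kappa> * exp (- C * (t - a)) * integral {a..t} S \<le> m t"
    using duhamel[OF Sc S0 \<kappa> C, of a] by blast
  have m1: "0 \<le> m t \<and> m t \<le> \<kappa> * measure lborel U" if "a \<le> t" for t
    using m(4)[OF that] mult_left_mono[OF SI_le[of t] \<kappa>] by auto
  have m2: "\<kappa> * exp (- C * (t - a)) * \<mu> \<le> m t" if "b \<le> t" "a \<le> t" for t
  proof -
    have "\<kappa> * exp (- C * (t - a)) * \<mu> \<le> \<kappa> * exp (- C * (t - a)) * integral {a..t} S"
      using SI_ge[OF that(1)] \<kappa> by (intro mult_left_mono) auto
    then show ?thesis using m(4)[OF that(2)] by linarith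
  qed
  show ?thesis
    by (intro exI[of _ g] exI[of _ m]) (use ab g01 gU gc m(1-3) m1 m2 in \<open>auto simp: Sleb\<close>)
qed

section \<open>Perturbing the operator by a bounded function\<close>

text \<open>At the contact point the competitor differs from a multiple of the bump plus a constant by a bounded
function that vanishes near the point. Such a function is integrated against the kernel without any
compensation, whatever the value of \<open>s\<close>.\<close>

lemma nonlocal_op_perturb:
  fixes K b w :: "real^'n \<Rightarrow> real"
  assumes K: "K \<in> kernels s lam Lam \<rho>" and s: "0 < s" and Lam: "0 \<le> Lam"
    and int: "integrable lebesgue (\<lambda>y. delta s b x y * K y)" and gb: "GDERIV b x :> g"
    and e: "0 < \<epsilon>" and Dm: "D \<in> borel_measurable lebesgue"
    and D0: "\<And>y. norm y < \<epsilon> \<Longrightarrow> D y = 0" and DN: "\<And>y. \<bar>D y\<bar> \<le> N"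
    and w: "\<And>y. w (x + y) = c - k * b (x + y) + D y"
  shows "grad w x = - k *\<^sub>R g" and "integrable lebesgue (\<lambda>y. D y * K y)"
    and "nonlocal_op s K w x = - k * nonlocal_op s K b x + (\<integral>y. D y * K y \<partial>lebesgue)"
proof -
  have "GDERIV (\<lambda>z. c - k * b z) x :> - k *\<^sub>R g"
    using gb unfolding gderiv_def by (auto intro!: derivative_eq_intros)
  then have "((\<lambda>z. c - k * b z) has_derivative (\<lambda>h. h \<bullet> (- k *\<^sub>R g))) (at x)"
    by (simp only: gderiv_def)
  then have "(w has_derivative (\<lambda>h. h \<bullet> (- k *\<^sub>R g))) (at x)"
  proof (rule has_derivative_transform_within_open)
    show "open (ball x \<epsilon>)" "x \<in> ball x \<epsilon>" using e by auto
    fix z assume "z \<in> ball x \<epsilon>"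
    then have "D (z - x) = 0" by (intro D0) (simp add: dist_norm norm_minus_commute)
    then show "c - k * b z = w z" using w[of "z - x"] by simp
  qed
  then have "GDERIV w x :> - k *\<^sub>R g" by (simp only: gderiv_def)
  then show gw: "grad w x = - k *\<^sub>R g" by (rule grad_eqI)
  have gb': "grad b x = g" by (rule grad_eqI[OF gb])
  have DN': "\<bar>D y\<bar> \<le> max 0 N * norm y powr 0" if "\<epsilon> \<le> norm y" for y
    using DN[of y] that e by auto
  have p: "(0::real) \<le> 0" "0 < 2 * s" "0 \<le> max 0 N" using s by auto
  show intD: "integrable lebesgue (\<lambda>y. D y * K y)"
    by (rule outer_integral(1)[OF K Lam p(1,2) e p(3) Dm D0 DN'])
  have "delta s w x y * K y = - k * (delta s b x y * K y) + D y * K y" for y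
  proof -
    have "w x = c - k * b x" using w[of 0] D0[of 0] e by simp
    then have "delta s w x y = - k * delta s b x y + D y"
      unfolding delta_cutoff gw gb' w by (simp add: algebra_simps)
    then show ?thesis by (simp only: distrib_right mult.assoc)
  qed
  then have "nonlocal_op s K w x = (\<integral>y. - k * (delta s b x y * K y) + D y * K y \<partial>lebesgue)"
    unfolding nonlocal_op_def by simp
  also have "\<dots> = (\<integral>y. - k * (delta s b x y * K y) \<partial>lebesgue) + (\<integral>y. D y * K y \<partial>lebesgue)"
    by (rule Bochner_Integration.integral_add) (use int intD in auto)
  finally show "nonlocal_op s K w x = - k * nonlocal_op s K b x + (\<integral>y. D y * K y \<partial>lebesgue)"
    unfolding nonlocal_op_def by simp
qed

lemma slice_measurable:
  assumes u: "u \<in> bounded_borel (UNIV \<times> I)" and t: "t \<in> I"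
  shows "(\<lambda>x::real^'n. u (x, t)) \<in> borel_measurable borel"
proof -
  have "(\<lambda>x::real^'n. (x, t)) \<in> borel \<rightarrow>\<^sub>M restrict_space borel (UNIV \<times> I)"
    by (rule measurable_restrict_space2)
      (use t in \<open>auto intro!: borel_measurable_continuous_onI continuous_intros\<close>)
  moreover have "u \<in> borel_measurable (restrict_space borel (UNIV \<times> I))"
    using u by (simp add: bounded_borel_def)
  ultimately show ?thesis by (rule measurable_compose)
qed

lemma lebesgue_integral_shift:
  fixes f :: "real^'n \<Rightarrow> real"
  assumes f: "f \<in> borel_measurable borel"
  shows "(\<integral>y. f (x + y) \<partial>lebesgue) = (\<integral>y. f y \<partial>lebesgue)"
proof -
  have [measurable]: "f \<in> borel_measurable borel" by fact
  have "(\<integral>y. f (x + y) \<partial>lebesgue) = (\<integral>y. f (x + y) \<partial>lborel)"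
    by (rule integral_completion) simp
  also have "\<dots> = (\<integral>y. f y \<partial>distr lborel borel ((+) x))"
    by (subst integral_distr) auto
  also have "\<dots> = (\<integral>y. f y \<partial>lebesgue)"
    unfolding lborel_distr_plus by (rule integral_completion[symmetric]) simp
  finally show ?thesis .
qed

definition tail_const :: "real \<Rightarrow> real \<Rightarrow> real" where
  "tail_const Lam s = outer_const Lam s s * 4 powr s"

lemma tail_const_nonneg: "0 < s \<Longrightarrow> 0 \<le> Lam \<Longrightarrow> 0 \<le> tail_const Lam s"
  unfolding tail_const_def using outer_const_nonneg[of Lam s s] by auto

text \<open>Seen from a point of \<open>ball x0 (r / 2)\<close>, the growth \<open>(norm (x - x0) / r)^s\<close> outside of \<open>ball x0 r\<close> is majorized
by \<open>T\<close>, because then \<open>norm (x - x0) \<le> 2 * norm y\<close> for the increment \<open>y\<close>.\<close>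

lemma tail_integral:
  fixes K :: "real^'n \<Rightarrow> real"
  assumes K: "K \<in> kernels s lam Lam \<rho>" and s: "0 < s" and Lam: "0 \<le> Lam" and r: "0 < r"
  defines "T \<equiv> \<lambda>y::real^'n. (2 / r) powr s * norm y powr s * indicator (- ball 0 (r / 2)) y"
  shows "integrable lebesgue (\<lambda>y. T y * K y)"
    and "(\<integral>y. T y * K y \<partial>lebesgue) \<le> tail_const Lam s * r powr (- 2 * s)"
proof -
  have Tm: "T \<in> borel_measurable lebesgue" unfolding T_def by measurable
  have T0: "T y = 0" if "norm y < r / 2" for y using that by (simp add: T_def)
  have Tb: "\<bar>T y\<bar> \<le> (2 / r) powr s * norm y powr s" if "r / 2 \<le> norm y" for y
    using that by (auto simp: T_def abs_mult)
  have p: "0 \<le> s" "s < 2 * s" "0 < r / 2" "0 \<le> (2 / r) powr s" using s r by auto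
  note I = outer_integral[OF K Lam p Tm T0 Tb]
  show "integrable lebesgue (\<lambda>y. T y * K y)" by (rule I(1))
  have "(\<integral>y. T y * K y \<partial>lebesgue) \<le> (2 / r) powr s * (outer_const Lam s s * (r / 2) powr (s - 2 * s))"
    using I(2) by linarith
  also have "\<dots> = outer_const Lam s s * ((2 / r) powr s * (r / 2) powr (- s))" by simp
  also have "(2 / r) powr s * (r / 2) powr (- s) = 4 powr s * r powr (- 2 * s)"
  proof -
    have "(r / 2) powr (- s) = (2 / r) powr s"
      using r by (simp add: powr_minus powr_divide)
    then have "(2 / r) powr s * (r / 2) powr (- s) = ((2 / r) * (2 / r)) powr s"
      by (simp only: powr_mult)
    also have "(2 / r) * (2 / r) = 4 * (1 / r * (1 / r))" by simp
    also have "\<dots> powr s = 4 powr s * (1 / r * (1 / r)) powr s"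
      using r by (subst powr_mult) auto
    also have "1 / r * (1 / r) = r powr (- 2)"
      using r by (simp add: powr_minus divide_inverse power2_eq_square)
    also have "(r powr (- 2)) powr s = r powr (- 2 * s)"
      by (simp only: powr_powr)
    finally show ?thesis .
  qed
  finally show "(\<integral>y. T y * K y \<partial>lebesgue) \<le> tail_const Lam s * r powr (- 2 * s)"
    by (simp add: tail_const_def)
qed

text \<open>Within distance \<open>\<epsilon>\<close> of the contact point the operator sees the test function in place of \<open>u\<close>, so the part of
the low set in that ball is lost; the loss tends to \<open>0\<close> with \<open>\<epsilon>\<close>.\<close>

lemma shifted_mass_bound:
  fixes \<gamma> :: "real^'n \<Rightarrow> real"
  assumes \<gamma>: "\<gamma> \<in> borel_measurable borel" "\<And>x. 0 \<le> \<gamma> x" "\<And>x. \<gamma> x \<le> 1" "\<And>x. x \<notin> ball c \<sigma> \<Longrightarrow> \<gamma> x = 0"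
    and e: "0 \<le> \<epsilon>"
  shows "(\<integral>x. \<gamma> x \<partial>lebesgue) - unit_ball_vol (real CARD('n)) * \<epsilon> ^ CARD('n)
    \<le> (\<integral>y. \<gamma> (x + y) * indicator (- ball 0 \<epsilon>) y \<partial>lebesgue)"
proof -
  have gm: "(\<lambda>y. \<gamma> (x + y)) \<in> borel_measurable lebesgue"
    by (rule borel_imp_lebesgue) (use \<gamma>(1) in measurable)
  have bint: "integrable lebesgue (indicator (ball (c - x) \<sigma>) :: real^'n \<Rightarrow> real)"
    "integrable lebesgue (indicator (ball 0 \<epsilon>) :: real^'n \<Rightarrow> real)"
    using emeasure_bounded_finite[OF bounded_ball, of "c - x" \<sigma>]
      emeasure_bounded_finite[OF bounded_ball, of "0::real^'n" \<epsilon>]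
    by (auto simp: integrable_indicator_iff)
  have z: "\<gamma> (x + y) = 0" if "y \<notin> ball (c - x) \<sigma>" for y
    using that by (intro \<gamma>(4)) (simp add: dist_norm algebra_simps)
  have int1: "integrable lebesgue (\<lambda>y. \<gamma> (x + y))"
    by (rule Bochner_Integration.integrable_bound[OF bint(1) gm])
      (use \<gamma>(2,3) z in \<open>auto simp: indicator_def\<close>)
  have int2: "integrable lebesgue (\<lambda>y. \<gamma> (x + y) * indicator (- ball 0 \<epsilon>) y)"
    using integrable_mult_indicator[OF _ int1, of "- ball 0 \<epsilon>"] by (simp add: mult.commute)
  have "(\<integral>x. \<gamma> x \<partial>lebesgue) = (\<integral>y. \<gamma> (x + y) \<partial>lebesgue)"
    by (rule lebesgue_integral_shift[OF \<gamma>(1), symmetric])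
  also have "\<dots> \<le> (\<integral>y. \<gamma> (x + y) * indicator (- ball 0 \<epsilon>) y + indicator (ball 0 \<epsilon>) y \<partial>lebesgue)"
  proof (rule integral_mono[OF int1 Bochner_Integration.integrable_add[OF int2 bint(2)]])
    fix y
    show "\<gamma> (x + y) \<le> \<gamma> (x + y) * indicator (- ball 0 \<epsilon>) y + indicator (ball 0 \<epsilon>) y"
      using \<gamma>(2,3)[of "x + y"] by (cases "y \<in> ball 0 \<epsilon>") auto
  qed
  also have "\<dots> = (\<integral>y. \<gamma> (x + y) * indicator (- ball 0 \<epsilon>) y \<partial>lebesgue) + measure lebesgue (ball (0::real^'n) \<epsilon>)"
    using int2 bint(2) by (subst Bochner_Integration.integral_add) auto
  finally show ?thesis using measure_lebesgue_ball[OF e, of "0::real^'n"] by simp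
qed

lemma left_dt_eqI:
  assumes d: "(f has_real_derivative D) (at_left t)" and e: "0 < \<epsilon>"
    and v: "\<And>\<tau>. t - \<epsilon> < \<tau> \<Longrightarrow> \<tau> \<le> t \<Longrightarrow> v (x, \<tau>) = f \<tau>"
  shows "left_dt v (x, t) = D"
proof -
  have "\<forall>\<^sub>F \<tau> in at_left t. v (x, \<tau>) = f \<tau>"
    unfolding eventually_at_left[of "t - 1" t, simplified]
    by (rule exI[of _ "t - \<epsilon>"]) (use e v in auto)
  then have "((\<lambda>\<tau>. v (x, \<tau>)) has_real_derivative D) (at_left t)"
    using d v[of t] e by (subst has_field_derivative_cong_eventually[of _ f]) auto
  then have "((\<lambda>\<tau>. v (x, \<tau>)) has_vector_derivative D) (at_left t)"
    by (rule has_real_derivative_iff_has_vector_derivative[THEN iffD1])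
  then show ?thesis unfolding left_dt_def fst_conv snd_conv
    by (intro vector_derivative_within) auto
qed

section \<open>The touching argument\<close>

text \<open>A free drift coefficient \<open>B\<close> covers the equations with drift (\<open>B = Lam\<close>) and without (\<open>B = 0\<close>).\<close>

abbreviation drift_sub ::
  "real \<Rightarrow> real \<Rightarrow> real \<Rightarrow> real \<Rightarrow> real \<Rightarrow> real \<Rightarrow> real \<Rightarrow> ((real^'n) \<times> real \<Rightarrow> real) \<Rightarrow> bool" where
  "drift_sub s lam Lam \<rho> B A R u \<equiv> visc_sub (ball 0 R) (time_interval s R)
     (\<lambda>w x. M_plus s lam Lam \<rho> w x + B * norm (grad w x)) (\<lambda>_. A) u"

abbreviation drift_super ::
  "real \<Rightarrow> real \<Rightarrow> real \<Rightarrow> real \<Rightarrow> real \<Rightarrow> real \<Rightarrow> real \<Rightarrow> ((real^'n) \<times> real \<Rightarrow> real) \<Rightarrow> bool" where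
  "drift_super s lam Lam \<rho> B A R u \<equiv> visc_super (ball 0 R) (time_interval s R)
     (\<lambda>w x. M_minus s lam Lam \<rho> w x - B * norm (grad w x)) (\<lambda>_. - A) u"

text \<open>Let the barrier touch \<open>u\<close> from above at \<open>(x1, t1)\<close>. Using it as a test function, the term \<open>h * \<kappa> * S * b\<close>
in its time derivative is compensated by the low set, because \<open>\<kappa>\<close> is at most a quarter of the kernel
lower bound and \<open>b \<le> 1\<close>; the term with \<open>C\<close> is compensated by the barrier inequality. So the slope \<open>A'\<close>
of the barrier in time cannot exceed the right-hand side and the tail. A larger slope
therefore rules out any contact.\<close>

lemma touching_bound:
  fixes u :: "(real^'n) \<times> real \<Rightarrow> real"
  assumes s: "0 < s" "s < 1" and lam: "0 < lam" and Lam: "0 < Lam"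
    and vs: "drift_sub s lam Lam \<rho> B A R u"
    and ne: "(kernels s lam Lam \<rho> :: (real^'n \<Rightarrow> real) set) \<noteq> {}"
    and r: "0 \<le> \<rho>" "\<rho> \<le> r" "0 < r"
    and dom: "norm x0 + r \<le> R" "- (R powr (2 * s)) < a" "t0 \<le> 0"
    and x1: "norm (x1 - x0) < r / 2" and t1: "a < t1" "t1 \<le> t0"
    and md: "\<And>t. a < t \<Longrightarrow> m differentiable (at t)"
    and dm: "(m has_real_derivative \<kappa> * (\<integral>x. \<gamma> x \<partial>lebesgue) - C * r powr (- 2 * s) * m t1) (at t1)"
    and m: "0 \<le> m t1" "m t1 \<le> 1/4"
    and barrier: "\<And>K. K \<in> kernels s lam Lam \<rho> \<Longrightarrow>
       B * norm (grad (bump x0 (r/2)) x1) - nonlocal_op s K (bump x0 (r/2)) x1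
         \<le> C * r powr (- 2 * s) * bump x0 (r/2) x1"
    and touch: "u (x1, t1) = M' - h * m t1 * bump x0 (r/2) x1 + A' * (t1 - a)"
    and below: "\<And>x t. norm (x - x0) < r \<Longrightarrow> a < t \<Longrightarrow> t \<le> t0 \<Longrightarrow>
       u (x, t) \<le> M' - h * m t * bump x0 (r/2) x + A' * (t - a)"
    and M: "M \<le> M'" and h: "0 < h" and A': "0 \<le> A'" and \<eta>: "0 \<le> \<eta>"
    and tail: "\<And>x. r \<le> norm (x - x0) \<Longrightarrow> u (x, t1) \<le> M + \<eta> * h * (norm (x - x0) / r) powr s"
    and \<gamma>: "\<gamma> \<in> borel_measurable borel" "\<And>x. 0 \<le> \<gamma> x" "\<And>x. \<gamma> x \<le> 1"
      "\<And>x. \<gamma> x \<noteq> 0 \<Longrightarrow> norm (x - x0) < r / 2 \<and> u (x, t1) < M - h / 2"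
    and \<kappa>: "0 \<le> \<kappa>" "\<kappa> \<le> lam * r powr (- real CARD('n) - 2 * s) / 4"
  shows "A' \<le> A + \<eta> * h * (tail_const Lam s * r powr (- 2 * s))"
proof (rule field_le_epsilon)
  fix \<delta> :: real assume \<delta>: "0 < \<delta>"
  let ?d = "real CARD('n)" and ?b = "bump x0 (r/2)" and ?I = "time_interval s R"
  define l where "l = lam * r powr (- ?d - 2 * s)"
  have l: "0 < l" using lam r by (simp add: l_def)
  define V where "V = unit_ball_vol ?d"
  have V: "0 < V" by (simp add: V_def)
  define \<epsilon> where "\<epsilon> = Min {r / 2, t1 - a, 1, 4 * \<delta> / (h * l * V)}"
  have e: "0 < \<epsilon>" "\<epsilon> \<le> r / 2" "\<epsilon> \<le> t1 - a" "\<epsilon> \<le> 1" "\<epsilon> \<le> 4 * \<delta> / (h * l * V)"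
  proof -
    \<comment> \<open>The first two bounds keep the backward cylinder inside the domain of the barrier, the last one makes the lost mass cost at most \<open>\<delta>\<close>.\<close>
    have le: "\<epsilon> \<le> z" if "z \<in> {r / 2, t1 - a, 1, 4 * \<delta> / (h * l * V)}" for z
      unfolding \<epsilon>_def using that by (intro Min_le) auto
    show "\<epsilon> \<le> r / 2" "\<epsilon> \<le> t1 - a" "\<epsilon> \<le> 1" "\<epsilon> \<le> 4 * \<delta> / (h * l * V)"
      by (rule le, simp)+
    show "0 < \<epsilon>" using r t1 \<delta> h l V by (auto simp: \<epsilon>_def)
  qed
  have small: "h / 4 * l * (V * \<epsilon> ^ CARD('n)) \<le> \<delta>"
  proof -
    have "\<epsilon> ^ CARD('n) \<le> \<epsilon> ^ 1" using e by (intro power_decreasing) auto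
    then have "h / 4 * l * (V * \<epsilon> ^ CARD('n)) \<le> h / 4 * l * (V * (4 * \<delta> / (h * l * V)))"
      using e h l V by (intro mult_left_mono) auto
    also have "\<dots> = \<delta>" using h l V by simp
    finally show ?thesis .
  qed
  define \<phi> where "\<phi> q = M' - h * m (snd q) * ?b (fst q) + A' * (snd q - a)" for q
  define v where "v q = (if q \<in> back_cyl \<epsilon> (x1, t1) then \<phi> q else u q)" for q
  \<comment> \<open>\<open>v\<close> is the competitor of the definition of viscosity subsolutions, and \<open>w\<close> its slice at time \<open>t1\<close>.\<close>
  define w where "w x = v (x, t1)" for x
  define c where "c = M' + A' * (t1 - a)"
  define S where "S = (\<integral>x. \<gamma> x \<partial>lebesgue)"
  have x1r: "norm (x - x0) < r" if "x \<in> ball x1 \<epsilon>" for x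
  proof -
    have "norm (x - x0) \<le> norm (x - x1) + norm (x1 - x0)"
      using norm_triangle_ineq[of "x - x1" "x1 - x0"] by simp
    then show ?thesis using that x1 e by (simp add: dist_norm norm_minus_commute)
  qed
  have ball_sub: "norm x < R" if "norm (x - x0) < r" for x
    using norm_triangle_ineq[of "x - x0" x0] that dom by simp
  have cyl: "back_cyl \<epsilon> (x1, t1) \<subseteq> ball 0 R \<times> ?I"
    using x1r ball_sub dom e t1 by (fastforce simp: back_cyl_def time_interval_def)
  have p: "(x1, t1) \<in> ball 0 R \<times> ?I" "t1 \<in> ?I"
    using ball_sub[of x1] x1 r dom t1 by (auto simp: time_interval_def)
  have test: "test_fun \<epsilon> (x1, t1) \<phi>"
    unfolding test_fun_def
  proof (intro conjI ballI)
    fix q assume "q \<in> back_cyl \<epsilon> (x1, t1)"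
    then obtain x t where q: "q = (x, t)" "a < t" using e by (auto simp: back_cyl_def)
    have "(\<lambda>\<tau>. \<phi> (x, \<tau>)) differentiable (at t)"
      unfolding \<phi>_def fst_conv snd_conv
      by (intro derivative_intros md q(2))
    then show "case q of (x, t) \<Rightarrow> (\<lambda>\<tau>. \<phi> (x, \<tau>)) differentiable (at_left t)"
      using q by (auto intro: differentiable_at_withinI)
  next
    fix t
    have "C11_on (ball x1 \<epsilon>) ?b" using r by (intro bump_C11) auto
    then obtain g L where gL: "\<And>x. x \<in> ball x1 \<epsilon> \<Longrightarrow> GDERIV ?b x :> g x" "L-lipschitz_on (ball x1 \<epsilon>) g"
      unfolding C11_on_def by blast
    have "GDERIV (\<lambda>x. \<phi> (x, t)) x :> (- (h * m t)) *\<^sub>R g x" if "x \<in> ball x1 \<epsilon>" for x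
      using gL(1)[OF that] unfolding gderiv_def \<phi>_def fst_conv snd_conv
      by (auto intro!: derivative_eq_intros)
    moreover have "(\<bar>- (h * m t)\<bar> * L)-lipschitz_on (ball x1 \<epsilon>) (\<lambda>x. (- (h * m t)) *\<^sub>R g x)"
      by (rule lipschitz_on_cmult[OF gL(2)])
    ultimately show "C11_on (ball (fst (x1, t1)) \<epsilon>) (\<lambda>x. \<phi> (x, t))"
      unfolding C11_on_def fst_conv
      by (intro exI[of _ "\<lambda>x. (- (h * m t)) *\<^sub>R g x"] exI[of _ "\<bar>- (h * m t)\<bar> * L"] conjI ballI)
  qed
  have dom_phi: "u q \<le> \<phi> q" if "q \<in> back_cyl \<epsilon> (x1, t1)" for q
    using that below[of "fst q" "snd q"] x1r[of "fst q"] e t1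
    by (auto simp: back_cyl_def \<phi>_def)
  have key: "left_dt v (x1, t1) - (M_plus s lam Lam \<rho> w x1 + B * norm (grad w x1)) \<le> A"
  proof -
    have u\<phi>: "u (x1, t1) = \<phi> (x1, t1)" using touch by (simp add: \<phi>_def)
    have "\<forall>p \<in> ball 0 R \<times> ?I. \<forall>\<epsilon>>0. \<forall>\<phi>.
        back_cyl \<epsilon> p \<subseteq> ball 0 R \<times> ?I \<and> test_fun \<epsilon> p \<phi> \<and> u p = \<phi> p \<and> (\<forall>q \<in> back_cyl \<epsilon> p. u q \<le> \<phi> q) \<longrightarrow>
        (let v = (\<lambda>q. if q \<in> back_cyl \<epsilon> p then \<phi> q else u q)
         in left_dt v p - (M_plus s lam Lam \<rho> (\<lambda>x. v (x, snd p)) (fst p)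
              + B * norm (grad (\<lambda>x. v (x, snd p)) (fst p))) \<le> A)"
      using vs unfolding visc_sub_def by (elim conjE)
    from this[rule_format, OF p(1) e(1), of \<phi>] cyl test u\<phi> dom_phi show ?thesis
      unfolding Let_def v_def[abs_def, symmetric] w_def[abs_def] fst_conv snd_conv by blast
  qed
  have dt: "left_dt v (x1, t1) = A' - h * (\<kappa> * S - C * r powr (- 2 * s) * m t1) * ?b x1"
  proof (rule left_dt_eqI[where f = "\<lambda>t. M' - h * m t * ?b x1 + A' * (t - a)" and \<epsilon> = \<epsilon>],
      rule has_field_derivative_at_within)
    show "((\<lambda>t. M' - h * m t * ?b x1 + A' * (t - a)) has_real_derivative
       A' - h * (\<kappa> * S - C * r powr (- 2 * s) * m t1) * ?b x1) (at t1)"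
      unfolding S_def by (auto intro!: derivative_eq_intros dm)
  qed (use e in \<open>auto simp: v_def back_cyl_def \<phi>_def\<close>)
  have ub: "u \<in> bounded_borel (UNIV \<times> ?I)" using vs by (simp add: visc_sub_def)
  obtain N where N: "\<And>x. \<bar>u (x, t1)\<bar> \<le> N"
  proof -
    obtain N where N: "\<And>q. q \<in> UNIV \<times> ?I \<Longrightarrow> norm (u q) \<le> N"
      using ub unfolding bounded_borel_def bounded_iff by blast
    show ?thesis by (rule that[of N]) (use N p(2) in force)
  qed
  have b01: "0 \<le> ?b x" "?b x \<le> 1" for x by (auto simp: bump_nonneg bump_le_1)
  have hm: "0 \<le> h * m t1" "h * m t1 \<le> h / 4" using h m mult_left_mono[OF m(2), of h] by auto
  have hmb: "0 \<le> h * m t1 * ?b x" "h * m t1 * ?b x \<le> h / 4" for x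
    using hm b01[of x] mult_mono[OF hm(2) b01(2)[of x]] h by auto
  define D where "D y = (if norm y < \<epsilon> then 0 else u (x1 + y, t1) - (c - h * m t1 * ?b (x1 + y)))" for y
  have w_eq: "w (x1 + y) = c - (h * m t1) * ?b (x1 + y) + D y" for y
    using e by (auto simp: w_def v_def D_def back_cyl_def \<phi>_def c_def dist_norm)
  have Dm: "D \<in> borel_measurable lebesgue"
  proof -
    have [measurable]: "(\<lambda>x. u (x, t1)) \<in> borel_measurable borel" by (rule slice_measurable[OF ub p(2)])
    show ?thesis unfolding D_def by (rule borel_imp_lebesgue) measurable
  qed
  have D0: "D y = 0" if "norm y < \<epsilon>" for y using that by (simp add: D_def)
  have DN: "\<bar>D y\<bar> \<le> N + \<bar>c\<bar> + h" for y
  proof (cases "norm y < \<epsilon>")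
    case True
    then show ?thesis using N[of x1] h by (simp add: D_def)
  next
    case False
    then have "D y = u (x1 + y, t1) - (c - h * m t1 * ?b (x1 + y))" by (simp add: D_def)
    then show ?thesis using N[of "x1 + y"] hmb[of "x1 + y"] h by linarith
  qed
  define \<Gamma> where "\<Gamma> y = \<gamma> (x1 + y) * indicator (- ball 0 \<epsilon>) y" for y
  define T where "T y = (2 / r) powr s * norm y powr s * indicator (- ball 0 (r / 2)) y" for y :: "real^'n"
  have D_le: "D y \<le> \<eta> * h * T y - h / 4 * \<Gamma> y" for y
  proof (cases "norm y < \<epsilon>")
    case True
    then show ?thesis using e by (simp add: D_def \<Gamma>_def T_def)
  next
    case False
    define x where "x = x1 + y"
    have D: "D y = u (x, t1) - (c - h * m t1 * ?b x)" using False by (simp add: D_def x_def)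
    have G: "\<Gamma> y = \<gamma> x" using False by (simp add: \<Gamma>_def x_def)
    have cM: "M \<le> c" using M mult_nonneg_nonneg[OF A', of "t1 - a"] t1 by (simp add: c_def)
    have T0: "0 \<le> \<eta> * h * T y" using \<eta> h by (simp add: T_def)
    show ?thesis
    proof (cases "norm (x - x0) < r")
      case True
      show ?thesis
      proof (cases "\<gamma> x = 0")
        case True
        then show ?thesis using below[OF \<open>norm (x - x0) < r\<close> t1] T0 by (simp add: D G c_def)
      next
        case False
        then have "u (x, t1) < M - h / 2" using \<gamma>(4) by blast
        then have "D y \<le> - h / 4" using hmb[of x] cM unfolding D by linarith
        moreover have "h / 4 * \<gamma> x \<le> h / 4 * 1" using \<gamma>(3) h by (intro mult_left_mono) auto
        ultimately show ?thesis using T0 unfolding G by linarith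
      qed
    next
      case F: False
      then have "\<gamma> x = 0" using \<gamma>(4)[of x] r by auto
      have "?b x = 0" using F r by (intro bump_eq_0) auto
      have tri: "norm (x - x0) \<le> norm (x1 - x0) + norm y"
        using norm_triangle_ineq[of "x1 - x0" y] by (simp add: x_def algebra_simps)
      then have y: "r / 2 \<le> norm y" using F x1 by linarith
      have "norm (x - x0) / r \<le> 2 * norm y / r"
        using tri x1 y r by (intro divide_right_mono) auto
      then have "(norm (x - x0) / r) powr s \<le> (2 / r * norm y) powr s"
        using s r by (intro powr_mono2) auto
      also have "\<dots> = T y" using y unfolding T_def powr_mult by simp
      finally have "\<eta> * h * (norm (x - x0) / r) powr s \<le> \<eta> * h * T y"
        using \<eta> h by (intro mult_left_mono) auto
      then show ?thesis using tail[of x] F cM \<open>\<gamma> x = 0\<close> \<open>?b x = 0\<close> by (simp add: D G)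
    qed
  qed
  define Z where "Z = h * m t1 * (C * r powr (- 2 * s) * ?b x1) - B * (h * m t1 * norm (grad ?b x1))
      + \<eta> * h * (tail_const Lam s * r powr (- 2 * s)) - h / 4 * (l * (S - V * \<epsilon> ^ CARD('n)))"
  have Kbound: "grad w x1 = - (h * m t1) *\<^sub>R grad ?b x1 \<and> nonlocal_op s K w x1 \<le> Z"
    if K: "K \<in> kernels s lam Lam \<rho>" for K
  proof -
    have Lam0: "0 \<le> Lam" using Lam by simp
    have int: "integrable lebesgue (\<lambda>y. delta s ?b x1 y * K y)"
      by (rule bump_operator_lower_bound(1)[OF K s lam Lam0 r _ , of _ _ "1/8"]) (use x1 in auto)
    have gb: "grad ?b x1 = bump_grad x0 (r/2) x1" by (rule grad_eqI[OF GDERIV_bump])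
    note P = nonlocal_op_perturb[OF K s(1) Lam0 int GDERIV_bump e(1) Dm D0 DN w_eq]
    have Gint: "integrable lebesgue (\<lambda>y. \<Gamma> y * K y)" "l * (\<integral>y. \<Gamma> y \<partial>lebesgue) \<le> (\<integral>y. \<Gamma> y * K y \<partial>lebesgue)"
    proof -
      have gm: "\<Gamma> \<in> borel_measurable lebesgue"
        unfolding \<Gamma>_def by (rule borel_imp_lebesgue) (use \<gamma>(1) in measurable)
      have G01: "0 \<le> \<Gamma> y" "\<Gamma> y \<le> 1" for y
        using \<gamma>(2,3)[of "x1 + y"] by (auto simp: \<Gamma>_def indicator_def)
      have G0: "\<Gamma> y = 0" if "norm y < \<epsilon>" for y using that by (simp add: \<Gamma>_def)
      have G1: "\<Gamma> y = 0" if "r < norm y" for y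
      proof -
        have "norm y \<le> norm (x1 + y - x0) + norm (x1 - x0)"
          using norm_triangle_ineq4[of "x1 + y - x0" "x1 - x0"] by (simp add: algebra_simps)
        then have "\<gamma> (x1 + y) = 0" using \<gamma>(4)[of "x1 + y"] x1 that by (cases "\<gamma> (x1 + y) = 0") auto
        then show ?thesis by (simp add: \<Gamma>_def)
      qed
      show "integrable lebesgue (\<lambda>y. \<Gamma> y * K y)" "l * (\<integral>y. \<Gamma> y \<partial>lebesgue) \<le> (\<integral>y. \<Gamma> y * K y \<partial>lebesgue)"
        unfolding l_def
        by (rule kernel_mass_lower_bound[OF K s(1) lam Lam0 r e(1) gm G01 G0 G1]; assumption)+
    qed
    have Gmass: "S - V * \<epsilon> ^ CARD('n) \<le> (\<integral>y. \<Gamma> y \<partial>lebesgue)"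
      unfolding S_def V_def \<Gamma>_def
      by (rule shifted_mass_bound[where c = x0 and \<sigma> = "r/2"])
        (use \<gamma> e in \<open>auto simp: dist_norm norm_minus_commute\<close>)
    have GK: "l * (S - V * \<epsilon> ^ CARD('n)) \<le> (\<integral>y. \<Gamma> y * K y \<partial>lebesgue)"
      using mult_left_mono[OF Gmass, of l] l Gint(2) by linarith
    have Tint: "integrable lebesgue (\<lambda>y. T y * K y)"
      "(\<integral>y. T y * K y \<partial>lebesgue) \<le> tail_const Lam s * r powr (- 2 * s)"
      unfolding T_def by (rule tail_integral[OF K s(1) Lam0 r(3)])+
    have "(\<integral>y. D y * K y \<partial>lebesgue) \<le> (\<integral>y. \<eta> * h * (T y * K y) - h / 4 * (\<Gamma> y * K y) \<partial>lebesgue)"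
    proof (rule integral_mono[OF P(2)])
      fix y
      show "D y * K y \<le> \<eta> * h * (T y * K y) - h / 4 * (\<Gamma> y * K y)"
        using mult_right_mono[OF D_le[of y] kernelsD(2)[OF K, of y]] by (simp add: algebra_simps)
    qed (use Tint(1) Gint(1) in auto)
    also have "\<dots> = \<eta> * h * (\<integral>y. T y * K y \<partial>lebesgue) - h / 4 * (\<integral>y. \<Gamma> y * K y \<partial>lebesgue)"
      using Tint(1) Gint(1) by (subst Bochner_Integration.integral_diff) auto
    also have "\<dots> \<le> \<eta> * h * (tail_const Lam s * r powr (- 2 * s)) - h / 4 * (l * (S - V * \<epsilon> ^ CARD('n)))"
      using Tint(2) GK \<eta> h by (intro diff_mono mult_left_mono) auto
    finally have Dint: "(\<integral>y. D y * K y \<partial>lebesgue)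
      \<le> \<eta> * h * (tail_const Lam s * r powr (- 2 * s)) - h / 4 * (l * (S - V * \<epsilon> ^ CARD('n)))" .
    have "h * m t1 * (B * norm (grad ?b x1) - nonlocal_op s K ?b x1) \<le> h * m t1 * (C * r powr (- 2 * s) * ?b x1)"
      by (rule mult_left_mono[OF barrier[OF K] hm(1)])
    then have "- (h * m t1) * nonlocal_op s K ?b x1
        \<le> h * m t1 * (C * r powr (- 2 * s) * ?b x1) - B * (h * m t1 * norm (grad ?b x1))"
      by (simp add: algebra_simps)
    then show ?thesis using P(1,3) Dint unfolding gb Z_def by auto
  qed
  have Mp: "M_plus s lam Lam \<rho> w x1 \<le> Z"
    unfolding M_plus_def using ne Kbound by (intro cSUP_least) auto
  have gw: "norm (grad w x1) = h * m t1 * norm (grad ?b x1)"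
  proof -
    have "grad w x1 = - (h * m t1) *\<^sub>R grad ?b x1" using ne Kbound by blast
    then show ?thesis using h m(1) by (simp add: abs_mult)
  qed
  have \<kappa>S: "h * (\<kappa> * S) * ?b x1 \<le> h / 4 * (l * S)"
  proof -
    have S0: "0 \<le> S" unfolding S_def using \<gamma>(2) by simp
    have "\<kappa> * S \<le> l / 4 * S" using \<kappa>(2) S0 by (intro mult_right_mono) (auto simp: l_def)
    then have "h * (\<kappa> * S) \<le> h * (l / 4 * S)" using h by (intro mult_left_mono) auto
    moreover have "h * (\<kappa> * S) * ?b x1 \<le> h * (\<kappa> * S) * 1"
      using b01 h \<kappa>(1) S0 by (intro mult_left_mono) auto
    ultimately show ?thesis by simp
  qed
  have fin: "A' - h * (\<kappa> * S - C * r powr (- 2 * s) * m t1) * ?b x1 \<le> A + Z + B * (h * m t1 * norm (grad ?b x1))"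
    using key Mp unfolding dt gw by linarith
  show "A' \<le> A + \<eta> * h * (tail_const Lam s * r powr (- 2 * s)) + \<delta>"
  proof -
    have "h * (\<kappa> * S - C * r powr (- 2 * s) * m t1) * ?b x1
        = h * (\<kappa> * S) * ?b x1 - h * m t1 * (C * r powr (- 2 * s) * ?b x1)"
      by (simp only: left_diff_distrib right_diff_distrib mult_ac)
    moreover have "h / 4 * (l * (S - V * \<epsilon> ^ CARD('n))) = h / 4 * (l * S) - h / 4 * l * (V * \<epsilon> ^ CARD('n))"
      by (simp only: left_diff_distrib right_diff_distrib mult_ac)
    ultimately show ?thesis using fin \<kappa>S small unfolding Z_def by linarith
  qed
qed

section \<open>Diminish of oscillation\<close>

lemma usc_on_subset: "usc_on S u \<Longrightarrow> T \<subseteq> S \<Longrightarrow> usc_on T u"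
  unfolding usc_on_def by (meson at_le filter_leD subsetD)

lemma usc_on_add_continuous:
  assumes u: "usc_on S u" and f: "continuous_on S f"
  shows "usc_on S (\<lambda>q. u q + f q)"
  unfolding usc_on_def
proof (intro ballI allI impI)
  fix p a assume p: "p \<in> S" and a: "u p + f p < a"
  define \<delta> where "\<delta> = (a - (u p + f p)) / 2"
  have d: "0 < \<delta>" "u p + \<delta> + (f p + \<delta>) = a" using a by (auto simp: \<delta>_def field_simps)
  have "\<forall>\<^sub>F q in at p within S. u q < u p + \<delta>"
    using u p d(1) unfolding usc_on_def by simp
  moreover have "\<forall>\<^sub>F q in at p within S. f q < f p + \<delta>"
    using f p d(1) by (intro order_tendstoD(2)) (auto simp: continuous_on_def)
  ultimately show "\<forall>\<^sub>F q in at p within S. u q + f q < a"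
    by eventually_elim (use d(2) in linarith)
qed

lemma usc_on_open_sublevel:
  assumes u: "usc_on S u" and G: "open G" "G \<subseteq> S"
  shows "open {q \<in> G. u q < a}"
proof (subst open_subopen, intro ballI)
  fix p assume p: "p \<in> {q \<in> G. u q < a}"
  then have "\<forall>\<^sub>F q in at p within S. u q < a" using u G unfolding usc_on_def by blast
  then obtain N where N: "open N" "p \<in> N" "\<And>q. q \<in> N \<Longrightarrow> q \<noteq> p \<Longrightarrow> q \<in> S \<Longrightarrow> u q < a"
    unfolding eventually_at_topological by auto
  show "\<exists>T. open T \<and> p \<in> T \<and> T \<subseteq> {q \<in> G. u q < a}"
    by (rule exI[of _ "N \<inter> G"]) (use N G p in auto)
qed

lemma measure_space_time_box:
  assumes "0 \<le> \<sigma>" "a \<le> b"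
  shows "emeasure lborel (ball (c::real^'n) \<sigma> \<times> {a<..<b})
      = ennreal (unit_ball_vol (real CARD('n)) * \<sigma> ^ CARD('n) * (b - a))"
proof -
  have "emeasure lborel (ball c \<sigma> \<times> {a<..<b}) = emeasure lborel (ball c \<sigma>) * emeasure lborel {a<..<b}"
    unfolding lborel_prod[symmetric] by (rule lborel.emeasure_pair_measure_Times) auto
  also have "emeasure lborel (ball c \<sigma>) = ennreal (unit_ball_vol (real CARD('n)) * \<sigma> ^ CARD('n))"
    using emeasure_ball[OF assms(1), of c] by simp
  finally show ?thesis using assms by (simp add: ennreal_mult)
qed

text \<open>The inner ball and the earlier half of the time interval: the set on which the smallness of \<open>u\<close> is
measured. The later half is where the conclusion is drawn.\<close>

definition half_cyl :: "real \<Rightarrow> real \<Rightarrow> real^'n \<Rightarrow> real \<Rightarrow> ((real^'n) \<times> real) set" where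
  "half_cyl s r x0 t0 = ball x0 (r / 2) \<times> {t0 - r powr (2 * s) <..< t0 - r powr (2 * s) / 2}"

lemma measure_half_cyl:
  assumes "0 < r"
  shows "measure lborel (half_cyl s r (x0 :: real^'n) t0)
    = unit_ball_vol (real CARD('n)) * (r / 2) ^ CARD('n) * (r powr (2 * s) / 2)"
    and "emeasure lborel (half_cyl s r (x0 :: real^'n) t0) < \<infinity>"
proof -
  have e: "emeasure lborel (half_cyl s r x0 t0)
    = ennreal (unit_ball_vol (real CARD('n)) * (r / 2) ^ CARD('n) * (r powr (2 * s) / 2))"
    unfolding half_cyl_def using assms by (subst measure_space_time_box) auto
  show "emeasure lborel (half_cyl s r x0 t0) < \<infinity>" unfolding e by simp
  show "measure lborel (half_cyl s r x0 t0)
    = unit_ball_vol (real CARD('n)) * (r / 2) ^ CARD('n) * (r powr (2 * s) / 2)"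
    unfolding measure_def e using assms by simp
qed

text \<open>The cylinder of radius \<open>r\<close> with top centre \<open>(x0, t0)\<close> lies in the domain of the equation, the kernels look
untruncated at scale \<open>r\<close>, and the drift is at most of critical size there.\<close>

abbreviation admissible_scale ::
  "real \<Rightarrow> real \<Rightarrow> real \<Rightarrow> real \<Rightarrow> real \<Rightarrow> real \<Rightarrow> real \<Rightarrow> real \<Rightarrow> real^'n \<Rightarrow> real \<Rightarrow> bool" where
  "admissible_scale s lam Lam \<rho> B B1 R r x0 t0 \<equiv>
    (kernels s lam Lam \<rho> :: (real^'n \<Rightarrow> real) set) \<noteq> {} \<and> 0 \<le> \<rho> \<and> \<rho> \<le> r \<and> 0 < r \<and>
    0 \<le> B \<and> B * r powr (2 * s - 1) \<le> B1 \<and> norm x0 + r \<le> R \<and> - (R powr (2 * s)) < t0 - r powr (2 * s) \<and> t0 \<le> 0"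

text \<open>If the comparison function were not above \<open>u\<close>, then \<open>W\<close> would attain a maximum above \<open>M\<close>, by upper
semicontinuity. The maximum is neither at the initial time, where \<open>m\<close> vanishes, nor at the lateral
boundary, where the bump does. So it is a contact point as in \<open>touching_bound\<close>, against the choice of
\<open>A'\<close>. The tail of \<open>u\<close> is allowed to grow like the power \<open>s\<close>, which is integrable at infinity.\<close>

lemma diminish_of_oscillation:
  fixes s lam Lam B1 :: real
  assumes s: "0 < s" "s < 1" and lam: "0 < lam" and Lam: "0 < Lam" and B1: "0 \<le> B1"
  shows "\<exists>\<eta> \<theta>. 0 < \<eta> \<and> 0 < \<theta> \<and> \<theta> \<le> 1 \<and> (\<forall>\<rho> A B R r (x0 :: real^'n) t0 u M h.
    drift_sub s lam Lam \<rho> B A R u \<and>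
    admissible_scale s lam Lam \<rho> B B1 R r x0 t0 \<and>
    0 < h \<and> A * r powr (2 * s) \<le> \<eta> * h \<and>
    (\<forall>x t. norm (x - x0) < r \<and> t0 - r powr (2 * s) \<le> t \<and> t \<le> t0 \<longrightarrow> u (x, t) \<le> M) \<and>
    (\<forall>x t. r \<le> norm (x - x0) \<and> t0 - r powr (2 * s) \<le> t \<and> t \<le> t0 \<longrightarrow>
       u (x, t) \<le> M + \<eta> * h * (norm (x - x0) / r) powr s) \<and>
    measure lborel (half_cyl s r x0 t0) / 2
      \<le> measure lborel {q \<in> half_cyl s r x0 t0. u q < M - h / 2}
    \<longrightarrow> (\<forall>x t. norm (x - x0) \<le> r / 4 \<and> t0 - r powr (2 * s) / 2 \<le> t \<and> t \<le> t0 \<longrightarrow>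
       u (x, t) \<le> M - \<theta> * h))"
proof -
  let ?d = "real CARD('n)"
  obtain C where C: "0 < C" and barrier: "\<And>\<rho> r (K :: real^'n \<Rightarrow> real) (c :: real^'n) x B.
    K \<in> kernels s lam Lam \<rho> \<and> 0 \<le> \<rho> \<and> \<rho> \<le> r \<and> 0 < r \<and> norm (x - c) \<le> r / 2 \<and>
    0 \<le> B \<and> B * r powr (2 * s - 1) \<le> B1 \<Longrightarrow>
      B * norm (grad (bump c (r/2)) x) - nonlocal_op s K (bump c (r/2)) x
        \<le> C * r powr (- 2 * s) * bump c (r/2) x"
    using bump_barrier[OF s lam Lam B1, where 'n='n] by blast
  define V where "V = unit_ball_vol ?d"
  have V: "0 < V" by (simp add: V_def)
  \<comment> \<open>The first bound on \<open>\<kappa>0\<close> is the one required at a contact point, the second keeps \<open>m\<close> below \<open>1 / 4\<close>, so that the barrier stays above the low level by \<open>h / 4\<close>.\<close>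
  define \<kappa>0 where "\<kappa>0 = min (lam / 4) (1 / (4 * V))"
  have \<kappa>0: "0 < \<kappa>0" "\<kappa>0 \<le> lam / 4" "\<kappa>0 * V \<le> 1 / 4"
    using lam V by (auto simp: \<kappa>0_def min_def field_simps)
  define m1 where "m1 = \<kappa>0 * V / 2 ^ CARD('n) / 2"
  have m1: "0 < m1" "m1 \<le> 1 / 4"
  proof -
    show "0 < m1" using \<kappa>0 V by (simp add: m1_def)
    have "\<kappa>0 * V / 2 ^ CARD('n) \<le> \<kappa>0 * V / 1"
      using \<kappa>0 V by (intro divide_left_mono) auto
    moreover have "0 < \<kappa>0 * V" using \<kappa>0 V by simp
    moreover have "z / 2 \<le> 1 / 4" if "z \<le> w / 1" "0 < w" "w \<le> 1 / 4" for z w :: real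
      using that by simp
    ultimately show "m1 \<le> 1 / 4" using \<kappa>0(3) unfolding m1_def by blast
  qed
  \<comment> \<open>A lower bound for \<open>m\<close> at the later times, from the mass accumulated before.\<close>
  define m0 where "m0 = m1 * exp (- C) / 4"
  have m0: "0 < m0" "m0 \<le> 1"
  proof -
    show "0 < m0" using m1 by (simp add: m0_def)
    have "m1 * exp (- C) \<le> (1/4) * 1" using m1 C by (intro mult_mono) auto
    then show "m0 \<le> 1" by (simp add: m0_def)
  qed
  define \<tau> where "\<tau> = tail_const Lam s"
  have \<tau>: "0 \<le> \<tau>" using tail_const_nonneg[of s Lam] s Lam by (simp add: \<tau>_def)
  \<comment> \<open>With this choice the slope \<open>A'\<close> costs, over the whole time interval, half of the gain \<open>h * m0 / 2\<close>.\<close>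
  define \<eta> where "\<eta> = m0 / (4 * (2 + \<tau>))"
  have \<eta>: "0 < \<eta>" "\<eta> * (2 + \<tau>) = m0 / 4" 
  proof -
    show "0 < \<eta>" unfolding \<eta>_def using m0 \<tau> by (intro divide_pos_pos) auto
    have "k / (4 * z) * z = k / 4" if "0 < z" for k z :: real using that by simp
    moreover have "0 < 2 + \<tau>" using \<tau> by linarith
    ultimately show "\<eta> * (2 + \<tau>) = m0 / 4" unfolding \<eta>_def by blast
  qed
  show ?thesis
  proof (rule exI[of _ \<eta>], rule exI[of _ "m0 / 4"], intro conjI allI impI, goal_cases)
    case 1 show ?case by (rule \<eta>(1))
  next
    case 2 show ?case using m0(1) by simp
  next
    case 3 show ?case using m0(2) by simp
  next
    case (4 \<rho> A B R r x0 t0 u M h x t)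
    define q where "q = r powr (2 * s)"
    define a where "a = t0 - q"
    define b where "b = t0 - q / 2"
    have r: "0 \<le> \<rho>" "\<rho> \<le> r" "0 < r" and q: "0 < q" using 4 by (auto simp: q_def)
    have vs: "drift_sub s lam Lam \<rho> B A R u"
      and ne: "(kernels s lam Lam \<rho> :: (real^'n \<Rightarrow> real) set) \<noteq> {}"
      and B: "0 \<le> B" "B * r powr (2 * s - 1) \<le> B1"
      and dom: "norm x0 + r \<le> R" "- (R powr (2 * s)) < a" "t0 \<le> 0"
      and h: "0 < h" and A: "A * q \<le> \<eta> * h"
      and in_M: "\<And>x t. norm (x - x0) < r \<Longrightarrow> a \<le> t \<Longrightarrow> t \<le> t0 \<Longrightarrow> u (x, t) \<le> M"
      and tail: "\<And>x t. r \<le> norm (x - x0) \<Longrightarrow> a \<le> t \<Longrightarrow> t \<le> t0 \<Longrightarrow>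
          u (x, t) \<le> M + \<eta> * h * (norm (x - x0) / r) powr s"
      and xt: "norm (x - x0) \<le> r / 4" "b \<le> t" "t \<le> t0"
      using 4 unfolding q_def a_def b_def by auto
    have r2s: "r powr (- 2 * s) = 1 / q"
      using r by (simp add: q_def powr_minus divide_inverse)
    have ab: "a < b" "b < t0" "a < t0" using q by (auto simp: a_def b_def)
    define U where "U = {q \<in> half_cyl s r x0 t0. u q < M - h / 2}"
    define P where "P = measure lborel (half_cyl s r x0 t0)"
    have mU: "P / 2 \<le> measure lborel U" using 4 unfolding U_def P_def by blast
    have P_eq: "P = V * (r / 2) ^ CARD('n) * (q / 2)"
      unfolding P_def measure_half_cyl(1)[OF r(3)] V_def q_def by simp
    have P: "0 < P" using V r q by (simp add: P_eq)
    have box: "half_cyl s r x0 t0 = ball x0 (r / 2) \<times> {a<..<b}"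
      by (simp add: half_cyl_def a_def b_def q_def)
    have dom_in: "(x, t) \<in> ball 0 R \<times> time_interval s R" if "norm (x - x0) < r" "a \<le> t" "t \<le> t0" for x t
      using norm_triangle_ineq[of "x - x0" x0] that dom by (auto simp: time_interval_def)
    have usc: "usc_on (ball 0 R \<times> time_interval s R) u" using vs by (simp add: visc_sub_def)
    have U: "open U" "U \<subseteq> ball x0 (r / 2) \<times> {a<..<b}"
    proof -
      show "open U" unfolding U_def
      proof (rule usc_on_open_sublevel[OF usc])
        show "open (half_cyl s r x0 t0)" unfolding box by (intro open_Times) auto
        show "half_cyl s r x0 t0 \<subseteq> ball 0 R \<times> time_interval s R"
        proof
          fix z assume "z \<in> half_cyl s r x0 t0"
          then show "z \<in> ball 0 R \<times> time_interval s R"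
            using dom_in[of "fst z" "snd z"] ab r unfolding box
            by (cases z) (auto simp: dist_norm norm_minus_commute)
        qed
      qed
    qed (auto simp: U_def box)
    have UP: "measure lborel U \<le> P" unfolding P_def
    proof (rule measure_mono_fmeasurable)
      show "half_cyl s r x0 t0 \<in> fmeasurable lborel"
      proof (rule fmeasurableI)
        show "half_cyl s r x0 t0 \<in> sets lborel" unfolding box by (simp add: borel_open open_Times)
        show "emeasure lborel (half_cyl s r x0 t0) < \<infinity>" by (rule measure_half_cyl(2)[OF r(3)])
      qed
    qed (use U in \<open>auto simp: U_def\<close>)
    define \<kappa> where "\<kappa> = \<kappa>0 * r powr (- ?d - 2 * s)"
    have \<kappa>: "0 \<le> \<kappa>" "\<kappa> \<le> lam * r powr (- ?d - 2 * s) / 4"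
    proof -
      show "0 \<le> \<kappa>" using \<kappa>0 by (simp add: \<kappa>_def)
      have "\<kappa> \<le> lam / 4 * r powr (- ?d - 2 * s)"
        unfolding \<kappa>_def by (intro mult_right_mono \<kappa>0(2)) auto
      then show "\<kappa> \<le> lam * r powr (- ?d - 2 * s) / 4" by simp
    qed
    have \<kappa>P: "\<kappa> * P = m1"
    proof -
      have rd: "r powr (- ?d - 2 * s) * (r ^ CARD('n) * q) = 1"
        unfolding q_def using r by (simp add: powr_realpow[symmetric] powr_add[symmetric])
      have "\<kappa> * P = \<kappa>0 * V / 2 ^ CARD('n) / 2 * (r powr (- ?d - 2 * s) * (r ^ CARD('n) * q))"
        unfolding \<kappa>_def P_eq power_divide by simp
      then show ?thesis unfolding rd m1_def by simp
    qed
    have Cq: "0 \<le> C * r powr (- 2 * s)" using C by simp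
    have \<mu>: "P / 4 < measure lborel U" using mU P by linarith
    obtain g m where g: "\<And>p. 0 \<le> g p" "\<And>p. g p \<le> 1" "\<And>p. p \<notin> U \<Longrightarrow> g p = 0" "continuous_on UNIV g"
      and m: "m a = 0" "continuous_on {a..} m"
      and dm: "\<And>t. a < t \<Longrightarrow> (m has_real_derivative \<kappa> * (\<integral>x. g (x, t) \<partial>lebesgue) - C * r powr (- 2 * s) * m t) (at t)"
      and mb: "\<And>t. a \<le> t \<Longrightarrow> 0 \<le> m t \<and> m t \<le> \<kappa> * measure lborel U"
      and ml: "\<And>t. b \<le> t \<Longrightarrow> \<kappa> * exp (- (C * r powr (- 2 * s)) * (t - a)) * (P / 4) \<le> m t"
      using mass_profile[OF ab(1) U \<mu> \<kappa>(1) Cq] by (auto simp: mult.assoc)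
    have m_le: "m t \<le> 1/4" if "a \<le> t" for t
    proof -
      have "m t \<le> \<kappa> * P" using mb[OF that] mult_left_mono[OF UP \<kappa>(1)] by linarith
      then show ?thesis using \<kappa>P m1 by linarith
    qed
    have m_ge: "m0 \<le> m t" if t: "b \<le> t" "t \<le> t0" for t
    proof -
      have "(t - a) / q \<le> 1" using t q by (simp add: a_def)
      then have "C * ((t - a) / q) \<le> C * 1" using C by (intro mult_left_mono) auto
      then have "exp (- C) \<le> exp (- (C * r powr (- 2 * s)) * (t - a))"
        unfolding r2s by (simp add: field_simps)
      then have "\<kappa> * exp (- C) * (P / 4) \<le> \<kappa> * exp (- (C * r powr (- 2 * s)) * (t - a)) * (P / 4)"
        using \<kappa>(1) P by (intro mult_right_mono mult_left_mono) auto
      moreover have "\<kappa> * exp (- C) * (P / 4) = m0" unfolding m0_def \<kappa>P[symmetric] by simp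
      ultimately show ?thesis using ml[OF t(1)] by linarith
    qed
    define A' where "A' = \<eta> * h * (2 + \<tau>) * r powr (- 2 * s)"
    have A': "0 \<le> A'" using \<eta> h \<tau> by (simp add: A'_def)
    define W where "W p = u p + (h * m (snd p) * bump x0 (r/2) (fst p) - A' * (snd p - a))" for p
    let ?C = "cball x0 (r / 2) \<times> {a..t0}"
    have W_le: "W p \<le> M" if p: "p \<in> ?C" for p
    proof (rule ccontr)
      assume neg: "\<not> W p \<le> M"
      have fc: "continuous_on ?C (\<lambda>p. h * m (snd p) * bump x0 (r/2) (fst p) - A' * (snd p - a))"
        by (intro continuous_intros continuous_on_compose2[OF m(2)] continuous_on_compose2[OF bump_continuous]) auto
      have "?C \<subseteq> ball 0 R \<times> time_interval s R"
      proof
        fix q assume "q \<in> ?C"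
        then show "q \<in> ball 0 R \<times> time_interval s R"
          using dom_in[of "fst q" "snd q"] r by (cases q) (auto simp: dist_norm norm_minus_commute)
      qed
      then have "usc_on ?C W" unfolding W_def[abs_def]
        by (intro usc_on_add_continuous usc_on_subset[OF usc] fc)
      moreover have "compact ?C" by (intro compact_Times) auto
      ultimately obtain p1 where p1: "p1 \<in> ?C" "\<And>q. q \<in> ?C \<Longrightarrow> W q \<le> W p1"
        using usc_attains_max[of ?C W] p by blast
      obtain x1 t1 where pp: "p1 = (x1, t1)" by (cases p1)
      have x1: "norm (x1 - x0) \<le> r / 2" and t1: "a \<le> t1" "t1 \<le> t0"
        using p1(1) by (auto simp: pp dist_norm norm_minus_commute)
      define M' where "M' = W (x1, t1)"
      have MM': "M < M'" using neg p1(2)[OF p] by (simp add: M'_def pp)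
      have uM: "u (x1, t1) \<le> M" using in_M[of x1 t1] x1 t1 r by auto
      have x1': "norm (x1 - x0) < r / 2"
      proof (rule ccontr)
        assume "\<not> norm (x1 - x0) < r / 2"
        then have "bump x0 (r/2) x1 = 0" using r by (intro bump_eq_0) auto
        then have "W (x1, t1) \<le> u (x1, t1)" using mult_nonneg_nonneg[OF A', of "t1 - a"] t1 by (simp add: W_def)
        then show False using uM MM' by (simp add: M'_def)
      qed
      have t1': "a < t1"
      proof (rule ccontr)
        assume "\<not> a < t1"
        then have "t1 = a" using t1 by simp
        then have "W (x1, t1) \<le> u (x1, t1)" by (simp add: W_def m(1))
        then show False using uM MM' by (simp add: M'_def)
      qed
      have gs: "(\<lambda>x. g (x, t1)) \<in> borel_measurable borel"
        by (intro borel_measurable_continuous_onI continuous_on_compose2[OF g(4)] continuous_intros) auto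
      have "A' \<le> A + \<eta> * h * (tail_const Lam s * r powr (- 2 * s))"
      proof (rule touching_bound[OF s lam Lam vs ne r dom x1' t1' t1(2) _ dm[OF t1'] _ _ _ _ _ less_imp_le[OF MM'] h A' less_imp_le[OF \<eta>(1)] _ gs _ _ _ \<kappa>])
        show "m differentiable at t" if "a < t" for t
          using dm[OF that] real_differentiable_def by blast
        show "0 \<le> m t1" "m t1 \<le> 1/4" using mb[OF t1(1)] m_le[OF t1(1)] by auto
        show "B * norm (grad (bump x0 (r/2)) x1) - nonlocal_op s K (bump x0 (r/2)) x1
            \<le> C * r powr (- 2 * s) * bump x0 (r/2) x1" if "K \<in> kernels s lam Lam \<rho>" for K
          using that r x1 B by (intro barrier) auto
        show "u (x1, t1) = M' - h * m t1 * bump x0 (r/2) x1 + A' * (t1 - a)"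
          by (simp add: M'_def W_def)
        show "u (x, t) \<le> M' - h * m t * bump x0 (r/2) x + A' * (t - a)"
          if "norm (x - x0) < r" "a < t" "t \<le> t0" for x t
        proof (cases "norm (x - x0) \<le> r / 2")
          case True
          then have "W (x, t) \<le> M'"
            using p1(2)[of "(x, t)"] that by (simp add: M'_def pp dist_norm norm_minus_commute)
          then show ?thesis by (simp add: W_def)
        next
          case False
          then have "bump x0 (r/2) x = 0" using r by (intro bump_eq_0) auto
          then show ?thesis using in_M[of x t] that MM' mult_nonneg_nonneg[OF A', of "t - a"] by simp
        qed
        show "u (x, t1) \<le> M + \<eta> * h * (norm (x - x0) / r) powr s" if "r \<le> norm (x - x0)" for x
          by (rule tail[OF that t1])
        show "norm (x - x0) < r / 2 \<and> u (x, t1) < M - h / 2" if "g (x, t1) \<noteq> 0" for x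
        proof -
          have "(x, t1) \<in> U" using g(3) that by blast
          then show ?thesis by (auto simp: U_def box dist_norm norm_minus_commute)
        qed
      qed (use g in auto)
      moreover have "A \<le> \<eta> * h * r powr (- 2 * s)"
        using A q unfolding r2s by (simp add: field_simps)
      moreover have "0 < \<eta> * h * r powr (- 2 * s)" using \<eta> h r by simp
      moreover have "A' = 2 * (\<eta> * h * r powr (- 2 * s)) + \<eta> * h * (tail_const Lam s * r powr (- 2 * s))"
        unfolding A'_def \<tau>_def by (simp add: distrib_left distrib_right)
      ultimately show False by linarith
    qed
    have "(x, t) \<in> ?C" using xt ab r by (auto simp: dist_norm norm_minus_commute)
    from W_le[OF this] have "u (x, t) \<le> M - h * m t * bump x0 (r/2) x + A' * (t - a)"
      by (simp add: W_def)
    moreover have "h * m0 * (1/2) \<le> h * m t * bump x0 (r/2) x"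
    proof (intro mult_mono)
      show "m0 \<le> m t" by (rule m_ge[OF xt(2,3)])
      show "1/2 \<le> bump x0 (r/2) x" using xt r by (intro bump_ge_half) auto
      show "0 \<le> h * m t" using h mb[of t] xt ab by simp
    qed (use h m0(1) in auto)
    moreover have "A' * (t - a) \<le> h * m0 / 4"
    proof -
      have "A' * (t - a) \<le> A' * q" using A' xt by (intro mult_left_mono) (auto simp: a_def)
      also have "\<dots> = h * (\<eta> * (2 + \<tau>))" unfolding A'_def r2s using q by simp
      also have "\<dots> = h * m0 / 4" unfolding \<eta>(2) by simp
      finally show ?thesis .
    qed
    ultimately show ?case by (simp add: mult.commute)
  qed
qed

section \<open>Reflection of supersolutions\<close>

lemma nonlocal_op_uminus:
  assumes "GDERIV w x :> g"
  shows "nonlocal_op s K (\<lambda>x. - w x) x = - nonlocal_op s K w x"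
proof -
  have g: "grad w x = g" "grad (\<lambda>x. - w x) x = - g"
    using assms by (auto intro!: grad_eqI GDERIV_minus)
  have "delta s (\<lambda>x. - w x) x y * K y = - (delta s w x y * K y)" for y
    unfolding delta_cutoff g by (simp add: algebra_simps)
  then show ?thesis unfolding nonlocal_op_def by simp
qed

lemma M_minus_uminus:
  assumes "GDERIV w x :> g"
  shows "M_minus s lam Lam \<rho> (\<lambda>x. - w x) x = - M_plus s lam Lam \<rho> w x"
  unfolding M_minus_def M_plus_def nonlocal_op_uminus[OF assms] Inf_real_def
  by (simp add: image_image)

text \<open>Reflection exchanges the two extremal operators, so that lower bounds for \<open>u\<close> follow from upper bounds
for \<open>- u\<close>.\<close>

lemma visc_super_imp_sub_uminus:
  fixes u :: "(real^'n) \<times> real \<Rightarrow> real"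
  assumes "visc_super \<Omega> I (\<lambda>w x. M_minus s lam Lam \<rho> w x - B * norm (grad w x)) (\<lambda>_. - A) u"
  shows "visc_sub \<Omega> I (\<lambda>w x. M_plus s lam Lam \<rho> w x + B * norm (grad w x)) (\<lambda>_. A) (\<lambda>q. - u q)"
proof -
  have bb: "u \<in> bounded_borel (UNIV \<times> I)" and lsc: "lsc_on (\<Omega> \<times> I) u"
    and super: "\<forall>p \<in> \<Omega> \<times> I. \<forall>\<epsilon>>0. \<forall>\<phi>.
        back_cyl \<epsilon> p \<subseteq> \<Omega> \<times> I \<and> test_fun \<epsilon> p \<phi> \<and> u p = \<phi> p \<and> (\<forall>q \<in> back_cyl \<epsilon> p. u q \<ge> \<phi> q) \<longrightarrow>
        (let v = (\<lambda>q. if q \<in> back_cyl \<epsilon> p then \<phi> q else u q)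
         in left_dt v p - (M_minus s lam Lam \<rho> (\<lambda>x. v (x, snd p)) (fst p)
              - B * norm (grad (\<lambda>x. v (x, snd p)) (fst p))) \<ge> - A)"
    using assms unfolding visc_super_def by - (elim conjE, assumption)+
  have bb': "(\<lambda>q. - u q) \<in> bounded_borel (UNIV \<times> I)"
    using bb unfolding bounded_borel_def bounded_iff by (auto intro: borel_measurable_uminus)
  have usc: "usc_on (\<Omega> \<times> I) (\<lambda>q. - u q)"
    unfolding usc_on_def
  proof (intro ballI allI impI)
    fix p a assume p: "p \<in> \<Omega> \<times> I" and a: "- u p < a"
    have "\<forall>\<^sub>F q in at p within \<Omega> \<times> I. - a < u q"
      using lsc p a unfolding lsc_on_def by (auto simp: minus_less_iff)
    then show "\<forall>\<^sub>F q in at p within \<Omega> \<times> I. - u q < a" by eventually_elim simp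
  qed
  show ?thesis unfolding visc_sub_def
  proof (intro conjI bb' usc ballI allI impI, goal_cases)
    case (1 p \<epsilon> \<phi>)
    obtain x1 t1 where p: "p = (x1, t1)" by (cases p)
    define v where "v q = (if q \<in> back_cyl \<epsilon> p then \<phi> q else - u q)" for q
    define v' where "v' q = (if q \<in> back_cyl \<epsilon> p then - \<phi> q else u q)" for q
    have vv: "v' q = - v q" for q by (simp add: v_def v'_def)
    have e: "0 < \<epsilon>" and test: "test_fun \<epsilon> p \<phi>" using 1 by auto
    have tmem: "t1 \<in> {snd p - \<epsilon> <.. snd p}" using e by (simp add: p)
    have cyl: "(x1, \<tau>) \<in> back_cyl \<epsilon> p" if "t1 - \<epsilon> < \<tau>" "\<tau> \<le> t1" for \<tau>
      using that e by (simp add: back_cyl_def p)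
    have "(\<lambda>\<tau>. \<phi> (x1, \<tau>)) differentiable (at_left t1)"
      using test cyl[of t1] e unfolding test_fun_def by auto
    then obtain D where D: "((\<lambda>\<tau>. \<phi> (x1, \<tau>)) has_real_derivative D) (at_left t1)"
      using real_differentiable_def by blast
    have dt: "left_dt v (x1, t1) = D"
      by (rule left_dt_eqI[OF D e]) (use cyl in \<open>simp add: v_def\<close>)
    have dt': "left_dt v' (x1, t1) = - D"
      by (rule left_dt_eqI[OF DERIV_minus[OF D] e]) (use cyl in \<open>simp add: v'_def\<close>)
    have C11: "C11_on (ball x1 \<epsilon>) (\<lambda>x. \<phi> (x, t))" if "t \<in> {snd p - \<epsilon> <.. snd p}" for t
      using test that unfolding test_fun_def by (simp add: p)
    obtain g where g: "GDERIV (\<lambda>x. \<phi> (x, t1)) x1 :> g"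
      using C11[OF tmem] e unfolding C11_on_def by force
    have gv: "GDERIV (\<lambda>x. v (x, t1)) x1 :> g"
      using g unfolding gderiv_def
      by (rule has_derivative_transform_within_open[of _ _ _ _ "ball x1 \<epsilon>"])
        (use e in \<open>auto simp: v_def back_cyl_def p\<close>)
    have test': "test_fun \<epsilon> p (\<lambda>q. - \<phi> q)"
      unfolding test_fun_def
    proof (intro conjI ballI)
      fix q assume "q \<in> back_cyl \<epsilon> p"
      then show "case q of (x, t) \<Rightarrow> (\<lambda>\<tau>. - \<phi> (x, \<tau>)) differentiable (at_left t)"
        using test unfolding test_fun_def by (auto intro: differentiable_minus)
    next
      fix t assume "t \<in> {snd p - \<epsilon> <.. snd p}"
      from C11[OF this] obtain g L where g: "\<And>x. x \<in> ball x1 \<epsilon> \<Longrightarrow> GDERIV (\<lambda>x. \<phi> (x, t)) x :> g x"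
        "L-lipschitz_on (ball x1 \<epsilon>) g" unfolding C11_on_def by blast
      have g': "GDERIV (\<lambda>x. - \<phi> (x, t)) x :> - g x" if "x \<in> ball x1 \<epsilon>" for x
        using GDERIV_minus[OF g(1)[OF that]] .
      have L': "L-lipschitz_on (ball x1 \<epsilon>) (\<lambda>x. - g x)"
        using g(2) by (simp add: lipschitz_on_def dist_minus)
      show "C11_on (ball (fst p) \<epsilon>) (\<lambda>x. - \<phi> (x, t))"
        unfolding C11_on_def p fst_conv
        by (rule exI[of _ "\<lambda>x. - g x"], rule exI[of _ L]) (use g' L' in auto)
    qed
    have "- A \<le> left_dt v' p - (M_minus s lam Lam \<rho> (\<lambda>x. v' (x, snd p)) (fst p)
              - B * norm (grad (\<lambda>x. v' (x, snd p)) (fst p)))"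
    proof -
      have c: "back_cyl \<epsilon> p \<subseteq> \<Omega> \<times> I \<and> test_fun \<epsilon> p (\<lambda>q. - \<phi> q) \<and> u p = - \<phi> p \<and> (\<forall>q \<in> back_cyl \<epsilon> p. u q \<ge> - \<phi> q)"
        using 1 test' by (auto simp: neg_le_iff_le minus_le_iff)
      from super[rule_format, OF 1(1,2), of "\<lambda>q. - \<phi> q"] c show ?thesis
        unfolding Let_def v'_def[abs_def, symmetric] by blast
    qed
    moreover have "M_minus s lam Lam \<rho> (\<lambda>x. v' (x, snd p)) (fst p) = - M_plus s lam Lam \<rho> (\<lambda>x. v (x, snd p)) (fst p)"
      unfolding vv p fst_conv snd_conv by (rule M_minus_uminus[OF gv])
    moreover have "grad (\<lambda>x. v' (x, snd p)) (fst p) = - grad (\<lambda>x. v (x, snd p)) (fst p)"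
      unfolding vv p fst_conv snd_conv using grad_eqI[OF gv] grad_eqI[OF GDERIV_minus[OF gv]] by simp
    ultimately have "left_dt v p - (M_plus s lam Lam \<rho> (\<lambda>x. v (x, snd p)) (fst p)
              + B * norm (grad (\<lambda>x. v (x, snd p)) (fst p))) \<le> A"
      using dt dt' by (simp add: p)
    then show ?case unfolding Let_def v_def[abs_def] .
  qed
qed

section \<open>Iteration over scales\<close>

text \<open>The invariant of the iteration: \<open>u\<close> ranges in \<open>{lo..lo + \<omega>}\<close> on the cylinder of radius \<open>r\<close>, and it leaves
this interval at most at the rate \<open>\<alpha>\<close> outside. The factor \<open>1 / \<sigma>\<close> in the growth is what the passage from one
scale to the next loses; with it the growth condition reproduces itself exactly.\<close>

definition osc_inv ::
  "real \<Rightarrow> real \<Rightarrow> real \<Rightarrow> ((real^'n) \<times> real \<Rightarrow> real) \<Rightarrow> real^'n \<Rightarrow> real \<Rightarrow> real \<Rightarrow> real \<Rightarrow> real \<Rightarrow> bool" where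
  "osc_inv s \<sigma> \<alpha> u x0 t0 r lo \<omega> \<longleftrightarrow> (\<forall>x t. t0 - r powr (2 * s) \<le> t \<and> t \<le> t0 \<longrightarrow>
     (norm (x - x0) < r \<longrightarrow> lo \<le> u (x, t) \<and> u (x, t) \<le> lo + \<omega>) \<and>
     (r \<le> norm (x - x0) \<longrightarrow>
        lo + \<omega> - \<omega> * (norm (x - x0) / (\<sigma> * r)) powr \<alpha> \<le> u (x, t) \<and>
        u (x, t) \<le> lo + \<omega> * (norm (x - x0) / (\<sigma> * r)) powr \<alpha>))"

lemma osc_inv_uminus:
  "osc_inv s \<sigma> \<alpha> (\<lambda>q. - u q) x0 t0 r (- (lo + \<omega>)) \<omega> \<longleftrightarrow> osc_inv s \<sigma> \<alpha> u x0 t0 r lo \<omega>"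
  unfolding osc_inv_def by (auto simp: algebra_simps)

text \<open>The growth outside is the same function at both scales, since \<open>\<omega> * (n / (\<sigma> * r))^\<alpha>\<close> is unchanged when \<open>r\<close>
and \<open>\<omega>\<close> are replaced by \<open>\<sigma> * r\<close> and \<open>\<sigma>^\<alpha> * \<omega>\<close>. Only the points between the two cylinders have to be looked
at, and there the old oscillation bound suffices.\<close>

lemma osc_inv_shrink:
  assumes inv: "osc_inv s \<sigma> \<alpha> u x0 t0 r lo \<omega>"
    and \<sigma>: "0 < \<sigma>" "\<sigma> \<le> 1" and s: "0 < s" and \<alpha>: "0 \<le> \<alpha>" and r: "0 < r" and \<omega>: "0 \<le> \<omega>"
    and up: "\<And>x t. norm (x - x0) < \<sigma> * r \<Longrightarrow> t0 - (\<sigma> * r) powr (2 * s) \<le> t \<Longrightarrow> t \<le> t0 \<Longrightarrow>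
       u (x, t) \<le> lo + \<sigma> powr \<alpha> * \<omega>"
  shows "osc_inv s \<sigma> \<alpha> u x0 t0 (\<sigma> * r) lo (\<sigma> powr \<alpha> * \<omega>)"
  unfolding osc_inv_def
proof (intro allI impI)
  fix x t assume t: "t0 - (\<sigma> * r) powr (2 * s) \<le> t \<and> t \<le> t0"
  let ?n = "norm (x - x0)"
  have sr: "\<sigma> * r \<le> r" using \<sigma> r by simp
  have "(\<sigma> * r) powr (2 * s) \<le> r powr (2 * s)" using sr \<sigma> r s by (intro powr_mono2) auto
  then have t': "t0 - r powr (2 * s) \<le> t" "t \<le> t0" using t by auto
  have s1: "\<sigma> powr \<alpha> \<le> 1" using \<sigma> \<alpha> by (intro powr_le1) auto
  then have \<omega>1: "\<sigma> powr \<alpha> * \<omega> \<le> \<omega>" using \<omega> by (intro mult_left_le_one_le) auto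
  have scale: "\<sigma> powr \<alpha> * (?n / (\<sigma> * (\<sigma> * r))) powr \<alpha> = (?n / (\<sigma> * r)) powr \<alpha>"
  proof -
    have "\<sigma> powr \<alpha> * (?n / (\<sigma> * (\<sigma> * r))) powr \<alpha> = (\<sigma> * (?n / (\<sigma> * (\<sigma> * r)))) powr \<alpha>"
      by (simp only: powr_mult)
    also have "\<sigma> * (?n / (\<sigma> * (\<sigma> * r))) = ?n / (\<sigma> * r)" using \<sigma> by simp
    finally show ?thesis .
  qed
  have scale': "\<sigma> powr \<alpha> * \<omega> * (?n / (\<sigma> * (\<sigma> * r))) powr \<alpha> = \<omega> * (?n / (\<sigma> * r)) powr \<alpha>"
    unfolding scale[symmetric] by (simp only: mult_ac)
  show "(?n < \<sigma> * r \<longrightarrow> lo \<le> u (x, t) \<and> u (x, t) \<le> lo + \<sigma> powr \<alpha> * \<omega>) \<and>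
     (\<sigma> * r \<le> ?n \<longrightarrow>
        lo + \<sigma> powr \<alpha> * \<omega> - \<sigma> powr \<alpha> * \<omega> * (?n / (\<sigma> * (\<sigma> * r))) powr \<alpha> \<le> u (x, t) \<and>
        u (x, t) \<le> lo + \<sigma> powr \<alpha> * \<omega> * (?n / (\<sigma> * (\<sigma> * r))) powr \<alpha>)"
  proof (intro conjI[of "_ \<longrightarrow> _"] impI)
    assume n: "?n < \<sigma> * r"
    then have "lo \<le> u (x, t)" using inv t' sr unfolding osc_inv_def by auto
    then show "lo \<le> u (x, t) \<and> u (x, t) \<le> lo + \<sigma> powr \<alpha> * \<omega>" using up[OF n] t by auto
  next
    assume n: "\<sigma> * r \<le> ?n"
    show "lo + \<sigma> powr \<alpha> * \<omega> - \<sigma> powr \<alpha> * \<omega> * (?n / (\<sigma> * (\<sigma> * r))) powr \<alpha> \<le> u (x, t) \<and>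
        u (x, t) \<le> lo + \<sigma> powr \<alpha> * \<omega> * (?n / (\<sigma> * (\<sigma> * r))) powr \<alpha>"
    proof (cases "?n < r")
      case True
      then have b: "lo \<le> u (x, t)" "u (x, t) \<le> lo + \<omega>" using inv t' unfolding osc_inv_def by auto
      have "1 \<le> ?n / (\<sigma> * r)" using n \<sigma> r by simp
      then have "1 \<le> (?n / (\<sigma> * r)) powr \<alpha>" using \<alpha> by (rule ge_one_powr_ge_zero)
      then have "\<omega> * 1 \<le> \<omega> * (?n / (\<sigma> * r)) powr \<alpha>" using \<omega> by (intro mult_left_mono)
      then show ?thesis unfolding scale' using b \<omega>1 by linarith
    next
      case False
      then have "lo + \<omega> - \<omega> * (?n / (\<sigma> * r)) powr \<alpha> \<le> u (x, t)" "u (x, t) \<le> lo + \<omega> * (?n / (\<sigma> * r)) powr \<alpha>"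
        using inv t' unfolding osc_inv_def by auto
      then show ?thesis unfolding scale' using \<omega>1 by linarith
    qed
  qed
qed

text \<open>The excess of \<open>z^\<alpha>\<close> over \<open>1\<close> is small with \<open>\<alpha>\<close>, uniformly in \<open>z\<close> if measured against a fixed larger power.
This is how a small exponent makes the tail negligible.\<close>

lemma powr_minus_one_le:
  fixes z :: real
  assumes z: "1 \<le> z" and \<alpha>: "0 < \<alpha>" "\<alpha> \<le> s / 2"
  shows "z powr \<alpha> - 1 \<le> 2 * \<alpha> / s * z powr s"
proof -
  define L where "L = ln z"
  have L: "0 \<le> L" using z by (simp add: L_def)
  have pw: "z powr a = exp (a * L)" for a using z by (simp add: powr_def L_def)
  have s: "0 < s" using \<alpha> by linarith
  have 1: "exp (\<alpha> * L) - 1 \<le> \<alpha> * L * exp (\<alpha> * L)"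
  proof -
    have "1 - \<alpha> * L \<le> exp (- (\<alpha> * L))" using exp_ge_add_one_self[of "- (\<alpha> * L)"] by simp
    then have "(1 - \<alpha> * L) * exp (\<alpha> * L) \<le> exp (- (\<alpha> * L)) * exp (\<alpha> * L)" by (intro mult_right_mono) auto
    also have "\<dots> = 1" by (simp add: exp_add[symmetric])
    finally show ?thesis by (simp add: algebra_simps)
  qed
  have 2: "s / 2 * L \<le> exp (s / 2 * L)" using exp_ge_add_one_self[of "s / 2 * L"] by linarith
  have 3: "exp (\<alpha> * L) \<le> exp (s / 2 * L)" using mult_right_mono[OF \<alpha>(2) L] by simp
  have "(s / 2 * L) * exp (\<alpha> * L) \<le> exp (s / 2 * L) * exp (s / 2 * L)"
    using 2 3 by (intro mult_mono) auto
  also have "\<dots> = exp (s * L)" by (simp add: exp_add[symmetric])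
  finally have "2 * \<alpha> / s * ((s / 2 * L) * exp (\<alpha> * L)) \<le> 2 * \<alpha> / s * exp (s * L)"
    using \<alpha> s by (intro mult_left_mono) auto
  then show ?thesis unfolding pw using 1 s by simp
qed

text \<open>The exponent \<open>\<alpha>\<close> is chosen last: small enough for the tail to be admissible in
\<open>diminish_of_oscillation\<close>, and so small that \<open>\<sigma>^\<alpha> \<ge> 1 - \<theta> / 2\<close>, the factor by which the oscillation drops.
The sets where \<open>u < lo + 3 / 4 * \<omega>\<close> and where \<open>u > lo + \<omega> / 4\<close> cover \<open>half_cyl\<close>, so one of them has at least
half of its measure; in the second case the argument is applied to \<open>- u\<close>.\<close>

lemma oscillation_step:
  fixes s lam Lam B1 :: real
  assumes s: "0 < s" "s < 1" and lam: "0 < lam" and Lam: "0 < Lam" and B1: "0 \<le> B1"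
  shows "\<exists>\<eta> \<sigma> \<alpha>. 0 < \<eta> \<and> 0 < \<sigma> \<and> \<sigma> < 1 \<and> 0 < \<alpha> \<and> \<alpha> < 2 * s \<and>
    (\<forall>\<rho> A B R r (x0 :: real^'n) t0 u lo \<omega>.
      drift_sub s lam Lam \<rho> B A R u \<and>
      drift_super s lam Lam \<rho> B A R u \<and>
      admissible_scale s lam Lam \<rho> B B1 R r x0 t0 \<and>
      0 < \<omega> \<and> A * r powr (2 * s) \<le> \<eta> * (\<omega> / 2) \<and> osc_inv s \<sigma> \<alpha> u x0 t0 r lo \<omega>
      \<longrightarrow> (\<exists>lo'. osc_inv s \<sigma> \<alpha> u x0 t0 (\<sigma> * r) lo' (\<sigma> powr \<alpha> * \<omega>)))"
proof -
  from diminish_of_oscillation[OF s lam Lam B1, where 'n='n]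
  obtain \<eta> \<theta> where \<eta>: "0 < \<eta>" and \<theta>: "0 < \<theta>" "\<theta> \<le> 1"
    and dim: "\<forall>\<rho> A B R r (x0 :: real^'n) t0 u M h.
    drift_sub s lam Lam \<rho> B A R u \<and>
    admissible_scale s lam Lam \<rho> B B1 R r x0 t0 \<and>
    0 < h \<and> A * r powr (2 * s) \<le> \<eta> * h \<and>
    (\<forall>x t. norm (x - x0) < r \<and> t0 - r powr (2 * s) \<le> t \<and> t \<le> t0 \<longrightarrow> u (x, t) \<le> M) \<and>
    (\<forall>x t. r \<le> norm (x - x0) \<and> t0 - r powr (2 * s) \<le> t \<and> t \<le> t0 \<longrightarrow>
       u (x, t) \<le> M + \<eta> * h * (norm (x - x0) / r) powr s) \<and>
    measure lborel (half_cyl s r x0 t0) / 2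
      \<le> measure lborel {q \<in> half_cyl s r x0 t0. u q < M - h / 2}
    \<longrightarrow> (\<forall>x t. norm (x - x0) \<le> r / 4 \<and> t0 - r powr (2 * s) / 2 \<le> t \<and> t \<le> t0 \<longrightarrow>
       u (x, t) \<le> M - \<theta> * h)"
    by (elim exE conjE) (rule that; assumption)
  \<comment> \<open>The second bound gives \<open>(\<sigma> * r)^(2 * s) \<le> r^(2 * s) / 2\<close>: the next cylinder lies in the later half of the present one.\<close>
  define \<sigma> :: real where "\<sigma> = min (1/4) (2 powr (- 1 / (2 * s)))"
  have \<sigma>: "0 < \<sigma>" "\<sigma> \<le> 1/4" "\<sigma> \<le> 2 powr (- 1 / (2 * s))" by (auto simp: \<sigma>_def)
  have \<sigma>2s: "\<sigma> powr (2 * s) \<le> 1/2"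
  proof -
    have "\<sigma> powr (2 * s) \<le> (2 powr (- 1 / (2 * s))) powr (2 * s)"
      using \<sigma> s by (intro powr_mono2) auto
    also have "\<dots> = 2 powr (- 1)" unfolding powr_powr using s by simp
    also have "\<dots> = 1/2" by (simp add: powr_minus)
    finally show ?thesis .
  qed
  define \<Lambda> where "\<Lambda> = - ln \<sigma>"
  have \<Lambda>: "0 < \<Lambda>" using \<sigma> by (simp add: \<Lambda>_def)
  \<comment> \<open>The three bounds serve \<open>powr_minus_one_le\<close>, the tail and the decay factor, in this order.\<close>
  define \<alpha> where "\<alpha> = Min {s / 2, \<eta> * \<sigma> powr s * s / 4, \<theta> / 2 / \<Lambda>}"
  have \<alpha>0: "0 < \<alpha>" using s \<eta> \<sigma> \<theta> \<Lambda> by (auto simp: \<alpha>_def)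
  have le: "\<alpha> \<le> z" if "z \<in> {s / 2, \<eta> * \<sigma> powr s * s / 4, \<theta> / 2 / \<Lambda>}" for z
    unfolding \<alpha>_def using that by (intro Min_le) auto
  have \<alpha>: "\<alpha> \<le> s / 2" "\<alpha> \<le> \<eta> * \<sigma> powr s * s / 4" "\<alpha> \<le> \<theta> / 2 / \<Lambda>"
    by (rule le, simp)+
  have \<sigma>\<alpha>: "1 - \<theta> / 2 \<le> \<sigma> powr \<alpha>"
  proof -
    have "\<alpha> * \<Lambda> \<le> \<theta> / 2" using \<alpha>(3) \<Lambda> by (simp add: field_simps)
    then have "1 - \<theta> / 2 \<le> 1 + (- (\<alpha> * \<Lambda>))" by simp
    also have "\<dots> \<le> exp (- (\<alpha> * \<Lambda>))" by (rule exp_ge_add_one_self)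
    also have "\<dots> = \<sigma> powr \<alpha>" using \<sigma> by (simp add: powr_def \<Lambda>_def)
    finally show ?thesis .
  qed
  have one_sided: "osc_inv s \<sigma> \<alpha> u x0 t0 (\<sigma> * r) lo (\<sigma> powr \<alpha> * \<omega>)"
    if vs: "drift_sub s lam Lam \<rho> B A R u"
      and hyp: "(kernels s lam Lam \<rho> :: (real^'n \<Rightarrow> real) set) \<noteq> {}" "0 \<le> \<rho>" "\<rho> \<le> r" "0 < r"
      "0 \<le> B" "B * r powr (2 * s - 1) \<le> B1"
      "norm x0 + r \<le> R" "- (R powr (2 * s)) < t0 - r powr (2 * s)" "t0 \<le> 0"
      "0 < \<omega>" "A * r powr (2 * s) \<le> \<eta> * (\<omega> / 2)"
      and inv: "osc_inv s \<sigma> \<alpha> u x0 t0 r lo \<omega>"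
      and half: "measure lborel (half_cyl s r x0 t0) / 2
      \<le> measure lborel {q \<in> half_cyl s r x0 t0. u q < lo + \<omega> - \<omega> / 2 / 2}"
    for \<rho> A B R r and x0 :: "real^'n" and t0 u lo \<omega>
  proof -
    have r: "0 < r" and \<omega>: "0 < \<omega>" using hyp by auto
    have in_M: "u (x, t) \<le> lo + \<omega>" if "norm (x - x0) < r" "t0 - r powr (2 * s) \<le> t" "t \<le> t0" for x t
      using inv that unfolding osc_inv_def by auto
    have tail: "u (x, t) \<le> lo + \<omega> + \<eta> * (\<omega> / 2) * (norm (x - x0) / r) powr s"
      if n: "r \<le> norm (x - x0)" and t: "t0 - r powr (2 * s) \<le> t" "t \<le> t0" for x t
    proof -
      define z where "z = norm (x - x0) / (\<sigma> * r)"
      have "\<sigma> * r \<le> 1 * r" using \<sigma> r by (intro mult_right_mono) auto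
      then have "\<sigma> * r \<le> norm (x - x0)" using n by linarith
      then have "1 \<le> z" using \<sigma> r by (simp add: z_def)
      have zs: "z powr s = (norm (x - x0) / r) powr s / \<sigma> powr s"
      proof -
        have z: "z = norm (x - x0) / r / \<sigma>" by (simp add: z_def)
        show ?thesis unfolding z by (rule powr_divide)
      qed
      have "z powr \<alpha> - 1 \<le> 2 * \<alpha> / s * z powr s"
        by (rule powr_minus_one_le[OF \<open>1 \<le> z\<close> \<alpha>0 \<alpha>(1)])
      also have "\<dots> \<le> (\<eta> * \<sigma> powr s / 2) * z powr s"
      proof (rule mult_right_mono)
        show "2 * \<alpha> / s \<le> \<eta> * \<sigma> powr s / 2" using \<alpha>(2) s by (simp add: field_simps)
      qed auto
      also have "\<dots> = \<eta> / 2 * (norm (x - x0) / r) powr s"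
        unfolding zs using \<sigma> by simp
      finally have "\<omega> * (z powr \<alpha> - 1) \<le> \<omega> * (\<eta> / 2 * (norm (x - x0) / r) powr s)"
        using \<omega> by (intro mult_left_mono) auto
      moreover have "u (x, t) \<le> lo + \<omega> * z powr \<alpha>"
        using inv n t unfolding osc_inv_def z_def by auto
      ultimately show ?thesis by (simp add: algebra_simps)
    qed
    have h2: "0 < \<omega> / 2" using \<omega> by simp
    have in_M': "\<forall>x t. norm (x - x0) < r \<and> t0 - r powr (2 * s) \<le> t \<and> t \<le> t0 \<longrightarrow> u (x, t) \<le> lo + \<omega>"
      using in_M by blast
    have tail': "\<forall>x t. r \<le> norm (x - x0) \<and> t0 - r powr (2 * s) \<le> t \<and> t \<le> t0 \<longrightarrow>
       u (x, t) \<le> lo + \<omega> + \<eta> * (\<omega> / 2) * (norm (x - x0) / r) powr s"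
      using tail by blast
    have concl: "u (x, t) \<le> lo + \<omega> - \<theta> * (\<omega> / 2)"
      if xt: "norm (x - x0) \<le> r / 4" "t0 - r powr (2 * s) / 2 \<le> t" "t \<le> t0" for x t
    proof -
      note d = dim[THEN spec[of _ \<rho>], THEN spec[of _ A], THEN spec[of _ B], THEN spec[of _ R],
          THEN spec[of _ r], THEN spec[of _ x0], THEN spec[of _ t0], THEN spec[of _ u],
          THEN spec[of _ "lo + \<omega>"], THEN spec[of _ "\<omega> / 2"], THEN mp, THEN spec[of _ x], THEN spec[of _ t], THEN mp]
      show ?thesis by (rule d) (intro conjI vs hyp(1-9) h2 hyp(11) in_M' tail' half xt)+
    qed
    show ?thesis
    proof (rule osc_inv_shrink[OF inv])
      fix x t assume xt: "norm (x - x0) < \<sigma> * r" "t0 - (\<sigma> * r) powr (2 * s) \<le> t" "t \<le> t0"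
      have "\<sigma> * r \<le> 1 / 4 * r" using \<sigma> r by (intro mult_right_mono) auto
      moreover have "(\<sigma> * r) powr (2 * s) \<le> 1 / 2 * r powr (2 * s)"
        unfolding powr_mult using \<sigma>2s by (intro mult_right_mono) auto
      ultimately have "u (x, t) \<le> lo + \<omega> - \<theta> * (\<omega> / 2)" using concl xt by auto
      also have "\<dots> = lo + (1 - \<theta> / 2) * \<omega>" by (simp add: algebra_simps)
      also have "\<dots> \<le> lo + \<sigma> powr \<alpha> * \<omega>" using \<sigma>\<alpha> \<omega> by (intro add_left_mono mult_right_mono) auto
      finally show "u (x, t) \<le> lo + \<sigma> powr \<alpha> * \<omega>" .
    qed (use \<sigma> s \<alpha>0 r \<omega> in auto)
  qed
  show ?thesis
  proof (rule exI[of _ \<eta>], rule exI[of _ \<sigma>], rule exI[of _ \<alpha>], intro conjI allI impI, goal_cases)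
    case (6 \<rho> A B R r x0 t0 u lo \<omega>)
    then have vs: "drift_sub s lam Lam \<rho> B A R u"
      and vu: "drift_super s lam Lam \<rho> B A R u"
      and hyp: "(kernels s lam Lam \<rho> :: (real^'n \<Rightarrow> real) set) \<noteq> {}" "0 \<le> \<rho>" "\<rho> \<le> r" "0 < r"
      "0 \<le> B" "B * r powr (2 * s - 1) \<le> B1"
      "norm x0 + r \<le> R" "- (R powr (2 * s)) < t0 - r powr (2 * s)" "t0 \<le> 0"
      "0 < \<omega>" "A * r powr (2 * s) \<le> \<eta> * (\<omega> / 2)"
      and inv: "osc_inv s \<sigma> \<alpha> u x0 t0 r lo \<omega>"
      by - (elim conjE, assumption)+
    note vs' = visc_super_imp_sub_uminus[OF vu]
    have inv': "osc_inv s \<sigma> \<alpha> (\<lambda>q. - u q) x0 t0 r (- (lo + \<omega>)) \<omega>"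
      unfolding osc_inv_uminus by (rule inv)
    define H where "H = half_cyl s r x0 t0"
    define U1 where "U1 = {q \<in> H. u q < lo + \<omega> - \<omega> / 2 / 2}"
    define U2 where "U2 = {q \<in> H. - u q < - (lo + \<omega>) + \<omega> - \<omega> / 2 / 2}"
    have Hopen: "open H" unfolding H_def half_cyl_def by (intro open_Times) auto
    have Hsub: "H \<subseteq> ball 0 R \<times> time_interval s R"
    proof
      fix q assume q: "q \<in> H"
      obtain x t where xt: "q = (x, t)" by (cases q)
      have "norm (x - x0) < r / 2" "t0 - r powr (2 * s) < t" "t < t0 - r powr (2 * s) / 2"
        using q by (auto simp: H_def half_cyl_def xt dist_norm norm_minus_commute)
      moreover have "0 < r powr (2 * s)" using hyp by simp
      ultimately show "q \<in> ball 0 R \<times> time_interval s R"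
        using norm_triangle_ineq[of "x - x0" x0] hyp by (auto simp: xt time_interval_def)
    qed
    have o1: "open U1" unfolding U1_def
      by (rule usc_on_open_sublevel[OF _ Hopen Hsub]) (use vs in \<open>simp add: visc_sub_def\<close>)
    have o2: "open U2" unfolding U2_def
      by (rule usc_on_open_sublevel[OF _ Hopen Hsub]) (use vs' in \<open>simp add: visc_sub_def\<close>)
    have "H = U1 \<union> U2"
    proof -
      have "u q < lo + \<omega> - \<omega> / 2 / 2 \<or> - u q < - (lo + \<omega>) + \<omega> - \<omega> / 2 / 2" for q
        using hyp by linarith
      then show ?thesis unfolding U1_def U2_def by blast
    qed
    then have "measure lborel H \<le> measure lborel U1 + measure lborel U2"
      using measure_Un_le[of U1 lborel U2] o1 o2 by simp
    then consider "measure lborel H / 2 \<le> measure lborel U1" | "measure lborel H / 2 \<le> measure lborel U2"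
      by linarith
    then show ?case
    proof cases
      case 1
      then show ?thesis using one_sided[OF vs hyp inv] unfolding U1_def H_def by blast
    next
      case 2
      then have "osc_inv s \<sigma> \<alpha> (\<lambda>q. - u q) x0 t0 (\<sigma> * r) (- (lo + \<omega>)) (\<sigma> powr \<alpha> * \<omega>)"
        using one_sided[OF vs' hyp inv'] unfolding U2_def H_def by blast
      then have "osc_inv s \<sigma> \<alpha> u x0 t0 (\<sigma> * r) (lo + \<omega> - \<sigma> powr \<alpha> * \<omega>) (\<sigma> powr \<alpha> * \<omega>)"
        using osc_inv_uminus[of s \<sigma> \<alpha> u x0 t0 "\<sigma> * r" "lo + \<omega> - \<sigma> powr \<alpha> * \<omega>" "\<sigma> powr \<alpha> * \<omega>"] by simp
      then show ?thesis by blast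
    qed
  qed (use \<eta> \<sigma> \<alpha> \<alpha>0 s in auto)
qed

section \<open>The Hoelder estimate\<close>

text \<open>Cylinders of radius \<open>c * R\<close> whose top centre lies in \<open>par_cyl s (R / 4)\<close> stay inside \<open>par_cyl s R\<close>. For small
\<open>s\<close> the time intervals force \<open>c\<close> to be small.\<close>

lemma inner_radius_factor:
  fixes s :: real
  assumes s: "0 < s"
  shows "\<exists>c>0. c \<le> 1/2 \<and> (1/4) powr (2 * s) + c powr (2 * s) \<le> 1"
proof -
  have q: "0 < 1 - (1/4) powr (2 * s)" using powr_less_mono2[of "2 * s" "1/4" 1] s by simp
  define c where "c = min (1/2) ((1 - (1/4) powr (2 * s)) powr (1 / (2 * s)))"
  have c: "0 < c" "c \<le> 1/2" "c \<le> (1 - (1/4) powr (2 * s)) powr (1 / (2 * s))"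
    using q by (auto simp: c_def)
  have "c powr (2 * s) \<le> ((1 - (1/4) powr (2 * s)) powr (1 / (2 * s))) powr (2 * s)"
    using c s by (intro powr_mono2) auto
  also have "\<dots> = 1 - (1/4) powr (2 * s)" unfolding powr_powr using s q by simp
  finally show ?thesis using c by (intro exI[of _ c]) auto
qed

lemma bounded_borel_sup_norm:
  assumes "u \<in> bounded_borel S" "p \<in> S"
  shows "\<bar>u p\<bar> \<le> sup_norm S u"
proof -
  obtain N where "\<And>q. q \<in> S \<Longrightarrow> norm (u q) \<le> N"
    using assms(1) unfolding bounded_borel_def bounded_iff by blast
  then have "bdd_above ((\<lambda>p. \<bar>u p\<bar>) ` S)" by (auto intro!: bdd_aboveI2[where M = N])
  then show ?thesis unfolding sup_norm_def by (rule cSUP_upper[OF assms(2)])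
qed

text \<open>For two points at distance \<open>D\<close>, the iteration is centred at the later one and run until the radius
\<open>\<sigma>^j * r0\<close> is comparable to \<open>D\<close>. Since \<open>D > \<rho>\<close>, all radii used are above \<open>\<rho>\<close>.\<close>

lemma holder_estimate:
  fixes s lam Lam B1 :: real
  assumes s: "0 < s" "s < 1" and lam: "0 < lam" and Lam: "0 < Lam" and B1: "0 \<le> B1"
  shows "\<exists>\<alpha> C. 0 < \<alpha> \<and> \<alpha> < 2 * s \<and> 0 < C \<and>
    (\<forall>\<rho> A B R. \<forall>u :: (real^'n) \<times> real \<Rightarrow> real.
      0 \<le> \<rho> \<and> 0 \<le> A \<and> \<rho> < R \<and> (kernels s lam Lam \<rho> :: (real^'n \<Rightarrow> real) set) \<noteq> {} \<and>
      0 \<le> B \<and> (\<forall>r. 0 < r \<and> r \<le> R \<longrightarrow> B * r powr (2 * s - 1) \<le> B1) \<and>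
      drift_sub s lam Lam \<rho> B A R u \<and>
      drift_super s lam Lam \<rho> B A R u
      \<longrightarrow> holder_above s \<alpha> \<rho> (par_cyl s (R / 4)) u
            \<le> ereal (C / R powr \<alpha> * (sup_norm (UNIV \<times> time_interval s R) u + R powr (2 * s) * A)))"
proof -
  from oscillation_step[OF s lam Lam B1, where 'n='n]
  obtain \<eta> \<sigma> \<alpha> where \<eta>: "0 < \<eta>" and \<sigma>: "0 < \<sigma>" "\<sigma> < 1" and \<alpha>: "0 < \<alpha>" "\<alpha> < 2 * s"
    and step: "\<forall>\<rho> A B R r (x0 :: real^'n) t0 u lo \<omega>.
      drift_sub s lam Lam \<rho> B A R u \<and>
      drift_super s lam Lam \<rho> B A R u \<and>
      admissible_scale s lam Lam \<rho> B B1 R r x0 t0 \<and>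
      0 < \<omega> \<and> A * r powr (2 * s) \<le> \<eta> * (\<omega> / 2) \<and> osc_inv s \<sigma> \<alpha> u x0 t0 r lo \<omega>
      \<longrightarrow> (\<exists>lo'. osc_inv s \<sigma> \<alpha> u x0 t0 (\<sigma> * r) lo' (\<sigma> powr \<alpha> * \<omega>))"
    by (elim exE conjE) (rule that; assumption)
  obtain c where c: "0 < c" "c \<le> 1/2" "(1/4) powr (2 * s) + c powr (2 * s) \<le> 1"
    using inner_radius_factor[OF s(1)] by blast
  define C where "C = 2 * (1 + 1 / \<eta>) / (\<sigma> * c) powr \<alpha>"
  have C: "0 < C" using \<eta> \<sigma> c by (simp add: C_def add_pos_pos)
  show ?thesis
  proof (rule exI[of _ \<alpha>], rule exI[of _ C], intro conjI allI impI \<alpha> C, elim conjE)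
    fix \<rho> A B R :: real and u :: "(real^'n) \<times> real \<Rightarrow> real"
    assume \<rho>: "0 \<le> \<rho>" "\<rho> < R" and A: "0 \<le> A" and ne: "(kernels s lam Lam \<rho> :: (real^'n \<Rightarrow> real) set) \<noteq> {}"
      and B: "0 \<le> B" "\<forall>r. 0 < r \<and> r \<le> R \<longrightarrow> B * r powr (2 * s - 1) \<le> B1"
      and vs: "drift_sub s lam Lam \<rho> B A R u"
      and vu: "drift_super s lam Lam \<rho> B A R u"
    let ?I = "time_interval s R"
    define n where "n = sup_norm (UNIV \<times> ?I) u"
    define r0 where "r0 = c * R"
    have R: "0 < R" using \<rho> by linarith
    have r0: "0 < r0" "r0 \<le> R / 2" using c R by (auto simp: r0_def)
    have "u \<in> bounded_borel (UNIV \<times> ?I)" using vs by (simp add: visc_sub_def)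
    note ub = bounded_borel_sup_norm[OF this, folded n_def]
    have n0: "0 \<le> n" using ub[of "(0, 0)"] R by (simp add: time_interval_def)
    have R4: "(R / 4) powr (2 * s) + r0 powr (2 * s) \<le> R powr (2 * s)"
    proof -
      have "((1/4) powr (2 * s) + c powr (2 * s)) * R powr (2 * s) \<le> 1 * R powr (2 * s)"
        by (rule mult_right_mono[OF c(3)]) simp
      moreover have "(R / 4) powr (2 * s) = (1/4) powr (2 * s) * R powr (2 * s)"
        unfolding powr_mult[symmetric] by simp
      moreover have "r0 powr (2 * s) = c powr (2 * s) * R powr (2 * s)"
        unfolding r0_def by (rule powr_mult)
      ultimately show ?thesis by (simp add: distrib_right)
    qed
    have decay: "\<exists>lo. osc_inv s \<sigma> \<alpha> u x0 t0 (\<sigma> ^ j * r0) lo ((\<sigma> powr \<alpha>) ^ j * (2 * N))"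
      if x0: "norm x0 < R / 4" and t0: "- ((R / 4) powr (2 * s)) < t0" "t0 \<le> 0"
        and N: "0 < N" "n \<le> N" "A * R powr (2 * s) \<le> \<eta> * N" and j: "\<forall>i<j. \<rho> \<le> \<sigma> ^ i * r0"
      for x0 :: "real^'n" and t0 N :: real and j :: nat
      using j
    proof (induction j)
      case 0
      have "osc_inv s \<sigma> \<alpha> u x0 t0 r0 (- N) (2 * N)"
        unfolding osc_inv_def
      proof (intro allI impI)
        fix x :: "real^'n" and t assume t: "t0 - r0 powr (2 * s) \<le> t \<and> t \<le> t0"
        then have "(x, t) \<in> UNIV \<times> ?I" using t0 R4 by (auto simp: time_interval_def)
        then have u: "\<bar>u (x, t)\<bar> \<le> N" using ub[of "(x, t)"] N by linarith
        have "2 * N * 1 \<le> 2 * N * (norm (x - x0) / (\<sigma> * r0)) powr \<alpha>" if "r0 \<le> norm (x - x0)"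
        proof (intro mult_left_mono ge_one_powr_ge_zero)
          have "\<sigma> * r0 \<le> 1 * r0" using \<sigma> r0 by (intro mult_right_mono) auto
          then have "\<sigma> * r0 \<le> norm (x - x0)" using that by linarith
          then show "1 \<le> norm (x - x0) / (\<sigma> * r0)" using \<sigma> r0 by simp
        qed (use N \<alpha> in auto)
        then show "(norm (x - x0) < r0 \<longrightarrow> - N \<le> u (x, t) \<and> u (x, t) \<le> - N + 2 * N) \<and>
          (r0 \<le> norm (x - x0) \<longrightarrow>
            - N + 2 * N - 2 * N * (norm (x - x0) / (\<sigma> * r0)) powr \<alpha> \<le> u (x, t) \<and>
            u (x, t) \<le> - N + 2 * N * (norm (x - x0) / (\<sigma> * r0)) powr \<alpha>)"
          using u unfolding abs_le_iff by linarith
      qed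
      then show ?case by auto
    next
      case (Suc j)
      define r where "r = \<sigma> ^ j * r0"
      define \<omega> where "\<omega> = (\<sigma> powr \<alpha>) ^ j * (2 * N)"
      obtain lo where lo: "osc_inv s \<sigma> \<alpha> u x0 t0 r lo \<omega>"
        using Suc unfolding r_def \<omega>_def by auto
      have \<sigma>j: "0 < \<sigma> ^ j" "\<sigma> ^ j \<le> 1" using \<sigma> by (auto intro: power_le_one)
      have r: "0 < r" "r \<le> r0" using \<sigma>j r0 by (auto simp: r_def)
      have \<rho>r: "\<rho> \<le> r" using Suc.prems by (auto simp: r_def)
      have rR: "r \<le> R" using r r0 R by linarith
      have \<omega>: "0 < \<omega>" using \<sigma> N by (simp add: \<omega>_def)
      have rp: "r powr (2 * s) \<le> r0 powr (2 * s)" using r s by (intro powr_mono2) auto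
      have dom1: "norm x0 + r \<le> R" using x0 r r0 R by linarith
      have dom2: "- (R powr (2 * s)) < t0 - r powr (2 * s)" using t0 R4 rp by linarith
      have Br: "B * r powr (2 * s - 1) \<le> B1" using B(2) r rR by blast
      have Ar: "A * r powr (2 * s) \<le> \<eta> * (\<omega> / 2)"
      proof -
        have p: "(\<sigma> ^ j) powr (2 * s) \<le> (\<sigma> ^ j) powr \<alpha>"
          using \<sigma>j \<alpha> by (intro powr_mono') auto
        have pj: "(\<sigma> ^ j) powr \<alpha> = (\<sigma> powr \<alpha>) ^ j"
          using \<sigma> by (simp add: powr_power powr_realpow[symmetric] powr_powr mult.commute)
        have "r0 powr (2 * s) \<le> R powr (2 * s)" using r0 R s by (intro powr_mono2) auto
        then have "A * r powr (2 * s) \<le> A * ((\<sigma> ^ j) powr (2 * s) * R powr (2 * s))"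
          unfolding r_def powr_mult using A by (intro mult_left_mono) auto
        also have "\<dots> = (\<sigma> ^ j) powr (2 * s) * (A * R powr (2 * s))" by (simp only: mult_ac)
        also have "\<dots> \<le> (\<sigma> ^ j) powr \<alpha> * (\<eta> * N)"
          by (rule mult_mono[OF p N(3)]) (use A in auto)
        finally show ?thesis by (simp add: \<omega>_def pj mult_ac)
      qed
      have "\<exists>lo'. osc_inv s \<sigma> \<alpha> u x0 t0 (\<sigma> * r) lo' (\<sigma> powr \<alpha> * \<omega>)"
      proof -
        note d = step[THEN spec[of _ \<rho>], THEN spec[of _ A], THEN spec[of _ B], THEN spec[of _ R],
          THEN spec[of _ r], THEN spec[of _ x0], THEN spec[of _ t0], THEN spec[of _ u],
          THEN spec[of _ lo], THEN spec[of _ \<omega>], THEN mp]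
        show ?thesis by (rule d) (intro conjI vs vu ne \<rho>(1) \<rho>r r(1) B(1) Br dom1 dom2 t0(2) \<omega> Ar lo)
      qed
      then show ?case by (simp add: r_def \<omega>_def mult.assoc)
    qed
    have close: "\<bar>u (x0, t0) - u (y, \<tau>)\<bar> \<le> 2 * N * (par_dist s (x0, t0) (y, \<tau>) / (\<sigma> * r0)) powr \<alpha>"
      if x0: "norm x0 < R / 4" and t0: "- ((R / 4) powr (2 * s)) < t0" "t0 \<le> 0"
        and \<tau>: "- ((R / 4) powr (2 * s)) < \<tau>" "\<tau> \<le> t0" and d: "\<rho> < par_dist s (x0, t0) (y, \<tau>)"
        and N: "0 < N" "n \<le> N" "A * R powr (2 * s) \<le> \<eta> * N" for x0 y :: "real^'n" and t0 \<tau> N :: real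
    proof -
      define D where "D = par_dist s (x0, t0) (y, \<tau>)"
      have D: "0 < D" "\<rho> < D" using d \<rho> by (auto simp: D_def)
      show ?thesis
      proof (cases "r0 \<le> D")
        case True
        have "(R / 4) powr (2 * s) \<le> R powr (2 * s)" using R4 by (smt (verit) powr_ge_zero)
        then have "(x0, t0) \<in> UNIV \<times> ?I" "(y, \<tau>) \<in> UNIV \<times> ?I"
          using t0 \<tau> by (auto simp: time_interval_def)
        then have "\<bar>u (x0, t0) - u (y, \<tau>)\<bar> \<le> 2 * N * 1" using ub N(2) by (smt (verit))
        also have "\<dots> \<le> 2 * N * (D / (\<sigma> * r0)) powr \<alpha>"
        proof (intro mult_left_mono ge_one_powr_ge_zero)
          have "\<sigma> * r0 \<le> 1 * r0" using \<sigma> r0 by (intro mult_right_mono) auto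
          then have "\<sigma> * r0 \<le> D" using True by linarith
          then show "1 \<le> D / (\<sigma> * r0)" using \<sigma> r0 by simp
        qed (use N \<alpha> in auto)
        finally show ?thesis by (simp add: D_def)
      next
        case False
        \<comment> \<open>The first radius that is not larger than \<open>D\<close>; the iteration uses the one before.\<close>
        define k where "k = (LEAST k. \<sigma> ^ k * r0 \<le> D)"
        obtain k0 where "\<sigma> ^ k0 < D / r0" using real_arch_pow_inv[of "D / r0" \<sigma>] D r0 \<sigma> by auto
        then have "\<sigma> ^ k0 * r0 \<le> D" using r0 by (simp add: field_simps)
        then have k: "\<sigma> ^ k * r0 \<le> D" unfolding k_def by (rule LeastI)
        have below: "D < \<sigma> ^ i * r0" if "i < k" for i
          using not_less_Least[of i "\<lambda>k. \<sigma> ^ k * r0 \<le> D"] that unfolding k_def by auto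
        have "k \<noteq> 0" using k False by (cases k) auto
        then obtain j where j: "k = Suc j" by (cases k) auto
        have Dj: "D < \<sigma> ^ j * r0" by (rule below) (simp add: j)
        have "\<forall>i<j. \<rho> \<le> \<sigma> ^ i * r0" using below D(2) j by (meson less_SucI less_imp_le less_trans)
        from decay[OF x0 t0 N this] obtain lo where
          lo: "osc_inv s \<sigma> \<alpha> u x0 t0 (\<sigma> ^ j * r0) lo ((\<sigma> powr \<alpha>) ^ j * (2 * N))" by blast
        have dist1: "norm (y - x0) < \<sigma> ^ j * r0"
          using Dj by (simp add: D_def par_dist_def norm_minus_commute)
        have dist2: "t0 - (\<sigma> ^ j * r0) powr (2 * s) \<le> \<tau>"
        proof -
          have "\<bar>t0 - \<tau>\<bar> powr (1 / (2 * s)) \<le> \<sigma> ^ j * r0" using Dj by (simp add: D_def par_dist_def)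
          then have "(\<bar>t0 - \<tau>\<bar> powr (1 / (2 * s))) powr (2 * s) \<le> (\<sigma> ^ j * r0) powr (2 * s)"
            using s by (intro powr_mono2) auto
          then have "\<bar>t0 - \<tau>\<bar> \<le> (\<sigma> ^ j * r0) powr (2 * s)" unfolding powr_powr using s by simp
          then show ?thesis by linarith
        qed
        have pos: "0 < \<sigma> ^ j * r0" using \<sigma> r0 by simp
        have "lo \<le> u (x0, t0)" "u (x0, t0) \<le> lo + (\<sigma> powr \<alpha>) ^ j * (2 * N)"
          "lo \<le> u (y, \<tau>)" "u (y, \<tau>) \<le> lo + (\<sigma> powr \<alpha>) ^ j * (2 * N)"
          using lo pos dist1 dist2 \<tau>(2) unfolding osc_inv_def by auto
        then have "\<bar>u (x0, t0) - u (y, \<tau>)\<bar> \<le> (\<sigma> powr \<alpha>) ^ j * (2 * N)" by linarith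
        also have "(\<sigma> powr \<alpha>) ^ j = (\<sigma> ^ j) powr \<alpha>"
          using \<sigma> by (simp add: powr_power powr_realpow[symmetric] powr_powr mult.commute)
        also have "(\<sigma> ^ j) powr \<alpha> * (2 * N) \<le> (D / (\<sigma> * r0)) powr \<alpha> * (2 * N)"
        proof (intro mult_right_mono powr_mono2)
          show "\<sigma> ^ j \<le> D / (\<sigma> * r0)" using k \<sigma> r0 by (simp add: j field_simps)
        qed (use \<sigma> \<alpha> N in auto)
        finally show ?thesis by (simp add: D_def mult.commute)
      qed
    qed
    define E where "E = n + R powr (2 * s) * A"
    have E: "0 \<le> E" using n0 A by (simp add: E_def)
    have est: "\<bar>u p - u q\<bar> \<le> C / R powr \<alpha> * E * par_dist s p q powr \<alpha>"
      if p: "p \<in> par_cyl s (R / 4)" and q: "q \<in> par_cyl s (R / 4)" and d: "\<rho> < par_dist s p q"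
        and le: "snd q \<le> snd p" for p q
    proof (rule field_le_epsilon)
      fix e :: real assume e: "0 < e"
      define X where "X = (par_dist s p q / (\<sigma> * r0)) powr \<alpha>"
      have X: "0 < X" using d \<rho> \<sigma> r0 by (simp add: X_def)
      \<comment> \<open>The summand with \<open>e\<close> makes \<open>N\<close> positive also if \<open>E = 0\<close>.\<close>
      define N where "N = (1 + 1 / \<eta>) * E + e / (2 * X)"
      have ie: "0 < 1 / \<eta>" using \<eta> by simp
      have N: "0 < N" "n \<le> N" "A * R powr (2 * s) \<le> \<eta> * N"
      proof -
        have e': "0 < e / (2 * X)" using e X by simp
        have "0 \<le> 1 / \<eta> * E" using ie E by simp
        then show "0 < N" using E e' unfolding N_def distrib_right by linarith
        have "n \<le> E" using A by (simp add: E_def)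
        then show "n \<le> N" using e' \<open>0 \<le> 1 / \<eta> * E\<close> unfolding N_def distrib_right by linarith
        have "E \<le> N * \<eta>"
        proof -
          have "1 / \<eta> * E \<le> N" using E e' unfolding N_def distrib_right by linarith
          then have "1 / \<eta> * E * \<eta> \<le> N * \<eta>" using \<eta> by (intro mult_right_mono) auto
          then show ?thesis using \<eta> by simp
        qed
        moreover have "A * R powr (2 * s) \<le> E" using n0 by (simp add: E_def mult.commute)
        ultimately show "A * R powr (2 * s) \<le> \<eta> * N" by (simp add: mult.commute)
      qed
      obtain x0 t0 y \<tau> where pq: "p = (x0, t0)" "q = (y, \<tau>)" by (cases p, cases q)
      have "\<bar>u p - u q\<bar> \<le> 2 * N * X"
        unfolding X_def pq using p q d le N
        by (intro close) (auto simp: par_cyl_def time_interval_def pq)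
      also have "\<dots> = 2 * (1 + 1 / \<eta>) * E * X + e"
        using X by (simp add: N_def distrib_right distrib_left)
      also have "2 * (1 + 1 / \<eta>) * E * X = C / R powr \<alpha> * E * par_dist s p q powr \<alpha>"
      proof -
        have "X = par_dist s p q powr \<alpha> / ((\<sigma> * c) powr \<alpha> * R powr \<alpha>)"
          unfolding X_def r0_def powr_divide powr_mult[symmetric] by (simp only: mult.assoc)
        then show ?thesis by (simp add: C_def)
      qed
      finally show "\<bar>u p - u q\<bar> \<le> C / R powr \<alpha> * E * par_dist s p q powr \<alpha> + e" .
    qed
    have sym: "par_dist s p q = par_dist s q p" for p q :: "(real^'n) \<times> real"
      by (simp add: par_dist_def norm_minus_commute abs_minus_commute)
    show "holder_above s \<alpha> \<rho> (par_cyl s (R / 4)) u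
       \<le> ereal (C / R powr \<alpha> * (sup_norm (UNIV \<times> ?I) u + R powr (2 * s) * A))"
      unfolding holder_above_def n_def[symmetric] E_def[symmetric]
    proof (rule SUP_least)
      fix z :: "((real^'n) \<times> real) \<times> ((real^'n) \<times> real)"
      assume "z \<in> {(p, q). p \<in> par_cyl s (R / 4) \<and> q \<in> par_cyl s (R / 4) \<and> \<rho> < par_dist s p q}"
      then obtain p q where z: "z = (p, q)" and p: "p \<in> par_cyl s (R / 4)" and q: "q \<in> par_cyl s (R / 4)"
        and d: "\<rho> < par_dist s p q" by auto
      have "\<bar>u p - u q\<bar> \<le> C / R powr \<alpha> * E * par_dist s p q powr \<alpha>"
      proof (cases "snd q \<le> snd p")
        case True
        then show ?thesis by (rule est[OF p q d])
      next
        case False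
        then have "\<bar>u q - u p\<bar> \<le> C / R powr \<alpha> * E * par_dist s q p powr \<alpha>"
          using d sym[of p q] by (intro est[OF q p]) auto
        then show ?thesis using sym[of p q] by (simp add: abs_minus_commute)
      qed
      moreover have "0 < par_dist s p q powr \<alpha>" using d \<rho> by simp
      ultimately have "\<bar>u p - u q\<bar> / par_dist s p q powr \<alpha> \<le> C / R powr \<alpha> * E"
        by (simp add: pos_divide_le_eq)
      then show "(case z of (p, q) \<Rightarrow> ereal (\<bar>u p - u q\<bar> / par_dist s p q powr \<alpha>)) \<le> ereal (C / R powr \<alpha> * E)"
        by (simp add: z)
    qed
  qed
qed

theorem corollary3p4:
  fixes s lam Lam :: real
  assumes "0 < s" "s < 1" "0 < lam" "0 < Lam"
  shows
    "(\<forall>R0>0. \<exists>\<alpha> C. 0 < \<alpha> \<and> \<alpha> < 2 * s \<and> 0 < C \<and>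
        (\<forall>\<rho> A R. \<forall>u :: (real^'n) \<times> real \<Rightarrow> real.
           0 \<le> \<rho> \<and> 0 \<le> A \<and> \<rho> < R \<and> R \<le> R0 \<and> 2 * \<rho> < R \<and>
           (kernels s lam Lam \<rho> :: (real^'n \<Rightarrow> real) set) \<noteq> {} \<and>
           u \<in> bounded_borel (UNIV \<times> time_interval s R) \<and>
           (s \<ge> 1 / 2 \<and> solves_with_drift s lam Lam \<rho> A R u \<or>
            solves_without_drift s lam Lam \<rho> A R u) \<longrightarrow>
           holder_above s \<alpha> \<rho> (par_cyl s (R / 4)) u
             \<le> ereal (C / R powr \<alpha> *
                  (sup_norm (UNIV \<times> time_interval s R) u + R powr (2 * s) * A))))
     \<and>
     (\<exists>\<alpha> C. 0 < \<alpha> \<and> \<alpha> < 2 * s \<and> 0 < C \<and>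
        (\<forall>R0>0. \<forall>\<rho> A R. \<forall>u :: (real^'n) \<times> real \<Rightarrow> real.
           0 \<le> \<rho> \<and> 0 \<le> A \<and> \<rho> < R \<and> R \<le> R0 \<and> 2 * \<rho> < R \<and>
           (kernels s lam Lam \<rho> :: (real^'n \<Rightarrow> real) set) \<noteq> {} \<and>
           u \<in> bounded_borel (UNIV \<times> time_interval s R) \<and>
           solves_without_drift s lam Lam \<rho> A R u \<longrightarrow>
           holder_above s \<alpha> \<rho> (par_cyl s (R / 4)) u
             \<le> ereal (C / R powr \<alpha> *
                  (sup_norm (UNIV \<times> time_interval s R) u + R powr (2 * s) * A))))"

proof (intro conjI allI impI, goal_cases)
  case (1 R0)
  have "0 \<le> Lam * R0 powr (2 * s - 1)" using assms by simp
  from holder_estimate[OF assms this, where 'n='n]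
  obtain \<alpha> C where \<alpha>: "0 < \<alpha>" "\<alpha> < 2 * s" "0 < C"
    and est: "\<And>\<rho> A B R. \<And>u :: (real^'n) \<times> real \<Rightarrow> real.
      0 \<le> \<rho> \<and> 0 \<le> A \<and> \<rho> < R \<and> (kernels s lam Lam \<rho> :: (real^'n \<Rightarrow> real) set) \<noteq> {} \<and>
      0 \<le> B \<and> (\<forall>r. 0 < r \<and> r \<le> R \<longrightarrow> B * r powr (2 * s - 1) \<le> Lam * R0 powr (2 * s - 1)) \<and>
      drift_sub s lam Lam \<rho> B A R u \<and>
      drift_super s lam Lam \<rho> B A R u
      \<Longrightarrow> holder_above s \<alpha> \<rho> (par_cyl s (R / 4)) u
            \<le> ereal (C / R powr \<alpha> * (sup_norm (UNIV \<times> time_interval s R) u + R powr (2 * s) * A))"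
    by blast
  show ?case
  proof (rule exI[of _ \<alpha>], rule exI[of _ C], intro conjI allI impI \<alpha>, elim conjE disjE)
    fix \<rho> A R :: real and u :: "(real^'n) \<times> real \<Rightarrow> real"
    assume *: "0 \<le> \<rho>" "0 \<le> A" "\<rho> < R" "R \<le> R0" "(kernels s lam Lam \<rho> :: (real^'n \<Rightarrow> real) set) \<noteq> {}"
      and sh: "1 / 2 \<le> s" and drift: "solves_with_drift s lam Lam \<rho> A R u"
    have "Lam * r powr (2 * s - 1) \<le> Lam * R0 powr (2 * s - 1)" if "0 < r" "r \<le> R" for r
      using that * sh assms by (intro mult_left_mono powr_mono2) auto
    then show "holder_above s \<alpha> \<rho> (par_cyl s (R / 4)) u
       \<le> ereal (C / R powr \<alpha> * (sup_norm (UNIV \<times> time_interval s R) u + R powr (2 * s) * A))"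
      using * drift assms unfolding solves_with_drift_def by (intro est[of _ _ _ Lam]) auto
  next
    fix \<rho> A R :: real and u :: "(real^'n) \<times> real \<Rightarrow> real"
    assume *: "0 \<le> \<rho>" "0 \<le> A" "\<rho> < R" "(kernels s lam Lam \<rho> :: (real^'n \<Rightarrow> real) set) \<noteq> {}"
      and "solves_without_drift s lam Lam \<rho> A R u"
    then show "holder_above s \<alpha> \<rho> (par_cyl s (R / 4)) u
       \<le> ereal (C / R powr \<alpha> * (sup_norm (UNIV \<times> time_interval s R) u + R powr (2 * s) * A))"
      using assms unfolding solves_without_drift_def by (intro est[of _ _ _ 0]) auto
  qed
next
  case 2
  from holder_estimate[OF assms order_refl, where 'n='n]
  obtain \<alpha> C where \<alpha>: "0 < \<alpha>" "\<alpha> < 2 * s" "0 < C"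
    and est: "\<And>\<rho> A B R. \<And>u :: (real^'n) \<times> real \<Rightarrow> real.
      0 \<le> \<rho> \<and> 0 \<le> A \<and> \<rho> < R \<and> (kernels s lam Lam \<rho> :: (real^'n \<Rightarrow> real) set) \<noteq> {} \<and>
      0 \<le> B \<and> (\<forall>r. 0 < r \<and> r \<le> R \<longrightarrow> B * r powr (2 * s - 1) \<le> 0) \<and>
      drift_sub s lam Lam \<rho> B A R u \<and>
      drift_super s lam Lam \<rho> B A R u
      \<Longrightarrow> holder_above s \<alpha> \<rho> (par_cyl s (R / 4)) u
            \<le> ereal (C / R powr \<alpha> * (sup_norm (UNIV \<times> time_interval s R) u + R powr (2 * s) * A))"
    by blast
  show ?case
  proof (rule exI[of _ \<alpha>], rule exI[of _ C], intro conjI allI impI \<alpha>, elim conjE)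
    fix \<rho> A R :: real and u :: "(real^'n) \<times> real \<Rightarrow> real"
    assume "0 \<le> \<rho>" "0 \<le> A" "\<rho> < R" "(kernels s lam Lam \<rho> :: (real^'n \<Rightarrow> real) set) \<noteq> {}"
      and "solves_without_drift s lam Lam \<rho> A R u"
    then show "holder_above s \<alpha> \<rho> (par_cyl s (R / 4)) u
       \<le> ereal (C / R powr \<alpha> * (sup_norm (UNIV \<times> time_interval s R) u + R powr (2 * s) * A))"
      unfolding solves_without_drift_def by (intro est[of _ _ _ 0]) auto
  qed
qed

end
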